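(* Let $(\mathcal V,\mathcal L,\{\mathcal L_v\}_{v\in\mathcal V},\theta)$ be a feasible instance of the linear assignment problem (LAP), let $(\alpha,\beta)$ be an arbitrary optimal solution of its dual linear program (D), and let $x\colon\mathcal V\to\mathcal L$ be an assignment optimal for the LAP. Then Algorithm A (described in the context), run on this input, returns an optimal solution of (D) that lies in the relative interior of the set of optimal solutions of (D). Moreover, the time complexity of Algorithm A is $O\big(\sum_{v\in\mathcal V}|\mathcal L_v|\big)$, i.e., linear in the size of the input.
   Context: **LAP.** $\mathcal V$ (vertices) and $\mathcal L$ (labels) are finite disjoint sets with $|\mathcal V|=|\mathcal L|$. For each $v\in\mathcal V$, $\mathcal L_v\subseteq\mathcal L$ is the set of allowed labels and $\theta_v\colon\mathcal L_v\to\mathbb R$ is a cost function. A feasible assignment is a bijection $x\colon\mathcal V\to\mathcal L$ (written $v\mapsto x_v$) with $x_v\in\mathcal L_v$ for all $v$; the LAP minimizes $\sum_{v\in\mathcal V}\theta_v(x_v)$ over feasible assignments. The LAP is assumed feasible. **Dual LP (D).** Maximize $\sum_{v\in\mathcal V}\alpha_v+\sum_{\ell\in\mathcal L}\beta_\ell$ over $\alpha\in\mathbb R^{\mathcal V}$, $\beta\in\mathbb R^{\mathcal L}$ subject to $\alpha_v+\beta_\ell\le\theta_v(\ell)$ for all $v\in\mathcal V$, $\ell\in\mathcal L_v$. **Graphs.** For $(\alpha,\beta)$ feasible for (D), $\mathcal E(\alpha,\beta)=\{\{v,\ell\}\mid v\in\mathcal V,\ \ell\in\mathcal L_v,\ \alpha_v+\beta_\ell=\theta_v(\ell)\}$.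 For a set $\mathcal E$ of pairs $\{v,\ell\}$ with $v\in\mathcal V$, $\ell\in\mathcal L_v$, let $\mathcal F_x(\mathcal E)=\{(u,v)\mid u,v\in\mathcal V,\ u\ne v,\ \{u,x_v\}\in\mathcal E\}$, the edge set of a directed graph on $\mathcal V$. The condensation of a directed graph has its strongly connected components (identified with their vertex sets) as vertices, and an edge $(V_i,V_j)$, $i\neq j$, iff the graph has an edge from some vertex of $V_i$ to some vertex of $V_j$. **Algorithm A.** Input: the LAP instance, an optimal solution $(\alpha,\beta)$ of (D), an optimal assignment $x$. 1. Compute $\mathcal F:=\mathcal F_x(\mathcal E(\alpha,\beta))$. 2. Compute the strongly connected components and the condensation of $(\mathcal V,\mathcal F)$. 3. Find a topological ordering $V_1,\dots,V_n$ of the condensation (every edge of the condensation goes from an earlier to a later component). 4. For $i=n,n-1,\dots,1$: if $V_i$ has at least one ingoing edge in the condensation computed in step 2, then with $L_i=\{x_v\mid v\in V_i\}$ and the current values of $(\alpha,\beta)$ set $\delta=\min\{\theta_v(\ell)-\alpha_v-\beta_\ell\mid v\in V_i,\ \ell\in\mathcal L_v\setminus L_i\}$ if this set is non-empty and $\delta=1$ otherwise, and update $\alpha_v:=\alpha_v+\delta/2$ for all $v\in V_i$ and $\beta_\ell:=\beta_\ell-\delta/2$ for all $\ell\in L_i$. 5. Return $(\alpha,\beta)$. Time complexity counts elementary operations (arithmetic operations and comparisons on costs and dual variables at unit cost), with the sets $\mathcal L_v$ given as lists. *)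

theory Defs
  imports "HOL-Analysis.Analysis" "Graph_Theory.Graph_Theory"
begin

section \<open>The linear assignment problem and its dual\<close>

(* Vertices and labels live in different types, so the two sets are disjoint by construction and
   an unordered pair of a vertex and a label can be written as an ordered one. *)
record ('v, 'l) lap =
  vertices :: "'v set"
  labels :: "'l set"
  allowed :: "'v \<Rightarrow> 'l set"
  cost :: "'v \<Rightarrow> 'l \<Rightarrow> real"

type_synonym ('v, 'l) dual = "('v \<Rightarrow> real) \<times> ('l \<Rightarrow> real)"

definition lap_instance :: "('v, 'l) lap \<Rightarrow> bool" where
  "lap_instance I \<longleftrightarrow>
     finite (vertices I) \<and> finite (labels I) \<and> card (vertices I) = card (labels I) \<and>
     (\<forall>v\<in>vertices I. allowed I v \<subseteq> labels I)"

definition assignment :: "('v, 'l) lap \<Rightarrow> ('v \<Rightarrow> 'l) \<Rightarrow> bool" where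
  "assignment I x \<longleftrightarrow>
     bij_betw x (vertices I) (labels I) \<and> (\<forall>v\<in>vertices I. x v \<in> allowed I v)"

definition lap_feasible :: "('v, 'l) lap \<Rightarrow> bool" where
  "lap_feasible I \<longleftrightarrow> (\<exists>x. assignment I x)"

definition assignment_cost :: "('v, 'l) lap \<Rightarrow> ('v \<Rightarrow> 'l) \<Rightarrow> real" where
  "assignment_cost I x = (\<Sum>v\<in>vertices I. cost I v (x v))"

definition optimal_assignment :: "('v, 'l) lap \<Rightarrow> ('v \<Rightarrow> 'l) \<Rightarrow> bool" where
  "optimal_assignment I x \<longleftrightarrow>
     assignment I x \<and> (\<forall>y. assignment I y \<longrightarrow> assignment_cost I x \<le> assignment_cost I y)"

definition dual_feasible :: "('v, 'l) lap \<Rightarrow> ('v, 'l) dual \<Rightarrow> bool" where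
  "dual_feasible I = (\<lambda>(\<alpha>, \<beta>). \<forall>v\<in>vertices I. \<forall>l\<in>allowed I v. \<alpha> v + \<beta> l \<le> cost I v l)"

definition dual_value :: "('v, 'l) lap \<Rightarrow> ('v, 'l) dual \<Rightarrow> real" where
  "dual_value I = (\<lambda>(\<alpha>, \<beta>). (\<Sum>v\<in>vertices I. \<alpha> v) + (\<Sum>l\<in>labels I. \<beta> l))"

definition dual_optimal :: "('v, 'l) lap \<Rightarrow> ('v, 'l) dual \<Rightarrow> bool" where
  "dual_optimal I d \<longleftrightarrow>
     dual_feasible I d \<and> (\<forall>d'. dual_feasible I d' \<longrightarrow> dual_value I d' \<le> dual_value I d)"

(* The point of R^V x R^L given by d. The finite types 'v and 'l may be larger than the sets of
   vertices and labels; R^V x R^L is then the coordinate subspace in which the other coordinates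
   vanish, and values of d outside these sets are irrelevant. *)
definition dual_vec ::
  "('v::finite, 'l::finite) lap \<Rightarrow> ('v, 'l) dual \<Rightarrow> (real ^ 'v) \<times> (real ^ 'l)" where
  "dual_vec I = (\<lambda>(\<alpha>, \<beta>).
     (\<chi> v. if v \<in> vertices I then \<alpha> v else 0, \<chi> l. if l \<in> labels I then \<beta> l else 0))"


section \<open>Algorithm A\<close>

definition tight_edges :: "('v, 'l) lap \<Rightarrow> ('v, 'l) dual \<Rightarrow> ('v \<times> 'l) set" where
  "tight_edges I = (\<lambda>(\<alpha>, \<beta>).
     {(v, l). v \<in> vertices I \<and> l \<in> allowed I v \<and> \<alpha> v + \<beta> l = cost I v l})"

definition exchange_graph ::
  "('v, 'l) lap \<Rightarrow> ('v \<Rightarrow> 'l) \<Rightarrow> ('v \<times> 'l) set \<Rightarrow> 'v pair_pre_digraph" where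
  "exchange_graph I x E =
     \<lparr>pverts = vertices I,
      parcs = {(u, v). u \<in> vertices I \<and> v \<in> vertices I \<and> u \<noteq> v \<and> (u, x v) \<in> E}\<rparr>"

definition condensation :: "'v pair_pre_digraph \<Rightarrow> 'v set pair_pre_digraph" where
  "condensation G =
     (let S = pre_digraph.sccs_verts (with_proj G) in
      \<lparr>pverts = S,
       parcs = {(A, B). A \<in> S \<and> B \<in> S \<and> A \<noteq> B \<and> (\<exists>a\<in>A. \<exists>b\<in>B. (a, b) \<in> parcs G)}\<rparr>)"

definition topological_ordering :: "'a pair_pre_digraph \<Rightarrow> 'a list \<Rightarrow> bool" where
  "topological_ordering G vs \<longleftrightarrow>
     distinct vs \<and> set vs = pverts G \<and>
     (\<forall>i<length vs. \<forall>j<length vs. (vs ! i, vs ! j) \<in> parcs G \<longrightarrow> i < j)"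

definition step_delta :: "('v, 'l) lap \<Rightarrow> ('v \<Rightarrow> 'l) \<Rightarrow> 'v set \<Rightarrow> ('v, 'l) dual \<Rightarrow> real" where
  "step_delta I x A = (\<lambda>(\<alpha>, \<beta>).
     let S = {cost I v l - \<alpha> v - \<beta> l | v l. v \<in> A \<and> l \<in> allowed I v - x ` A}
     in if S = {} then 1 else Min S)"

definition process_component ::
  "('v, 'l) lap \<Rightarrow> ('v \<Rightarrow> 'l) \<Rightarrow> 'v set pair_pre_digraph \<Rightarrow> 'v set \<Rightarrow> ('v, 'l) dual \<Rightarrow> ('v, 'l) dual"
  where
  "process_component I x K A = (\<lambda>(\<alpha>, \<beta>).
     if \<exists>B. (B, A) \<in> parcs K
     then (let \<delta> = step_delta I x A (\<alpha>, \<beta>)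
           in (\<lambda>v. if v \<in> A then \<alpha> v + \<delta> / 2 else \<alpha> v,
               \<lambda>l. if l \<in> x ` A then \<beta> l - \<delta> / 2 else \<beta> l))
     else (\<alpha>, \<beta>))"

definition input_graph ::
  "('v, 'l) lap \<Rightarrow> ('v, 'l) dual \<Rightarrow> ('v \<Rightarrow> 'l) \<Rightarrow> 'v pair_pre_digraph" where
  "input_graph I d x = exchange_graph I x (tight_edges I d)"

(* foldr applies the step for the last list element first. *)
definition process_all ::
  "('v, 'l) lap \<Rightarrow> ('v \<Rightarrow> 'l) \<Rightarrow> 'v set pair_pre_digraph \<Rightarrow> 'v set list \<Rightarrow> ('v, 'l) dual \<Rightarrow> ('v, 'l) dual"
  where
  "process_all I x K Vs d = foldr (process_component I x K) Vs d"

(* A relation between input and output, since the topological ordering is not determined. *)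
definition algorithm_A ::
  "('v, 'l) lap \<Rightarrow> ('v, 'l) dual \<Rightarrow> ('v \<Rightarrow> 'l) \<Rightarrow> ('v, 'l) dual \<Rightarrow> bool" where
  "algorithm_A I d x d' \<longleftrightarrow>
     (\<exists>Vs. topological_ordering (condensation (input_graph I d x)) Vs \<and>
           d' = process_all I x (condensation (input_graph I d x)) Vs d)"


section \<open>Random access programs with unit-cost real arithmetic\<close>

(* The memory has scalars and arrays holding naturals (indices) and reals (costs and dual
   variables). Every memory access, arithmetic operation, comparison, store and branch costs one
   unit. Naturals can only be added and subtracted, never multiplied, and reals cannot be converted
   to naturals, so that unit cost is the usual convention. Programs cannot inspect the size of an
   array and may not assume that memory outside the input is initialized. *)

record memory =
  nvar :: "string \<Rightarrow> nat"
  narr :: "string \<Rightarrow> nat \<Rightarrow> nat"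
  rvar :: "string \<Rightarrow> real"
  rarr :: "string \<Rightarrow> nat \<Rightarrow> real"

datatype nexp = NConst nat | NVar string | NArr string nexp | NAdd nexp nexp | NSub nexp nexp

datatype rexp = RConst int | RVar string | RArr string nexp
  | RAdd rexp rexp | RSub rexp rexp | RMul rexp rexp | RDiv rexp rexp

datatype bexp = NLess nexp nexp | RLess rexp rexp | Neg bexp | Conj bexp bexp

datatype com = Skip
  | NSet string nexp | NStore string nexp nexp
  | RSet string rexp | RStore string nexp rexp
  | Seq com com | Cond bexp com com | While bexp com

primrec nval :: "memory \<Rightarrow> nexp \<Rightarrow> nat" where
  "nval s (NConst k) = k"
| "nval s (NVar y) = nvar s y"
| "nval s (NArr a e) = narr s a (nval s e)"
| "nval s (NAdd e f) = nval s e + nval s f"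
| "nval s (NSub e f) = nval s e - nval s f"

primrec rval :: "memory \<Rightarrow> rexp \<Rightarrow> real" where
  "rval s (RConst k) = of_int k"
| "rval s (RVar y) = rvar s y"
| "rval s (RArr a e) = rarr s a (nval s e)"
| "rval s (RAdd e f) = rval s e + rval s f"
| "rval s (RSub e f) = rval s e - rval s f"
| "rval s (RMul e f) = rval s e * rval s f"
| "rval s (RDiv e f) = rval s e / rval s f"

primrec bval :: "memory \<Rightarrow> bexp \<Rightarrow> bool" where
  "bval s (NLess e f) \<longleftrightarrow> nval s e < nval s f"
| "bval s (RLess e f) \<longleftrightarrow> rval s e < rval s f"
| "bval s (Neg b) \<longleftrightarrow> \<not> bval s b"
| "bval s (Conj b c) \<longleftrightarrow> bval s b \<and> bval s c"

primrec ncost :: "nexp \<Rightarrow> nat" where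
  "ncost (NConst k) = 1"
| "ncost (NVar y) = 1"
| "ncost (NArr a e) = 1 + ncost e"
| "ncost (NAdd e f) = 1 + ncost e + ncost f"
| "ncost (NSub e f) = 1 + ncost e + ncost f"

primrec rcost :: "rexp \<Rightarrow> nat" where
  "rcost (RConst k) = 1"
| "rcost (RVar y) = 1"
| "rcost (RArr a e) = 1 + ncost e"
| "rcost (RAdd e f) = 1 + rcost e + rcost f"
| "rcost (RSub e f) = 1 + rcost e + rcost f"
| "rcost (RMul e f) = 1 + rcost e + rcost f"
| "rcost (RDiv e f) = 1 + rcost e + rcost f"

primrec bcost :: "bexp \<Rightarrow> nat" where
  "bcost (NLess e f) = 1 + ncost e + ncost f"
| "bcost (RLess e f) = 1 + rcost e + rcost f"
| "bcost (Neg b) = 1 + bcost b"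
| "bcost (Conj b c) = 1 + bcost b + bcost c"

(* exec c s t s': started in memory s, program c terminates after t units of time in memory s'. *)
inductive exec :: "com \<Rightarrow> memory \<Rightarrow> nat \<Rightarrow> memory \<Rightarrow> bool" where
  Skip: "exec Skip s 1 s"
| NSet: "exec (NSet y e) s (1 + ncost e) (s\<lparr>nvar := (nvar s)(y := nval s e)\<rparr>)"
| NStore: "exec (NStore a i e) s (1 + ncost i + ncost e)
    (s\<lparr>narr := (narr s)(a := (narr s a)(nval s i := nval s e))\<rparr>)"
| RSet: "exec (RSet y e) s (1 + rcost e) (s\<lparr>rvar := (rvar s)(y := rval s e)\<rparr>)"
| RStore: "exec (RStore a i e) s (1 + ncost i + rcost e)
    (s\<lparr>rarr := (rarr s)(a := (rarr s a)(nval s i := rval s e))\<rparr>)"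
| Seq: "exec c s t s' \<Longrightarrow> exec d s' u s'' \<Longrightarrow> exec (Seq c d) s (t + u) s''"
| CondTrue: "bval s b \<Longrightarrow> exec c s t s' \<Longrightarrow> exec (Cond b c d) s (1 + bcost b + t) s'"
| CondFalse: "\<not> bval s b \<Longrightarrow> exec d s t s' \<Longrightarrow> exec (Cond b c d) s (1 + bcost b + t) s'"
| WhileFalse: "\<not> bval s b \<Longrightarrow> exec (While b c) s (1 + bcost b) s"
| WhileTrue: "bval s b \<Longrightarrow> exec c s t s' \<Longrightarrow> exec (While b c) s' u s'' \<Longrightarrow>
    exec (While b c) s (1 + bcost b + t + u) s''"

inductive_cases exec_SkipE: "exec Skip s t s'"
inductive_cases exec_NSetE: "exec (NSet y e) s t s'"
inductive_cases exec_NStoreE: "exec (NStore a i e) s t s'"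
inductive_cases exec_RSetE: "exec (RSet y e) s t s'"
inductive_cases exec_RStoreE: "exec (RStore a i e) s t s'"
inductive_cases exec_SeqE: "exec (Seq c d) s t s'"
inductive_cases exec_CondE: "exec (Cond b c d) s t s'"
inductive_cases exec_WhileE: "exec (While b c) s t s'"

(* Hence existence of a run with a given property is a statement about the only run. *)
lemma exec_deterministic:
  "exec c s t s' \<Longrightarrow> exec c s u s'' \<Longrightarrow> u = t \<and> s'' = s'"
proof (induction arbitrary: u s'' rule: exec.induct)
  case Skip
  then show ?case by (auto elim: exec_SkipE)
next
  case NSet
  then show ?case by (auto elim: exec_NSetE)
next
  case NStore
  then show ?case by (auto elim: exec_NStoreE)
next
  case RSet
  then show ?case by (auto elim: exec_RSetE)
next
  case RStore
  then show ?case by (auto elim: exec_RStoreE)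
next
  case Seq
  from Seq.prems show ?case by (rule exec_SeqE) (metis Seq.IH)
next
  case CondTrue
  from CondTrue.prems show ?case by (rule exec_CondE) (auto simp: CondTrue.hyps(1) dest!: CondTrue.IH)
next
  case CondFalse
  from CondFalse.prems show ?case by (rule exec_CondE) (auto simp: CondFalse.hyps(1) dest!: CondFalse.IH)
next
  case WhileFalse
  from WhileFalse.prems show ?case by (rule exec_WhileE) (simp_all add: WhileFalse.hyps)
next
  case WhileTrue
  from WhileTrue.prems show ?case by (rule exec_WhileE) (auto simp: WhileTrue.hyps(1) dest!: WhileTrue.IH)
qed


section \<open>Algorithm A as a program\<close>

(* The encoded instances have vertices 0..n-1 and labels 0..n-1. The lists of allowed labels are
   stored consecutively: the entries for v start at position "first"[v] of "label" and "cost". *)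
definition encodes_input ::
  "memory \<Rightarrow> (nat, nat) lap \<Rightarrow> (nat \<Rightarrow> nat list) \<Rightarrow> (nat, nat) dual \<Rightarrow> (nat \<Rightarrow> nat) \<Rightarrow> bool" where
  "encodes_input s I Ls d x \<longleftrightarrow>
     vertices I = {..<nvar s ''n''} \<and> labels I = {..<nvar s ''n''} \<and>
     (\<forall>v\<in>vertices I. distinct (Ls v) \<and> set (Ls v) = allowed I v) \<and>
     (\<forall>v\<le>nvar s ''n''. narr s ''first'' v = (\<Sum>u<v. length (Ls u))) \<and>
     (\<forall>v\<in>vertices I. \<forall>k<length (Ls v).
        narr s ''label'' (narr s ''first'' v + k) = Ls v ! k \<and>
        rarr s ''cost'' (narr s ''first'' v + k) = cost I v (Ls v ! k)) \<and>
     (\<forall>v\<in>vertices I. narr s ''x'' v = x v \<and> rarr s ''alpha'' v = fst d v) \<and>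
     (\<forall>l\<in>labels I. rarr s ''beta'' l = snd d l)"

(* Edge lists in memory; repetitions are allowed. *)
definition listed_edges :: "memory \<Rightarrow> string \<Rightarrow> (nat \<times> nat) set" where
  "listed_edges s a =
     {(narr s (a @ ''_tail'') k, narr s (a @ ''_head'') k) | k. k < nvar s (a @ ''_size'')}"

definition component_of_index :: "memory \<Rightarrow> (nat, nat) lap \<Rightarrow> nat \<Rightarrow> nat set" where
  "component_of_index s I c = {v \<in> vertices I. narr s ''comp'' v = c}"

(* The programs P1, ..., P4 carry out the four steps of Algorithm A one after the other, in total
   time t, the result of each step being present in memory after the respective program. *)
definition runs_algorithm_A ::
  "com \<Rightarrow> com \<Rightarrow> com \<Rightarrow> com \<Rightarrow> memory \<Rightarrow> (nat, nat) lap \<Rightarrow> (nat, nat) dual \<Rightarrow> (nat \<Rightarrow> nat) \<Rightarrow> nat \<Rightarrow> bool"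
  where
  "runs_algorithm_A P1 P2 P3 P4 s I d x t \<longleftrightarrow>
     (\<exists>s1 s2 s3 s4 t1 t2 t3 t4 Vs d'.
        let G = input_graph I d x; K = condensation G; V = component_of_index s2 I;
            m = nvar s2 ''comp_count''
        in
        exec P1 s t1 s1 \<and>
        listed_edges s1 ''F'' = parcs G \<and>
        exec P2 s1 t2 s2 \<and>
        bij_betw V {..<m} (pverts K) \<and>
        map_prod V V ` listed_edges s2 ''cond'' = parcs K \<and>
        exec P3 s2 t3 s3 \<and>
        Vs = map (\<lambda>i. V (narr s3 ''order'' i)) [0..<m] \<and>
        topological_ordering K Vs \<and>
        exec P4 s3 t4 s4 \<and>
        d' = process_all I x K Vs d \<and>
        (\<forall>v\<in>vertices I. rarr s4 ''alpha'' v = fst d' v) \<and>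
        (\<forall>l\<in>labels I. rarr s4 ''beta'' l = snd d' l) \<and>
        t = t1 + t2 + t3 + t4)"

end

(*
Duality. If a pair (v, x v) is not tight for an optimal dual solution, then either v lies on a cycle
of tight pairs, along which x can be improved, or the vertices reachable from v admit an improving
shift of the dual solution. Hence the optimal dual solutions are exactly the feasible ones that are
tight on x, and an optimal solution lies in the relative interior of this polyhedron as soon as every
pair that is tight for it is tight for all optimal solutions. A tight pair inside a strongly connected
component has this property, because the potentials of two optimal solutions differ by a constant on
the component; a tight pair between different components is made strict when the component of its
label is processed, and stays strict because later steps use up at most half of its slack.

Running time. The strongly connected components are found by the path-based depth-first search of
Gabow: a stack of vertices is cut into blocks by a stack of boundaries, an edge back into the stack
removes boundaries, and a block without unscanned edges is a component. The components appear in
reverse topological order, which is the order in which Algorithm A processes them. Time is paid for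
by a potential.
*)

theory Submission
  imports Defs "HOL-Combinatorics.Cycles"
begin

section \<open>Strongly connected components and the condensation\<close>

text \<open>A point of a convex set is relatively interior iff every segment of the set ending there
  can be prolonged a little beyond it. Prolonging moves finitely many slacks, and a positive slack
  survives a short step, so only tight pairs can obstruct; hence everything is phrased through
  slacks. As \<open>x\<close> is a bijection, a label can be named by its partner vertex, and
  tightness on \<open>x\<close> turns label variables into vertex variables.

  The factor 1/2 of step 4 keeps pairs out of the component strict: subtracting all of \<delta>
  would make the minimizing pair tight again.

  Linear time needs constant-time answers to three questions: which vertex is the partner of a label
  (\<open>xinv\<close>), which edges leave a vertex (the edge list is grouped by tail, with offsets
  \<open>fstart\<close>), which vertices form a component (\<open>mem\<close> with offsets
  \<open>cs\<close>). The language has no procedures, so the recursion of the search is an explicit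
  stack and the search a single loop. Each of its iterations lowers one potential, which bounds the
  time although an edge may be inspected several times before it is passed.\<close>

definition scc_class :: "('a \<times> 'a) set \<Rightarrow> 'a \<Rightarrow> 'a set" where
  "scc_class E u = {v. (u, v) \<in> E\<^sup>* \<and> (v, u) \<in> E\<^sup>*}"

lemma self_in_scc_class [simp]: "u \<in> scc_class E u"
  by (simp add: scc_class_def)

lemma scc_class_eq: "v \<in> scc_class E u \<Longrightarrow> scc_class E v = scc_class E u"
  by (auto simp: scc_class_def intro: rtrancl_trans)

text \<open>Library reachability requires the start to be a vertex even for the empty walk; the
  assumption keeps every later vertex in the graph.\<close>

lemma reachable_with_proj:
  assumes "parcs G \<subseteq> pverts G \<times> pverts G"
  shows "u \<rightarrow>\<^sup>*\<^bsub>with_proj G\<^esub> v \<longleftrightarrow> u \<in> pverts G \<and> (u, v) \<in> (parcs G)\<^sup>*"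
proof
  assume r: "u \<rightarrow>\<^sup>*\<^bsub>with_proj G\<^esub> v"
  show "u \<in> pverts G \<and> (u, v) \<in> (parcs G)\<^sup>*"
    using r reachable_rtranclI[OF r] by (auto simp: reachable_def dest: in_rtrancl_on_in_F)
next
  assume "u \<in> pverts G \<and> (u, v) \<in> (parcs G)\<^sup>*"
  hence u: "u \<in> pverts G" and r: "(u, v) \<in> (parcs G)\<^sup>*" by auto
  from r show "u \<rightarrow>\<^sup>*\<^bsub>with_proj G\<^esub> v"
    by induction (use u assms in \<open>auto simp: reachable_def intro: rtrancl_on_into_rtrancl_on\<close>)
qed

lemma scc_class_subset:
  assumes "E \<subseteq> V \<times> V" "u \<in> V"
  shows "scc_class E u \<subseteq> V"
proof
  fix v assume "v \<in> scc_class E u"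
  hence "(u, v) \<in> E\<^sup>*" by (simp add: scc_class_def)
  thus "v \<in> V" using assms by induction auto
qed

lemma sccs_verts_with_proj:
  assumes G: "parcs G \<subseteq> pverts G \<times> pverts G"
  shows "pre_digraph.sccs_verts (with_proj G) = scc_class (parcs G) ` pverts G"
proof (intro set_eqI iffI)
  fix S assume S: "S \<in> pre_digraph.sccs_verts (with_proj G)"
  then obtain u where u: "u \<in> S" by (auto simp: pre_digraph.sccs_verts_def)
  have "u \<rightarrow>\<^sup>*\<^bsub>with_proj G\<^esub> u" using S u by (auto simp: pre_digraph.sccs_verts_def)
  hence uV: "u \<in> pverts G" by (simp add: reachable_with_proj[OF G])
  have "S = scc_class (parcs G) u"
  proof (intro set_eqI iffI)
    fix v assume "v \<in> S"
    thus "v \<in> scc_class (parcs G) u"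
      using S u by (auto simp: pre_digraph.sccs_verts_def reachable_with_proj[OF G] scc_class_def)
  next
    fix v assume v: "v \<in> scc_class (parcs G) u"
    hence "v \<in> pverts G" using scc_class_subset[OF G uV] by auto
    with v uV have "u \<rightarrow>\<^sup>*\<^bsub>with_proj G\<^esub> v" "v \<rightarrow>\<^sup>*\<^bsub>with_proj G\<^esub> u"
      by (auto simp: reachable_with_proj[OF G] scc_class_def)
    thus "v \<in> S" using S u unfolding pre_digraph.sccs_verts_def by blast
  qed
  thus "S \<in> scc_class (parcs G) ` pverts G" using uV by auto
next
  fix S assume "S \<in> scc_class (parcs G) ` pverts G"
  then obtain u where u: "u \<in> pverts G" and S: "S = scc_class (parcs G) u" by auto
  show "S \<in> pre_digraph.sccs_verts (with_proj G)"
    unfolding pre_digraph.sccs_verts_def reachable_with_proj[OF G] S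
  proof (intro CollectI conjI ballI allI impI)
    show "scc_class (parcs G) u \<noteq> {}" using self_in_scc_class by fastforce
  next
    fix v w assume "v \<in> scc_class (parcs G) u" "w \<in> scc_class (parcs G) u"
    thus "v \<in> pverts G" "(v, w) \<in> (parcs G)\<^sup>*"
      using scc_class_subset[OF G u] by (auto simp: scc_class_def intro: rtrancl_trans)
  next
    fix v w assume "v \<in> scc_class (parcs G) u" "w \<notin> scc_class (parcs G) u"
    thus "\<not> (v \<in> pverts G \<and> (v, w) \<in> (parcs G)\<^sup>*) \<or> \<not> (w \<in> pverts G \<and> (w, v) \<in> (parcs G)\<^sup>*)"
      by (auto simp: scc_class_def intro: rtrancl_trans)
  qed
qed

lemma pverts_condensation:
  assumes "parcs G \<subseteq> pverts G \<times> pverts G"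
  shows "pverts (condensation G) = scc_class (parcs G) ` pverts G"
  by (simp add: condensation_def sccs_verts_with_proj[OF assms])

text \<open>Any edge between two classes joins the classes of its own endpoints, so the arcs can be
  indexed by edges. In this form one pass over the edge list produces them.\<close>

lemma parcs_condensation:
  assumes G: "parcs G \<subseteq> pverts G \<times> pverts G"
  shows "parcs (condensation G) =
    {(scc_class (parcs G) u, scc_class (parcs G) v) | u v.
      (u, v) \<in> parcs G \<and> scc_class (parcs G) u \<noteq> scc_class (parcs G) v}" (is "?L = ?R")
proof
  show "?L \<subseteq> ?R"
  proof
    fix e assume "e \<in> ?L"
    then obtain A B a b where "e = (A, B)" "A \<in> scc_class (parcs G) ` pverts G"
      "B \<in> scc_class (parcs G) ` pverts G" "A \<noteq> B" "a \<in> A" "b \<in> B" "(a, b) \<in> parcs G"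
      unfolding condensation_def Let_def sccs_verts_with_proj[OF G] pair_pre_digraph.simps by blast
    moreover from this have "A = scc_class (parcs G) a" "B = scc_class (parcs G) b"
      by (auto dest: scc_class_eq)
    ultimately show "e \<in> ?R" by blast
  qed
next
  show "?R \<subseteq> ?L"
  proof
    fix e assume "e \<in> ?R"
    then obtain u v where e: "e = (scc_class (parcs G) u, scc_class (parcs G) v)"
      "(u, v) \<in> parcs G" "scc_class (parcs G) u \<noteq> scc_class (parcs G) v" by blast
    moreover have "u \<in> pverts G" "v \<in> pverts G" using e(2) G by auto
    moreover have "u \<in> scc_class (parcs G) u" "v \<in> scc_class (parcs G) v" by simp_all
    ultimately show "e \<in> ?L"
      unfolding condensation_def Let_def sccs_verts_with_proj[OF G] pair_pre_digraph.simps by blast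
  qed
qed

section \<open>Existence of topological orderings\<close>

lemma topological_ordering_by_measure:
  fixes f :: "'a \<Rightarrow> nat"
  assumes "finite (pverts K)" and "\<And>A B. (A, B) \<in> parcs K \<Longrightarrow> f B < f A"
  shows "\<exists>vs. topological_ordering K vs"
proof -
  obtain ys where ys: "set ys = pverts K" "distinct ys"
    using finite_distinct_list[OF assms(1)] by auto
  \<comment> \<open>Decreasing \<open>f\<close>: an arc strictly lowers \<open>f\<close>, so it can
    neither point backwards nor join two entries of equal value.\<close>
  define vs where "vs = rev (sort_key f ys)"
  have "i < j" if ij: "i < length vs" "j < length vs" "(vs ! i, vs ! j) \<in> parcs K" for i j
  proof (rule ccontr)
    assume "\<not> i < j"
    hence "rev vs ! (length vs - 1 - i) = vs ! i" "rev vs ! (length vs - 1 - j) = vs ! j"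
      "length vs - 1 - i \<le> length vs - 1 - j" "length vs - 1 - j < length vs"
      using ij by (auto simp: rev_nth)
    moreover have "sorted (map f (rev vs))" by (simp add: vs_def)
    ultimately have "f (vs ! i) \<le> f (vs ! j)"
      using sorted_nth_mono[of "map f (rev vs)" "length vs - 1 - i" "length vs - 1 - j"] by simp
    thus False using assms(2)[OF ij(3)] by simp
  qed
  thus ?thesis using ys by (auto simp: topological_ordering_def vs_def intro!: exI[of _ vs])
qed

text \<open>The measure counts the vertices reachable from a component. It falls strictly along an
  arc from \<open>A\<close> to \<open>B\<close>: a vertex of \<open>A\<close> reachable from
  \<open>B\<close> would merge the two components.\<close>

lemma condensation_has_topological_ordering:
  assumes G: "parcs G \<subseteq> pverts G \<times> pverts G" and fin: "finite (pverts G)"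
  shows "\<exists>vs. topological_ordering (condensation G) vs"
proof (rule topological_ordering_by_measure[where f = "\<lambda>A. card ((parcs G)\<^sup>* `` A)"])
  show "finite (pverts (condensation G))" using fin by (simp add: pverts_condensation[OF G])
next
  fix A B assume "(A, B) \<in> parcs (condensation G)"
  then obtain u v where uv: "A = scc_class (parcs G) u" "B = scc_class (parcs G) v"
    "(u, v) \<in> parcs G" "A \<noteq> B" by (auto simp: parcs_condensation[OF G])
  have reach: "(parcs G)\<^sup>* `` scc_class (parcs G) w = (parcs G)\<^sup>* `` {w}" for w
    by (auto simp: scc_class_def intro: rtrancl_trans)
  have "u \<notin> (parcs G)\<^sup>* `` B"
  proof
    assume "u \<in> (parcs G)\<^sup>* `` B"
    hence "(v, u) \<in> (parcs G)\<^sup>*" by (simp add: reach uv(2))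
    hence "u \<in> B" using uv(2,3) by (auto simp: scc_class_def)
    thus False using uv(1,2,4) scc_class_eq[of u "parcs G" v] by simp
  qed
  moreover have "u \<in> (parcs G)\<^sup>* `` A" by (simp add: reach uv(1))
  moreover have "(parcs G)\<^sup>* `` B \<subseteq> (parcs G)\<^sup>* `` A"
    using uv(3) by (auto simp: reach uv(1,2) intro: converse_rtrancl_into_rtrancl)
  moreover have "(parcs G)\<^sup>* `` A \<subseteq> pverts G"
  proof
    fix w assume "w \<in> (parcs G)\<^sup>* `` A"
    hence "(u, w) \<in> (parcs G)\<^sup>*" by (simp add: reach uv(1))
    thus "w \<in> pverts G" by induction (use uv(3) G in auto)
  qed
  ultimately show "card ((parcs G)\<^sup>* `` B) < card ((parcs G)\<^sup>* `` A)"
    using fin by (intro psubset_card_mono) (auto intro: finite_subset)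
qed

section \<open>Complementary slackness\<close>

definition slack :: "('v, 'l) lap \<Rightarrow> ('v, 'l) dual \<Rightarrow> 'v \<Rightarrow> 'l \<Rightarrow> real" where
  "slack I d v l = cost I v l - fst d v - snd d l"

lemma dual_feasible_iff:
  "dual_feasible I d \<longleftrightarrow> (\<forall>v\<in>vertices I. \<forall>l\<in>allowed I v. 0 \<le> slack I d v l)"
  by (cases d) (auto simp: dual_feasible_def slack_def algebra_simps)

lemma tight_edges_iff:
  "(v, l) \<in> tight_edges I d \<longleftrightarrow> v \<in> vertices I \<and> l \<in> allowed I v \<and> slack I d v l = 0"
  by (cases d) (auto simp: tight_edges_def slack_def)

text \<open>As \<open>y\<close> is onto the labels, the label variables along \<open>y\<close> add
  up to their total. The slacks along an assignment are thus its duality gap; weak duality, the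
  improvement of \<open>x\<close> and the optimality criterion all compare such sums.\<close>

lemma assignment_cost_eq_slack:
  assumes "assignment I y"
  shows "assignment_cost I y = dual_value I d + (\<Sum>v\<in>vertices I. slack I d v (y v))"
proof -
  have "(\<Sum>v\<in>vertices I. snd d (y v)) = (\<Sum>l\<in>labels I. snd d l)"
    using assms by (auto simp: assignment_def intro: sum.reindex_bij_betw)
  thus ?thesis
    by (simp add: assignment_cost_def dual_value_def slack_def sum_subtractf split: prod.splits)
qed

lemma dual_value_le_assignment_cost:
  assumes "assignment I y" "dual_feasible I d"
  shows "dual_value I d \<le> assignment_cost I y"
proof -
  have "0 \<le> (\<Sum>v\<in>vertices I. slack I d v (y v))"
    using assms by (intro sum_nonneg) (auto simp: dual_feasible_iff assignment_def)
  thus ?thesis using assignment_cost_eq_slack[OF assms(1), of d] by simp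
qed

text \<open>A shortest closed walk through \<open>a\<close> repeats no vertex, because cutting out
  the part between two equal vertices would leave a shorter one. Its vertices therefore form a
  cycle, and moving each to its successor is the permutation.\<close>

lemma trancl_cycle_permutation:
  assumes "(a, a) \<in> E\<^sup>+"
  shows "\<exists>c \<sigma>. a \<in> c \<and> \<sigma> permutes c \<and> (\<forall>u\<in>c. (u, \<sigma> u) \<in> E)"
proof -
  define n where "n = (LEAST n. 0 < n \<and> (a, a) \<in> E ^^ n)"
  have "\<exists>n. 0 < n \<and> (a, a) \<in> E ^^ n" using assms by (auto simp: trancl_power)
  hence n: "0 < n" "(a, a) \<in> E ^^ n" unfolding n_def by (metis (mono_tags, lifting) LeastI_ex)+
  have least: "n \<le> k" if "0 < k" "(a, a) \<in> E ^^ k" for k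
    using that unfolding n_def by (simp add: Least_le)
  from n obtain f where f: "f 0 = a" "f n = a" "\<And>i. i < n \<Longrightarrow> (f i, f (Suc i)) \<in> E"
    by (auto simp: relpow_fun_conv)
  have pow: "(f i, f (i + k)) \<in> E ^^ k" if "i + k \<le> n" for i k
    using that by (induction k) (auto intro!: relcompI f(3))
  have neq: "f i \<noteq> f j" if "i < j" "j < n" for i j
  proof
    assume eq: "f i = f j"
    have "(f 0, f (0 + i)) \<in> E ^^ i" "(f j, f (j + (n - j))) \<in> E ^^ (n - j)"
      using that pow[of 0 i] pow[of j "n - j"] by simp_all
    hence "(a, a) \<in> E ^^ (i + (n - j))"
      using that f eq unfolding relpow_add by (auto intro!: relcompI[of _ "f j"])
    from least[OF _ this] that show False by auto
  qed
  define cs where "cs = map f [0..<n]"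
  have cs: "distinct cs"
    using neq by (auto simp: cs_def distinct_map inj_on_def) (metis linorder_neqE_nat)
  have rot: "map (cycle_of_list cs) cs = rotate1 cs"
    using cyclic_rotation[OF cs, of 1] by simp
  have step: "cycle_of_list cs (f i) = f (Suc i)" if "i < n" for i
  proof -
    have "cycle_of_list cs (f i) = map (cycle_of_list cs) cs ! i"
      using that by (simp add: cs_def)
    also have "\<dots> = rotate1 cs ! i" by (simp only: rot)
    also have "\<dots> = cs ! (Suc i mod n)"
      using that n(1) nth_rotate1[of i cs] by (simp add: cs_def)
    \<comment> \<open>The index wraps around only at the last vertex, where \<open>f n\<close> and
      \<open>f 0\<close> are both \<open>a\<close>.\<close>
    also have "\<dots> = f (Suc i)"
      using that f n(1) by (cases "Suc i = n") (auto simp: cs_def)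
    finally show ?thesis .
  qed
  show ?thesis
  proof (intro exI conjI ballI)
    show "a \<in> set cs" using n(1) f(1) by (auto simp: cs_def intro!: image_eqI[of _ _ 0])
    show "cycle_of_list cs permutes set cs" by (rule cycle_permutes)
    show "(u, cycle_of_list cs u) \<in> E" if "u \<in> set cs" for u
      using that step f(3) by (auto simp: cs_def)
  qed
qed

text \<open>A non-tight pair of \<open>x\<close> at \<open>v0\<close> yields either a cycle of tight pairs through \<open>v0\<close>, along
  which \<open>x\<close> can be improved, or a set of vertices reachable from \<open>v0\<close> that has fewer tight labels
  than elements, along which \<open>d\<close> can be improved.\<close>

lemma complementary_slackness:
  assumes inst: "lap_instance I" and opt: "dual_optimal I d" and x: "optimal_assignment I x"
    and v0: "v0 \<in> vertices I"
  shows "slack I d v0 (x v0) = 0"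
proof (rule ccontr)
  assume nontight: "slack I d v0 (x v0) \<noteq> 0"
  let ?V = "vertices I"
  have ax: "assignment I x" and feas: "dual_feasible I d" and fin: "finite ?V" "finite (labels I)"
    using assms by (auto simp: optimal_assignment_def dual_optimal_def lap_instance_def)
  have xb: "bij_betw x ?V (labels I)" and xa: "\<And>v. v \<in> ?V \<Longrightarrow> x v \<in> allowed I v"
    using ax by (auto simp: assignment_def)
  \<comment> \<open>Loops are kept, unlike in the exchange graph: the label \<open>x u\<close> must
    count among the tight labels of \<open>u\<close> for \<open>tightN\<close> to hold without
    exceptions.\<close>
  define E where "E = {(u, w). u \<in> ?V \<and> w \<in> ?V \<and> (u, x w) \<in> tight_edges I d}"
  show False
  proof (cases "(v0, v0) \<in> E\<^sup>+")
    case True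
    then obtain c \<sigma> where c: "v0 \<in> c" "\<sigma> permutes c" "\<And>u. u \<in> c \<Longrightarrow> (u, \<sigma> u) \<in> E"
      by (auto dest: trancl_cycle_permutation)
    have "c \<subseteq> ?V" using c(3) by (auto simp: E_def)
    hence "\<sigma> permutes ?V" using c(2) permutes_subset by blast
    hence bij: "bij_betw (x \<circ> \<sigma>) ?V (labels I)"
      using xb by (auto intro: bij_betw_trans permutes_imp_bij)
    have on: "x (\<sigma> u) \<in> allowed I u \<and> slack I d u (x (\<sigma> u)) = 0" if "u \<in> c" for u
      using c(3)[OF that] by (auto simp: E_def tight_edges_iff)
    have off: "\<sigma> u = u" if "u \<notin> c" for u
      using that c(2) by (auto simp: permutes_def)
    have ay: "assignment I (x \<circ> \<sigma>)"
      unfolding assignment_def using bij on off xa by (metis comp_apply)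
    have "(\<Sum>v\<in>?V. slack I d v ((x \<circ> \<sigma>) v)) < (\<Sum>v\<in>?V. slack I d v (x v))"
    proof (rule sum_strict_mono_ex1[OF fin(1)])
      have "0 \<le> slack I d v (x v)" if "v \<in> ?V" for v
        using that feas xa by (auto simp: dual_feasible_iff)
      thus "\<forall>v\<in>?V. slack I d v ((x \<circ> \<sigma>) v) \<le> slack I d v (x v)"
        using on off by (metis comp_apply order_refl)
      show "\<exists>v\<in>?V. slack I d v ((x \<circ> \<sigma>) v) < slack I d v (x v)"
        using v0 nontight on[OF c(1)] \<open>\<And>v. v \<in> ?V \<Longrightarrow> 0 \<le> slack I d v (x v)\<close> by force
    qed
    hence "assignment_cost I (x \<circ> \<sigma>) < assignment_cost I x"
      using assignment_cost_eq_slack[OF ax, of d] assignment_cost_eq_slack[OF ay, of d] by simp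
    thus False using x ay by (auto simp: optimal_assignment_def)
  next
    case False
    \<comment> \<open>\<open>R'\<close> collects what is reached by at least one edge, so in this
      case it lacks \<open>v0\<close>, while \<open>R\<close> contains it. All tight labels of
      \<open>R\<close> are partners of \<open>R'\<close>, which leaves one vertex too many: raising
      \<open>R\<close> and lowering \<open>N\<close> by the same amount improves the dual
      value.\<close>
    define R' where "R' = {w. (v0, w) \<in> E\<^sup>+}"
    define R where "R = insert v0 R'"
    define N where "N = x ` R'"
    have "E \<subseteq> ?V \<times> ?V" by (auto simp: E_def)
    hence "E\<^sup>+ \<subseteq> ?V \<times> ?V" by (rule trancl_subset_Sigma)
    hence R'V: "R' \<subseteq> ?V" by (auto simp: R'_def)
    hence RV: "R \<subseteq> ?V" using v0 by (auto simp: R_def)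
    have finR: "finite R'" using R'V fin(1) finite_subset by auto
    have NL: "N \<subseteq> labels I" using R'V xb by (auto simp: N_def bij_betw_def)
    have cardN: "card N = card R'"
      using xb R'V by (auto simp: N_def bij_betw_def intro: card_image inj_on_subset)
    have cardR: "card R = Suc (card R')" using False finR by (auto simp: R_def R'_def)
    have tightN: "l \<in> N" if "u \<in> R" "l \<in> allowed I u" "slack I d u l = 0" for u l
    proof -
      have "u \<in> ?V" using that RV by auto
      hence "l \<in> labels I" using that inst by (auto simp: lap_instance_def)
      then obtain w where w: "w \<in> ?V" "l = x w" using xb by (auto simp: bij_betw_def)
      have "(u, w) \<in> E" using that w \<open>u \<in> ?V\<close> by (auto simp: E_def tight_edges_iff)
      hence "w \<in> R'" using that(1) by (auto simp: R_def R'_def intro: trancl_into_trancl)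
      thus ?thesis using w by (auto simp: N_def)
    qed
    define S where "S = (\<lambda>(u, l). slack I d u l) ` (SIGMA u:R. allowed I u - N)"
    \<comment> \<open>The 1 provides a value when no pair leads from \<open>R\<close> to a label
      outside \<open>N\<close>.\<close>
    define \<epsilon> where "\<epsilon> = Min (insert 1 S)"
    have "finite (SIGMA u:R. allowed I u - N)"
      using RV fin inst by (intro finite_SigmaI) (auto simp: lap_instance_def intro: finite_subset)
    hence finS: "finite S" by (simp add: S_def)
    have "0 < s" if "s \<in> S" for s
    proof -
      obtain u l where ul: "u \<in> R" "l \<in> allowed I u" "l \<notin> N" "s = slack I d u l"
        using \<open>s \<in> S\<close> by (auto simp: S_def)
      have "0 \<le> slack I d u l" using feas ul RV by (auto simp: dual_feasible_iff)
      thus ?thesis using tightN[OF ul(1,2)] ul by fastforce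
    qed
    hence pos: "0 < \<epsilon>" using finS by (auto simp: \<epsilon>_def)
    have le: "\<epsilon> \<le> slack I d u l" if "u \<in> R" "l \<in> allowed I u" "l \<notin> N" for u l
    proof -
      have "slack I d u l \<in> S" using that by (force simp: S_def)
      thus ?thesis using finS by (simp add: \<epsilon>_def)
    qed
    define d' where "d' = (\<lambda>v. fst d v + (if v \<in> R then \<epsilon> else 0), \<lambda>l. snd d l - (if l \<in> N then \<epsilon> else 0))"
    have "dual_feasible I d'"
      unfolding dual_feasible_iff
    proof (intro ballI)
      fix v l assume vl: "v \<in> ?V" "l \<in> allowed I v"
      hence "0 \<le> slack I d v l" using feas by (auto simp: dual_feasible_iff)
      thus "0 \<le> slack I d' v l"
        using pos le[of v l] vl by (auto simp: slack_def d'_def)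
    qed
    hence "dual_value I d' \<le> dual_value I d" using opt unfolding dual_optimal_def by blast
    moreover have "dual_value I d' = dual_value I d + \<epsilon>"
    proof -
      have "(\<Sum>v\<in>?V. if v \<in> R then \<epsilon> else 0) = \<epsilon> * card R"
        using RV fin(1) by (simp add: sum.If_cases Int_absorb1)
      moreover have "(\<Sum>l\<in>labels I. if l \<in> N then \<epsilon> else 0) = \<epsilon> * card N"
        using NL fin(2) by (simp add: sum.If_cases Int_absorb1)
      ultimately show ?thesis
        by (simp add: dual_value_def d'_def sum.distrib sum_subtractf cardN cardR algebra_simps
            split: prod.splits)
    qed
    ultimately show False using pos by simp
  qed
qed

text \<open>Tightness on \<open>x\<close> closes the gap between the dual value and the cost of
  \<open>x\<close>, which by weak duality no dual value exceeds. Optimality thereby becomes a set of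
  linear conditions on slacks, to which affine combinations can be applied.\<close>

lemma dual_optimal_iff:
  assumes inst: "lap_instance I" and opt: "dual_optimal I d" and x: "optimal_assignment I x"
  shows "dual_optimal I e \<longleftrightarrow> dual_feasible I e \<and> (\<forall>v\<in>vertices I. slack I e v (x v) = 0)"
proof
  assume "dual_optimal I e"
  thus "dual_feasible I e \<and> (\<forall>v\<in>vertices I. slack I e v (x v) = 0)"
    using complementary_slackness[OF inst _ x] by (auto simp: dual_optimal_def)
next
  assume e: "dual_feasible I e \<and> (\<forall>v\<in>vertices I. slack I e v (x v) = 0)"
  have ax: "assignment I x" using x by (simp add: optimal_assignment_def)
  have "assignment_cost I x = dual_value I e"
    using assignment_cost_eq_slack[OF ax, of e] e by simp
  thus "dual_optimal I e"
    using e dual_value_le_assignment_cost[OF ax] by (auto simp: dual_optimal_def)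
qed

section \<open>The relative interior of the set of optimal solutions\<close>

text \<open>Formed before passing to vectors, because slacks need a pair of functions and
  \<open>dual_vec\<close> forgets the values outside the instance.\<close>

definition dual_comb :: "real \<Rightarrow> ('v, 'l) dual \<Rightarrow> real \<Rightarrow> ('v, 'l) dual \<Rightarrow> ('v, 'l) dual" where
  "dual_comb a d b e = (\<lambda>v. a * fst d v + b * fst e v, \<lambda>l. a * snd d l + b * snd e l)"

lemma dual_vec_comb: "dual_vec I (dual_comb a d b e) = a *\<^sub>R dual_vec I d + b *\<^sub>R dual_vec I e"
  by (cases d; cases e) (auto simp: dual_vec_def dual_comb_def vec_eq_iff)

text \<open>Slack is affine but not linear in the dual solution: the weights have to sum to 1 to
  share out the cost.\<close>

lemma slack_comb:
  assumes "a + b = 1"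
  shows "slack I (dual_comb a d b e) v l = a * slack I d v l + b * slack I e v l"
proof -
  have "cost I v l = (a + b) * cost I v l" using assms by simp
  also have "\<dots> = a * cost I v l + b * cost I v l" by (rule distrib_right)
  finally show ?thesis by (simp add: slack_def dual_comb_def algebra_simps)
qed

lemma dual_vec_in_rel_interior:
  fixes I :: "('v::finite, 'l::finite) lap"
  assumes inst: "lap_instance I" and opt: "dual_optimal I p" and x: "optimal_assignment I x"
    and strict: "\<And>v l q. v \<in> vertices I \<Longrightarrow> l \<in> allowed I v \<Longrightarrow> slack I p v l = 0 \<Longrightarrow>
      dual_optimal I q \<Longrightarrow> slack I q v l = 0"
  shows "dual_vec I p \<in> rel_interior (dual_vec I ` {e. dual_optimal I e})"
proof -
  let ?O = "{e. dual_optimal I e}"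
  note O_iff = dual_optimal_iff[OF inst opt x] dual_feasible_iff
  have conv: "convex (dual_vec I ` ?O)"
  proof (rule convexI)
    fix y z and a b :: real
    assume "y \<in> dual_vec I ` ?O" "z \<in> dual_vec I ` ?O" and ab: "0 \<le> a" "0 \<le> b" "a + b = 1"
    then obtain d e where de: "dual_optimal I d" "dual_optimal I e"
      and yz: "y = dual_vec I d" "z = dual_vec I e" by auto
    have "dual_optimal I (dual_comb a d b e)"
      using de ab by (simp add: O_iff slack_comb)
    thus "a *\<^sub>R y + b *\<^sub>R z \<in> dual_vec I ` ?O"
      unfolding yz dual_vec_comb[symmetric] by auto
  qed
  have "\<exists>c>1. (1 - c) *\<^sub>R dual_vec I q + c *\<^sub>R dual_vec I p \<in> dual_vec I ` ?O"
    if q: "dual_optimal I q" for q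
  proof -
    \<comment> \<open>The prolongation is \<open>dual_comb (- t) q (1 + t) p\<close> for small
      \<open>t > 0\<close>. A pair tight at \<open>p\<close> is tight at \<open>q\<close> by
      \<open>strict\<close> and stays tight; any other has positive slack at \<open>p\<close> and
      keeps it nonnegative near \<open>t = 0\<close>. Finitely many pairs admit a common
      \<open>t\<close>.\<close>
    let ?P = "SIGMA v:vertices I. allowed I v"
    have "\<forall>\<^sub>F t in at_right 0. 0 \<le> slack I (dual_comb (- t) q (1 + t) p) v l"
      if vl: "(v, l) \<in> ?P" for v l
    proof (cases "slack I p v l = 0")
      case True
      hence "slack I q v l = 0" using strict q vl by auto
      thus ?thesis using True by (simp add: slack_comb)
    next
      case False
      hence pos: "0 < slack I p v l" using opt vl by (force simp: O_iff)
      have "((\<lambda>t. - t * slack I q v l + (1 + t) * slack I p v l) \<longlongrightarrow>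
          - 0 * slack I q v l + (1 + 0) * slack I p v l) (at_right 0)"
        by (intro tendsto_intros)
      hence "\<forall>\<^sub>F t in at_right 0. 0 < - t * slack I q v l + (1 + t) * slack I p v l"
        using pos by (intro order_tendstoD(1)) auto
      thus ?thesis by (rule eventually_mono) (simp add: slack_comb)
    qed
    hence "\<forall>\<^sub>F t in at_right 0. \<forall>(v, l)\<in>?P. 0 \<le> slack I (dual_comb (- t) q (1 + t) p) v l"
      by (intro eventually_ball_finite) auto
    moreover have "\<forall>\<^sub>F t::real in at_right 0. 0 < t" by (rule eventually_at_right_less)
    ultimately have "\<forall>\<^sub>F t::real in at_right 0.
        0 < t \<and> (\<forall>(v, l)\<in>?P. 0 \<le> slack I (dual_comb (- t) q (1 + t) p) v l)"
      by eventually_elim auto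
    hence "\<exists>t::real. 0 < t \<and> (\<forall>(v, l)\<in>?P. 0 \<le> slack I (dual_comb (- t) q (1 + t) p) v l)"
      by (rule eventually_happens'[OF trivial_limit_at_right_real])
    then obtain t :: real
      where t: "0 < t" "\<forall>(v, l)\<in>?P. 0 \<le> slack I (dual_comb (- t) q (1 + t) p) v l"
      by blast
    \<comment> \<open>Tightness on \<open>x\<close> holds at both \<open>p\<close> and
      \<open>q\<close>, hence at every affine combination of them.\<close>
    have "dual_optimal I (dual_comb (- t) q (1 + t) p)"
      using t(2) opt q by (auto simp: O_iff slack_comb)
    hence "(1 - (1 + t)) *\<^sub>R dual_vec I q + (1 + t) *\<^sub>R dual_vec I p \<in> dual_vec I ` ?O"
      using dual_vec_comb[of I "- t" q "1 + t" p] by force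
    thus ?thesis using t(1) by (intro exI[of _ "1 + t"]) auto
  qed
  moreover have "dual_vec I ` ?O \<noteq> {}" using opt by blast
  ultimately show ?thesis using conv by (subst convex_rel_interior_iff) auto
qed

section \<open>Correctness of Algorithm A\<close>

lemma pverts_input_graph [simp]: "pverts (input_graph I d x) = vertices I"
  by (simp add: input_graph_def exchange_graph_def)

lemma parcs_input_graph:
  "parcs (input_graph I d x) = {(u, w). u \<in> vertices I \<and> w \<in> vertices I \<and> u \<noteq> w \<and>
     x w \<in> allowed I u \<and> slack I d u (x w) = 0}"
  by (auto simp: input_graph_def exchange_graph_def tight_edges_iff)

lemma parcs_input_graph_subset: "parcs (input_graph I d x) \<subseteq> vertices I \<times> vertices I"
  by (auto simp: parcs_input_graph)

text \<open>Along a pair that is tight for \<open>d\<close>, the difference of the vertex parts of any other optimal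
  solution and of \<open>d\<close> can only increase; hence it is constant on strongly connected components.\<close>

lemma slack_optimal_within_scc:
  assumes inst: "lap_instance I" and opt: "dual_optimal I d" and x: "optimal_assignment I x"
    and q: "dual_optimal I q" and u: "u \<in> vertices I"
    and w: "w \<in> scc_class (parcs (input_graph I d x)) u"
  shows "slack I q u (x w) = slack I d u (x w)"
proof -
  let ?E = "parcs (input_graph I d x)"
  define f where "f v = fst q v - fst d v" for v
  have tight: "slack I d v (x v) = 0" "slack I q v (x v) = 0" if "v \<in> vertices I" for v
    using that complementary_slackness[OF inst _ x] opt q by auto
  \<comment> \<open>Tightness at \<open>(z, x z)\<close> replaces the label variable of
    \<open>x z\<close> by the vertex variable of \<open>z\<close>, for \<open>q\<close> as for
    \<open>d\<close>.\<close>
  have diff: "slack I q v (x z) = slack I d v (x z) + f z - f v" if "z \<in> vertices I" for v z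
    using tight[OF that] by (simp add: slack_def f_def)
  have step: "f v \<le> f z" if "(v, z) \<in> ?E" for v z
  proof -
    have "0 \<le> slack I q v (x z)"
      using that q by (auto simp: parcs_input_graph dual_optimal_def dual_feasible_iff)
    thus ?thesis using that diff[of z v] by (auto simp: parcs_input_graph)
  qed
  have mono: "f v \<le> f z" if "(v, z) \<in> ?E\<^sup>*" for v z
    using that by induction (auto dest: step)
  have "f u = f w" using w by (auto simp: scc_class_def intro: antisym mono)
  moreover have "w \<in> vertices I"
    by (rule subsetD[OF scc_class_subset[OF parcs_input_graph_subset u] w])
  ultimately show ?thesis using diff by simp
qed

section \<open>One update of the dual solution and the invariant of Algorithm A\<close>

lemma step_delta_eq:
  "step_delta I x A d =
    (let S = (\<lambda>(v, l). slack I d v l) ` (SIGMA v:A. allowed I v - x ` A) in if S = {} then 1 else Min S)"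
proof -
  have "{cost I v l - fst d v - snd d l | v l. v \<in> A \<and> l \<in> allowed I v - x ` A} =
      (\<lambda>(v, l). slack I d v l) ` (SIGMA v:A. allowed I v - x ` A)"
    by (force simp: slack_def)
  moreover have "step_delta I x A d =
      (let S = {cost I v l - fst d v - snd d l | v l. v \<in> A \<and> l \<in> allowed I v - x ` A}
       in if S = {} then 1 else Min S)"
    by (cases d) (simp add: step_delta_def)
  ultimately show ?thesis by (simp only:)
qed

lemma process_component_eq:
  "process_component I x K A d =
    (if \<exists>B. (B, A) \<in> parcs K
     then (\<lambda>v. fst d v + (if v \<in> A then step_delta I x A d / 2 else 0),
           \<lambda>l. snd d l - (if l \<in> x ` A then step_delta I x A d / 2 else 0))
     else d)"
proof -
  have 1: "(\<lambda>v. if P v then f v + c else f v) = (\<lambda>v. f v + (if P v then c else 0))"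
    and 2: "(\<lambda>v. if P v then f v - c else f v) = (\<lambda>v. f v - (if P v then c else 0))"
    for P and f :: "'c \<Rightarrow> real" and c by auto
  show ?thesis
    by (cases d) (simp only: process_component_def prod.case Let_def 1 2 fst_conv snd_conv)
qed

context
  fixes I :: "('v, 'l) lap" and d :: "('v, 'l) dual" and x :: "'v \<Rightarrow> 'l" and E and comp
  assumes inst: "lap_instance I" and opt: "dual_optimal I d" and x: "optimal_assignment I x"
  defines "E \<equiv> parcs (input_graph I d x)" and "comp \<equiv> scc_class E"
begin

lemma allowed_eq_image:
  assumes "u \<in> vertices I" "l \<in> allowed I u"
  shows "\<exists>w\<in>vertices I. l = x w"
proof -
  have "l \<in> labels I" using assms inst by (auto simp: lap_instance_def)
  moreover have "labels I = x ` vertices I"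
    using x by (simp add: optimal_assignment_def assignment_def bij_betw_def)
  ultimately show ?thesis by auto
qed

text \<open>The invariant after processing the components in \<open>Bs\<close>, the tail of the topological
  ordering. A pair is here given by two vertices \<open>u\<close> and \<open>w\<close> and stands for \<open>u\<close> and the label
  \<open>x w\<close>.\<close>

definition processed :: "'v set set \<Rightarrow> ('v, 'l) dual \<Rightarrow> bool" where
  "processed Bs e \<longleftrightarrow>
    (\<forall>u\<in>vertices I. \<forall>w\<in>vertices I. x w \<in> allowed I u \<longrightarrow>
      (if comp u = comp w then slack I e u (x w) = slack I d u (x w)
       else 0 \<le> slack I e u (x w) \<and>
         (slack I d u (x w) > 0 \<or> comp w \<in> Bs \<longrightarrow> 0 < slack I e u (x w))))"

lemma comp_edge: "(u, w) \<in> E \<Longrightarrow> comp u \<noteq> comp w \<Longrightarrow>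
    (comp u, comp w) \<in> parcs (condensation (input_graph I d x))"
  by (subst parcs_condensation) (auto simp: parcs_input_graph_subset comp_def E_def)

text \<open>The shifts cancel on a pair inside \<open>A\<close>, and pairs avoiding \<open>A\<close>
  do not move. A pair entering \<open>A\<close> gains half of \<delta>. A pair leaving
  \<open>A\<close> loses half of \<delta>, so its slack has to be positive beforehand:
  \<open>later\<close> guarantees this, and it is why components are processed against the
  topological order.\<close>

lemma process_component_processed:
  fixes e
  defines "K \<equiv> condensation (input_graph I d x)"
  assumes A: "A \<in> pverts K" and e: "processed Bs e"
    and later: "\<And>B. (A, B) \<in> parcs K \<Longrightarrow> B \<in> Bs"
  shows "processed (insert A Bs) (process_component I x K A e)"
proof -
  let ?V = "vertices I" and ?\<delta> = "step_delta I x A e"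
  have feas: "0 \<le> slack I d u l" if "u \<in> ?V" "l \<in> allowed I u" for u l
    using that opt by (auto simp: dual_optimal_def dual_feasible_iff)
  have xinj: "x w \<in> x ` A \<longleftrightarrow> w \<in> A" if "w \<in> ?V" "A \<subseteq> ?V" for w
    using that x by (auto simp: optimal_assignment_def assignment_def bij_betw_def inj_on_def)
  have "A \<in> comp ` ?V"
    using A by (simp add: K_def pverts_condensation parcs_input_graph_subset comp_def E_def)
  then obtain a where a: "a \<in> ?V" "A = comp a" by auto
  have AV: "A \<subseteq> ?V"
    using scc_class_subset[OF parcs_input_graph_subset a(1)] a(2) by (simp add: comp_def E_def)
  have inA: "v \<in> A \<longleftrightarrow> comp v = A" for v
    unfolding a comp_def using scc_class_eq[of v E a] self_in_scc_class[of v E] by metis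
  show ?thesis
  proof (cases "\<exists>B. (B, A) \<in> parcs K")
    case False
    \<comment> \<open>Without an ingoing arc no pair that enters \<open>A\<close> is tight for
      \<open>d\<close>, so omitting the update loses nothing.\<close>
    have "0 < slack I e u (x w)"
      if "u \<in> ?V" "w \<in> ?V" "x w \<in> allowed I u" "comp u \<noteq> comp w" "comp w = A" for u w
    proof -
      have "(u, w) \<notin> E" using comp_edge[of u w] that False by (auto simp: K_def)
      hence "0 < slack I d u (x w)"
        using that feas[of u "x w"] by (cases "u = w") (auto simp: E_def parcs_input_graph)
      thus ?thesis using e that by (auto simp: processed_def)
    qed
    thus ?thesis using e False by (auto simp: processed_def process_component_eq)
  next
    case True
    \<comment> \<open>A pair out of \<open>A\<close> either has positive slack for \<open>d\<close>
      or gives an arc, whose head lies in \<open>Bs\<close>; the invariant makes the current slack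
      positive in both cases.\<close>
    have out_pos: "0 < slack I e u l" if ul: "u \<in> A" "l \<in> allowed I u" "l \<notin> x ` A" for u l
    proof -
      have u: "u \<in> ?V" using ul AV by auto
      obtain w where w: "w \<in> ?V" "l = x w" using allowed_eq_image[OF u ul(2)] by auto
      have ne: "comp u \<noteq> comp w" using ul w inA by auto
      have "0 < slack I d u l \<or> comp w \<in> Bs"
      proof (cases "slack I d u l = 0")
        case True
        have "u \<noteq> w" using ne by auto
        hence "(u, w) \<in> E" using True u w ul by (auto simp: E_def parcs_input_graph)
        thus ?thesis using comp_edge[of u w] ne later ul(1) inA by (auto simp: K_def)
      qed (use feas[OF u ul(2)] in auto)
      thus ?thesis using e u w ul ne by (auto simp: processed_def)
    qed
    let ?S = "(\<lambda>(v, l). slack I e v l) ` (SIGMA v:A. allowed I v - x ` A)"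
    have "finite (SIGMA v:A. allowed I v - x ` A)"
      using AV inst by (intro finite_SigmaI finite_Diff)
        (auto simp: lap_instance_def intro: finite_subset[of A] finite_subset[of "allowed I _"])
    hence finS: "finite ?S" by simp
    have delta_pos: "0 < ?\<delta>"
      using finS out_pos by (auto simp: step_delta_eq Let_def)
    have delta_le: "?\<delta> \<le> slack I e u l" if "u \<in> A" "l \<in> allowed I u" "l \<notin> x ` A" for u l
    proof -
      have "slack I e u l \<in> ?S" using that by force
      thus ?thesis using finS by (auto simp: step_delta_eq Let_def)
    qed
    have new: "slack I (process_component I x K A e) u (x w) =
        slack I e u (x w) - (if u \<in> A then ?\<delta> / 2 else 0) + (if w \<in> A then ?\<delta> / 2 else 0)"
      if "w \<in> ?V" for u w
      using True xinj[OF that AV] by (simp add: process_component_eq slack_def)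
    show ?thesis
      unfolding processed_def
    proof (intro ballI impI)
      fix u w assume uw: "u \<in> ?V" "w \<in> ?V" "x w \<in> allowed I u"
      let ?s = "slack I (process_component I x K A e) u (x w)"
      show "if comp u = comp w then ?s = slack I d u (x w)
        else 0 \<le> ?s \<and> (0 < slack I d u (x w) \<or> comp w \<in> insert A Bs \<longrightarrow> 0 < ?s)"
      proof (cases "comp u = comp w")
        case True
        thus ?thesis using e uw inA by (simp add: new processed_def)
      next
        case False
        hence old: "0 \<le> slack I e u (x w)"
          "0 < slack I d u (x w) \<or> comp w \<in> Bs \<Longrightarrow> 0 < slack I e u (x w)"
          using e uw by (auto simp: processed_def)
        show ?thesis
        proof (cases "u \<in> A")
          case True
          hence "w \<notin> A" using False inA by auto
          moreover from this have "0 < slack I e u (x w)" "?\<delta> \<le> slack I e u (x w)"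
            using out_pos[OF True uw(3)] delta_le[OF True uw(3)] xinj[OF uw(2) AV] by auto
          ultimately show ?thesis using True False uw by (simp add: new)
        next
          case uA: False
          show ?thesis
          proof (cases "w \<in> A")
            case True
            thus ?thesis using False uA uw old(1) delta_pos by (auto simp: new)
          next
            case wA: False
            thus ?thesis using False uA uw old inA by (auto simp: new)
          qed
        qed
      qed
    qed
  qed
qed

lemma process_all_processed:
  fixes K
  defines "K \<equiv> condensation (input_graph I d x)"
  assumes top: "topological_ordering K Vs"
  shows "processed (set Vs) (process_all I x K Vs d)"
proof -
  \<comment> \<open>The tails of \<open>Vs\<close> are what \<open>foldr\<close> has already
    treated. The prefix \<open>As\<close> gives the position of \<open>A\<close> in
    \<open>Vs\<close>, beyond which its arcs lead.\<close>
  have "processed (set Bs) (foldr (process_component I x K) Bs d)" if "Vs = As @ Bs" for As Bs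
    using that
  proof (induction Bs arbitrary: As)
    case Nil
    show ?case
      using opt by (auto simp: processed_def dual_optimal_def dual_feasible_iff)
  next
    case (Cons A Bs)
    have "B \<in> set Bs" if AB: "(A, B) \<in> parcs K" for B
    proof -
      have "B \<in> set Vs"
        using AB top by (auto simp: topological_ordering_def K_def condensation_def Let_def)
      then obtain j where j: "j < length Vs" "Vs ! j = B" by (auto simp: in_set_conv_nth)
      have "Vs ! length As = A" "length As < length Vs" using Cons.prems by auto
      hence "length As < j" using top AB j by (auto simp: topological_ordering_def)
      thus ?thesis using j Cons.prems by (auto simp: nth_append nth_Cons split: nat.splits)
    qed
    moreover have "A \<in> pverts K" using top Cons.prems by (auto simp: topological_ordering_def)
    moreover have "processed (set Bs) (foldr (process_component I x K) Bs d)"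
      using Cons.IH[of "As @ [A]"] Cons.prems by simp
    ultimately show ?case
      using process_component_processed[of A "set Bs"] by (simp add: K_def)
  qed
  from this[of "[]" Vs] show ?thesis by (simp add: process_all_def)
qed

section \<open>Optimality and tight pairs of the output\<close>

lemma algorithm_A_slack:
  assumes "algorithm_A I d x d'"
  shows "processed (comp ` vertices I) d'"
proof -
  let ?K = "condensation (input_graph I d x)"
  obtain Vs where Vs: "topological_ordering ?K Vs" "d' = process_all I x ?K Vs d"
    using assms by (auto simp: algorithm_A_def)
  have "set Vs = comp ` vertices I"
    using Vs(1) by (simp add: topological_ordering_def pverts_condensation parcs_input_graph_subset comp_def E_def)
  thus ?thesis using process_all_processed[OF Vs(1)] Vs(2) by simp
qed

text \<open>A pair \<open>(v, x v)\<close> joins \<open>v\<close> to its own partner and so lies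
  inside a component, where updates leave slacks alone; it stays tight.\<close>

lemma algorithm_A_optimal:
  assumes "algorithm_A I d x d'"
  shows "dual_optimal I d'"
proof -
  note p = algorithm_A_slack[OF assms, unfolded processed_def, rule_format]
  have feas: "0 \<le> slack I d v l" if "v \<in> vertices I" "l \<in> allowed I v" for v l
    using that opt by (auto simp: dual_optimal_def dual_feasible_iff)
  have "0 \<le> slack I d' v l" if "v \<in> vertices I" "l \<in> allowed I v" for v l
  proof -
    obtain w where "w \<in> vertices I" "l = x w" using allowed_eq_image[OF \<open>v \<in> vertices I\<close> \<open>l \<in> allowed I v\<close>] by auto
    thus ?thesis using p[of v w] that feas[of v l] by (auto split: if_splits)
  qed
  moreover have "slack I d' v (x v) = 0" if "v \<in> vertices I" for v
    using p[of v v] that x complementary_slackness[OF inst opt x that]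
    by (auto simp: optimal_assignment_def assignment_def)
  ultimately show ?thesis by (auto simp: dual_optimal_iff[OF inst opt x] dual_feasible_iff)
qed

text \<open>This is the condition \<open>strict\<close> of \<open>dual_vec_in_rel_interior\<close>.
  Once all components are processed, a tight pair must lie inside a component, and there every
  optimal solution has the slack of \<open>d\<close>.\<close>

lemma algorithm_A_tight:
  assumes "algorithm_A I d x d'" and v: "v \<in> vertices I" and l: "l \<in> allowed I v"
    and "slack I d' v l = 0" and q: "dual_optimal I q"
  shows "slack I q v l = 0"
proof -
  obtain w where w: "w \<in> vertices I" "l = x w" using allowed_eq_image[OF v l] by auto
  have "comp v = comp w" "slack I d v l = 0"
    using algorithm_A_slack[OF assms(1), unfolded processed_def, rule_format, of v w] assms w
    by (auto split: if_splits)
  moreover from this have "w \<in> scc_class E v" using self_in_scc_class[of w E] by (simp add: comp_def)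
  ultimately show ?thesis
    using slack_optimal_within_scc[OF inst opt x q v, of w] w by (simp add: E_def)
qed

end

lemma algorithm_A_exists:
  assumes "lap_instance I"
  shows "\<exists>d'. algorithm_A I d x d'"
proof -
  have "\<exists>Vs. topological_ordering (condensation (input_graph I d x)) Vs"
    using assms by (intro condensation_has_topological_ordering)
      (simp_all add: parcs_input_graph_subset lap_instance_def)
  thus ?thesis unfolding algorithm_A_def by blast
qed

section \<open>Reasoning about random access programs\<close>

text \<open>Total correctness, with the running time handed to the postcondition. Asking for some
  run is enough, since the run is unique.\<close>

definition wp :: "com \<Rightarrow> memory \<Rightarrow> (nat \<Rightarrow> memory \<Rightarrow> bool) \<Rightarrow> bool" where
  "wp c s Q \<longleftrightarrow> (\<exists>t s'. exec c s t s' \<and> Q t s')"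

text \<open>Determinism makes this an equivalence, so that the rules for single commands can serve
  as rewrite rules.\<close>

lemma wp_exec: "exec c s t s' \<Longrightarrow> wp c s Q \<longleftrightarrow> Q t s'"
  unfolding wp_def using exec_deterministic by blast

lemma wp_Skip [simp]: "wp Skip s Q \<longleftrightarrow> Q 1 s"
  by (rule wp_exec[OF exec.Skip])

lemma wp_NSet [simp]:
  "wp (NSet y e) s Q \<longleftrightarrow> Q (1 + ncost e) (s\<lparr>nvar := (nvar s)(y := nval s e)\<rparr>)"
  by (rule wp_exec[OF exec.NSet])

lemma wp_NStore [simp]:
  "wp (NStore a i e) s Q \<longleftrightarrow> Q (1 + ncost i + ncost e)
    (s\<lparr>narr := (narr s)(a := (narr s a)(nval s i := nval s e))\<rparr>)"
  by (rule wp_exec[OF exec.NStore])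

lemma wp_RSet [simp]:
  "wp (RSet y e) s Q \<longleftrightarrow> Q (1 + rcost e) (s\<lparr>rvar := (rvar s)(y := rval s e)\<rparr>)"
  by (rule wp_exec[OF exec.RSet])

lemma wp_RStore [simp]:
  "wp (RStore a i e) s Q \<longleftrightarrow> Q (1 + ncost i + rcost e)
    (s\<lparr>rarr := (rarr s)(a := (rarr s a)(nval s i := rval s e))\<rparr>)"
  by (rule wp_exec[OF exec.RStore])

lemma wp_Seq [simp]: "wp (Seq c d) s Q \<longleftrightarrow> wp c s (\<lambda>t s'. wp d s' (\<lambda>u s''. Q (t + u) s''))"
  unfolding wp_def by (blast intro: exec.Seq elim: exec_SeqE)

lemma wp_Cond [simp]:
  "wp (Cond b c d) s Q \<longleftrightarrow>
    (if bval s b then wp c s (\<lambda>t. Q (1 + bcost b + t)) else wp d s (\<lambda>t. Q (1 + bcost b + t)))"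
  unfolding wp_def by (cases "bval s b") (simp_all, (blast intro: exec.CondTrue[simplified] exec.CondFalse[simplified] elim: exec_CondE[simplified])+)

lemma wp_mono: "wp c s P \<Longrightarrow> (\<And>t s'. P t s' \<Longrightarrow> Q t s') \<Longrightarrow> wp c s Q"
  by (auto simp: wp_def)

section \<open>Frames: the names that a program can change\<close>

primrec nvs :: "com \<Rightarrow> string set" where
  "nvs Skip = {}" | "nvs (NSet y e) = {y}" | "nvs (NStore a i e) = {}" | "nvs (RSet y r) = {}"
| "nvs (RStore a i r) = {}" | "nvs (Seq c d) = nvs c \<union> nvs d" | "nvs (Cond b c d) = nvs c \<union> nvs d"
| "nvs (While b c) = nvs c"

primrec nas :: "com \<Rightarrow> string set" where
  "nas Skip = {}" | "nas (NSet y e) = {}" | "nas (NStore a i e) = {a}" | "nas (RSet y r) = {}"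
| "nas (RStore a i r) = {}" | "nas (Seq c d) = nas c \<union> nas d" | "nas (Cond b c d) = nas c \<union> nas d"
| "nas (While b c) = nas c"

primrec ras :: "com \<Rightarrow> string set" where
  "ras Skip = {}" | "ras (NSet y e) = {}" | "ras (NStore a i e) = {}" | "ras (RSet y r) = {}"
| "ras (RStore a i r) = {a}" | "ras (Seq c d) = ras c \<union> ras d" | "ras (Cond b c d) = ras c \<union> ras d"
| "ras (While b c) = ras c"

text \<open>Real scalars are not framed; \<open>delta\<close>, the only one whose value is carried
  between loops, is followed by explicit invariants.\<close>

definition frame :: "com \<Rightarrow> memory \<Rightarrow> memory \<Rightarrow> bool" where
  "frame c s s' \<longleftrightarrow> (\<forall>y. y \<notin> nvs c \<longrightarrow> nvar s' y = nvar s y) \<and>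
    (\<forall>a. a \<notin> nas c \<longrightarrow> narr s' a = narr s a) \<and> (\<forall>a. a \<notin> ras c \<longrightarrow> rarr s' a = rarr s a)"

lemma frameD:
  assumes "frame c s s'"
  shows "y \<notin> nvs c \<Longrightarrow> nvar s' y = nvar s y" "a \<notin> nas c \<Longrightarrow> narr s' a = narr s a"
    "a \<notin> ras c \<Longrightarrow> rarr s' a = rarr s a"
  using assms by (auto simp: frame_def)

lemma frame_refl [simp]: "frame c s s"
  by (simp add: frame_def)

lemma frame_trans: "frame c s s' \<Longrightarrow> frame c s' s'' \<Longrightarrow> frame c s s''"
  by (simp add: frame_def)

lemma frame_mono:
  "frame c s s' \<Longrightarrow> nvs c \<subseteq> nvs d \<Longrightarrow> nas c \<subseteq> nas d \<Longrightarrow> ras c \<subseteq> ras d \<Longrightarrow> frame d s s'"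
  unfolding frame_def by blast

lemma exec_frame: "exec c s t s' \<Longrightarrow> frame c s s'"
  by (induction rule: exec.induct) (auto simp: frame_def)

lemma wp_frame: "wp c s Q \<Longrightarrow> wp c s (\<lambda>t s'. Q t s' \<and> frame c s s')"
  by (auto simp: wp_def dest: exec_frame)

text \<open>The potential \<open>\<Phi>\<close> pays for the iterations and, every iteration costing time, also gives
  termination.\<close>

lemma wp_While:
  assumes step: "\<And>s'. Inv s' \<Longrightarrow> frame (While b c) s s' \<Longrightarrow> bval s' b \<Longrightarrow>
      wp c s' (\<lambda>t s''. Inv s'' \<and> t + Suc (bcost b) + \<Phi> s'' \<le> \<Phi> s')"
    and init: "Inv s"
    and Q: "\<And>t s'. Inv s' \<Longrightarrow> \<not> bval s' b \<Longrightarrow> frame (While b c) s s' \<Longrightarrow>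
      t \<le> \<Phi> s + Suc (bcost b) \<Longrightarrow> Q t s'"
  shows "wp (While b c) s Q"
proof -
  have "\<exists>t s'. exec (While b c) s1 t s' \<and> Inv s' \<and> \<not> bval s' b \<and> t + \<Phi> s' \<le> \<Phi> s1 + Suc (bcost b)"
    if "Inv s1" "frame (While b c) s s1" for s1
    using that
  proof (induction "\<Phi> s1" arbitrary: s1 rule: less_induct)
    case less
    show ?case
    proof (cases "bval s1 b")
      case False
      thus ?thesis using less.prems exec.WhileFalse[OF False, of c] by fastforce
    next
      case True
      obtain t s2 where s2: "exec c s1 t s2" "Inv s2" "t + Suc (bcost b) + \<Phi> s2 \<le> \<Phi> s1"
        using step[OF less.prems True] by (auto simp: wp_def)
      have "frame (While b c) s1 s2"
        using exec_frame[OF s2(1)] by (rule frame_mono) auto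
      hence "frame (While b c) s s2" using less.prems(2) frame_trans by blast
      moreover have "\<Phi> s2 < \<Phi> s1" using s2(3) by simp
      ultimately obtain u s3 where s3: "exec (While b c) s2 u s3" "Inv s3" "\<not> bval s3 b"
        "u + \<Phi> s3 \<le> \<Phi> s2 + Suc (bcost b)"
        using less.hyps s2(2) by blast
      have "exec (While b c) s1 (1 + bcost b + t + u) s3"
        by (rule exec.WhileTrue[OF True s2(1) s3(1)])
      moreover have "(1 + bcost b + t + u) + \<Phi> s3 \<le> \<Phi> s1 + Suc (bcost b)"
        using s2(3) s3(4) by simp
      ultimately show ?thesis using s3 by blast
    qed
  qed
  from this[OF init frame_refl] obtain t s' where
    "exec (While b c) s t s'" "Inv s'" "\<not> bval s' b" "t + \<Phi> s' \<le> \<Phi> s + Suc (bcost b)"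
    by blast
  moreover from this have "frame (While b c) s s'" by (simp add: exec_frame)
  ultimately show ?thesis using Q unfolding wp_def by fastforce
qed

section \<open>Counting loops\<close>

definition For :: "string \<Rightarrow> nexp \<Rightarrow> nexp \<Rightarrow> com \<Rightarrow> com" where
  "For i lo hi c = Seq (NSet i lo)
    (While (NLess (NVar i) hi) (Seq c (NSet i (NAdd (NVar i) (NConst 1)))))"

lemma changes_For [simp]:
  "nvs (For i lo hi c) = insert i (nvs c)" "nas (For i lo hi c) = nas c"
  "ras (For i lo hi c) = ras c"
  by (auto simp: For_def)

text \<open>\<open>T k\<close> bounds the total time of the iterations before \<open>k\<close>.\<close>

lemma wp_For:
  assumes lo: "nval s lo = l" and le: "l \<le> h" and i: "i \<notin> nvs c"
    and init: "Inv l (s\<lparr>nvar := (nvar s)(i := l)\<rparr>)"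
    and hi: "\<And>k s'. Inv k s' \<Longrightarrow> frame (For i lo hi c) s s' \<Longrightarrow> nvar s' i = k \<Longrightarrow> nval s' hi = h"
    and step: "\<And>k s'. l \<le> k \<Longrightarrow> k < h \<Longrightarrow> Inv k s' \<Longrightarrow> frame (For i lo hi c) s s' \<Longrightarrow>
      nvar s' i = k \<Longrightarrow>
      wp c s' (\<lambda>t s''. Inv (Suc k) (s''\<lparr>nvar := (nvar s'')(i := Suc k)\<rparr>) \<and>
        t + T k + (7 + ncost hi) \<le> T (Suc k))"
    and Q: "\<And>t s'. Inv h s' \<Longrightarrow> nvar s' i = h \<Longrightarrow> frame (For i lo hi c) s s' \<Longrightarrow>
      t + T l \<le> T h + (4 + ncost lo + ncost hi) \<Longrightarrow> Q t s'"
  shows "wp (For i lo hi c) s Q"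
proof -
  let ?b = "NLess (NVar i) hi" and ?c = "Seq c (NSet i (NAdd (NVar i) (NConst 1)))"
  have loop: "\<exists>t s'. exec (While ?b ?c) s1 t s' \<and> Inv h s' \<and> nvar s' i = h \<and>
      t + T k \<le> T h + (3 + ncost hi)"
    if "l \<le> k" "k \<le> h" "Inv k s1" "frame (For i lo hi c) s s1" "nvar s1 i = k" for k s1
    using that(2,1,3-)
  proof (induction k arbitrary: s1 rule: inc_induct)
    case base
    hence "\<not> bval s1 ?b" by (simp add: hi)
    from exec.WhileFalse[OF this, of ?c] show ?case using base by fastforce
  next
    case (step k)
    have b: "bval s1 ?b" using step by (simp add: hi)
    obtain t s2 where s2: "exec c s1 t s2" "Inv (Suc k) (s2\<lparr>nvar := (nvar s2)(i := Suc k)\<rparr>)"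
      "t + T k + (7 + ncost hi) \<le> T (Suc k)"
      using assms(6)[of k s1] step by (auto simp: wp_def)
    let ?s3 = "s2\<lparr>nvar := (nvar s2)(i := Suc k)\<rparr>"
    have "nvar s2 i = k" using frameD(1)[OF exec_frame[OF s2(1)] i] step by simp
    hence body: "exec ?c s1 (t + 4) ?s3"
      using exec.Seq[OF s2(1) exec.NSet[of i "NAdd (NVar i) (NConst 1)" s2]] by (simp add: numeral_eq_Suc)
    have "frame ?c s1 ?s3" by (rule exec_frame[OF body])
    hence "frame (For i lo hi c) s1 ?s3" by (rule frame_mono) auto
    hence "frame (For i lo hi c) s ?s3" using step.prems frame_trans by blast
    then obtain u s4 where s4: "exec (While ?b ?c) ?s3 u s4" "Inv h s4" "nvar s4 i = h"
      "u + T (Suc k) \<le> T h + (3 + ncost hi)"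
      using step.IH[of ?s3] step.prems step.hyps s2(2) by auto
    \<comment> \<open>Per iteration the test costs \<open>3 + ncost hi\<close> and the increment 4,
      which makes the overhead \<open>7 + ncost hi\<close>.\<close>
    have "exec (While ?b ?c) s1 (1 + bcost ?b + (t + 4) + u) s4"
      by (rule exec.WhileTrue[OF b body s4(1)])
    thus ?case using s4 s2(3) by fastforce
  qed
  let ?s1 = "s\<lparr>nvar := (nvar s)(i := l)\<rparr>"
  have first: "exec (NSet i lo) s (1 + ncost lo) ?s1"
    using exec.NSet[of i lo s] lo by simp
  have "frame (NSet i lo) s ?s1" by (rule exec_frame[OF first])
  hence "frame (For i lo hi c) s ?s1" by (rule frame_mono) auto
  from loop[OF order_refl le init this] obtain t s' where s': "exec (While ?b ?c) ?s1 t s'"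
    "Inv h s'" "nvar s' i = h" "t + T l \<le> T h + (3 + ncost hi)"
    by auto
  have run: "exec (For i lo hi c) s ((1 + ncost lo) + t) s'"
    unfolding For_def by (rule exec.Seq[OF first s'(1)])
  have "Q ((1 + ncost lo) + t) s'"
    by (rule Q[OF s'(2,3) exec_frame[OF run]]) (use s'(4) in simp)
  thus ?thesis using run unfolding wp_def by blast
qed

text \<open>Programs compare only by \<open><\<close>; equality takes two comparisons, hence the
  doubled costs in \<open>bval_Eq\<close>.\<close>

definition NEq :: "nexp \<Rightarrow> nexp \<Rightarrow> bexp" where
  "NEq e f = Conj (Neg (NLess e f)) (Neg (NLess f e))"

definition REq :: "rexp \<Rightarrow> rexp \<Rightarrow> bexp" where
  "REq e f = Conj (Neg (RLess e f)) (Neg (RLess f e))"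

lemma bval_Eq [simp]:
  "bval s (NEq e f) \<longleftrightarrow> nval s e = nval s f" "bval s (REq p q) \<longleftrightarrow> rval s p = rval s q"
  "bcost (NEq e f) = 5 + 2 * (ncost e + ncost f)" "bcost (REq p q) = 5 + 2 * (rcost p + rcost q)"
  by (auto simp: NEq_def REq_def)

notation Seq (infixr ";;" 60)

section \<open>Step 1: the exchange graph\<close>

text \<open>Images of initial segments grow by one insertion when an edge is appended; the array
  names are also computed here.\<close>

lemma listed_edges_image:
  "listed_edges s ''F'' = (\<lambda>k. (narr s ''F_tail'' k, narr s ''F_head'' k)) ` {..<nvar s ''F_size''}"
  "listed_edges s ''cond'' =
    (\<lambda>k. (narr s ''cond_tail'' k, narr s ''cond_head'' k)) ` {..<nvar s ''cond_size''}"
  by (auto simp: listed_edges_def)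

text \<open>The allowed lists hold labels but the exchange graph joins vertices; the inverse of
  \<open>x\<close> finds the head of an edge in constant time.\<close>

definition invert_assignment :: com where
  "invert_assignment = For ''v'' (NConst 0) (NVar ''n'')
    (NStore ''xinv'' (NArr ''x'' (NVar ''v'')) (NVar ''v''))"

lemma wp_invert_assignment:
  assumes inj: "inj_on (narr s ''x'') {..<nvar s ''n''}"
    and Q: "\<And>t s'. \<forall>v<nvar s ''n''. narr s' ''xinv'' (narr s ''x'' v) = v \<Longrightarrow>
      frame invert_assignment s s' \<Longrightarrow> t \<le> 12 * nvar s ''n'' + 6 \<Longrightarrow> Q t s'"
  shows "wp invert_assignment s Q"
  unfolding invert_assignment_def
proof (rule wp_For[where l = 0 and h = "nvar s ''n''" and T = "\<lambda>k. 12 * k"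
      and Inv = "\<lambda>k s'. \<forall>v<k. narr s' ''xinv'' (narr s ''x'' v) = v"], goal_cases)
  case (5 k s') show ?case using frameD[OF 5(2)] by simp
next
  case (6 k s')
  have "narr s ''x'' v \<noteq> narr s ''x'' k" if "v < k" for v
    using inj 6(2) that by (auto simp: inj_on_def)
  thus ?case using frameD[OF 6(4)] 6 by (simp add: less_Suc_eq)
next
  case (7 t s') show ?case
    by (rule Q) (use 7 in \<open>auto simp: invert_assignment_def\<close>)
qed auto

definition scan_vertex :: com where
  "scan_vertex =
    For ''k'' (NArr ''first'' (NVar ''v'')) (NArr ''first'' (NAdd (NVar ''v'') (NConst 1)))
      (NSet ''w'' (NArr ''xinv'' (NArr ''label'' (NVar ''k''))) ;;
       Cond (Conj (REq (RAdd (RArr ''alpha'' (NVar ''v'')) (RArr ''beta'' (NArr ''label'' (NVar ''k''))))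
                       (RArr ''cost'' (NVar ''k'')))
                  (Neg (NEq (NVar ''v'') (NVar ''w''))))
         (NStore ''F_tail'' (NVar ''F_size'') (NVar ''v'') ;;
          NStore ''F_head'' (NVar ''F_size'') (NVar ''w'') ;;
          NSet ''F_size'' (NAdd (NVar ''F_size'') (NConst 1)))
         Skip)"

text \<open>Vertices are scanned in increasing order, so the edges come grouped by tail and
  \<open>fstart\<close> records where each group begins: the list doubles as the adjacency structure
  of the search.\<close>

definition scan_edges :: com where
  "scan_edges =
    NStore ''fstart'' (NConst 0) (NConst 0) ;;
    NSet ''F_size'' (NConst 0) ;;
    For ''v'' (NConst 0) (NVar ''n'')
      (scan_vertex ;;
       NStore ''fstart'' (NAdd (NVar ''v'') (NConst 1)) (NVar ''F_size''))"

definition tight_entry :: "memory \<Rightarrow> nat \<Rightarrow> nat \<Rightarrow> bool" where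
  "tight_entry s v k \<longleftrightarrow>
    rarr s ''alpha'' v + rarr s ''beta'' (narr s ''label'' k) = rarr s ''cost'' k \<and>
    v \<noteq> narr s ''xinv'' (narr s ''label'' k)"

definition tight_entries :: "memory \<Rightarrow> nat \<Rightarrow> nat set \<Rightarrow> (nat \<times> nat) set" where
  "tight_entries s v K = {(v, narr s ''xinv'' (narr s ''label'' k)) | k. k \<in> K \<and> tight_entry s v k}"

lemma tight_entries_empty [simp]: "tight_entries s v {} = {}"
  by (simp add: tight_entries_def)

lemma tight_entries_insert:
  "tight_entries s v (insert k K) =
    (if tight_entry s v k then insert (v, narr s ''xinv'' (narr s ''label'' k)) (tight_entries s v K)
     else tight_entries s v K)"
  by (auto simp: tight_entries_def)

lemma tight_entries_frame:
  assumes fr: "frame c s s'" and "''xinv'' \<notin> nas c" "''label'' \<notin> nas c"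
    "''alpha'' \<notin> ras c" "''beta'' \<notin> ras c" "''cost'' \<notin> ras c"
  shows "tight_entries s' = tight_entries s"
  using assms(2-) by (intro ext) (simp add: tight_entries_def tight_entry_def frameD[OF fr])

lemma image_pair_update:
  "(\<lambda>j. (if j = n then p else f j, if j = n then q else g j)) ` {..<Suc n} =
    insert (p, q) ((\<lambda>j. (f j, g j)) ` {..<n})"
  by (auto simp: lessThan_Suc)

text \<open>At most one edge is appended per list entry. Summed over the vertices this bounds
  \<open>F_size\<close> by the input size, which the time bound of the search needs.\<close>

lemma wp_scan_vertex:
  defines "a \<equiv> \<lambda>s. nvar s ''F_size''" and "v \<equiv> \<lambda>s. nvar s ''v''"
  assumes first: "narr s ''first'' (v s) \<le> narr s ''first'' (Suc (v s))"
    and Q: "\<And>t s'. a s \<le> a s' \<Longrightarrow>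
      a s' \<le> a s + (narr s ''first'' (Suc (v s)) - narr s ''first'' (v s)) \<Longrightarrow> \<forall>j<a s. narr s' ''F_tail'' j = narr s ''F_tail'' j \<Longrightarrow>
      \<forall>j\<in>{a s..<a s'}. narr s' ''F_tail'' j = v s \<Longrightarrow>
      listed_edges s' ''F'' = listed_edges s ''F'' \<union>
        tight_entries s (v s) {narr s ''first'' (v s)..<narr s ''first'' (Suc (v s))} \<Longrightarrow>
      frame scan_vertex s s' \<Longrightarrow>
      t \<le> 70 * (narr s ''first'' (Suc (v s)) - narr s ''first'' (v s)) + 20 \<Longrightarrow> Q t s'"
  shows "wp scan_vertex s Q"
  unfolding scan_vertex_def
proof (rule wp_For[where l = "narr s ''first'' (v s)" and h = "narr s ''first'' (Suc (v s))"
      and T = "\<lambda>k. 70 * (k - narr s ''first'' (v s))"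
      and Inv = "\<lambda>k s'. a s \<le> a s' \<and> a s' \<le> a s + (k - narr s ''first'' (v s)) \<and> (\<forall>j<a s. narr s' ''F_tail'' j = narr s ''F_tail'' j) \<and>
        (\<forall>j\<in>{a s..<a s'}. narr s' ''F_tail'' j = v s) \<and>
        listed_edges s' ''F'' = listed_edges s ''F'' \<union>
          tight_entries s (v s) {narr s ''first'' (v s)..<k}"], goal_cases)
  case (5 k s') show ?case using frameD[OF 5(2)] by (simp add: v_def)
next
  case (6 k s')
  note fr = frameD[OF 6(4), simplified]
  have iv: "{narr s ''first'' (nvar s ''v'')..<Suc k} = insert k {narr s ''first'' (nvar s ''v'')..<k}"
    using 6 by (auto simp: v_def)
  have k: "narr s ''first'' (nvar s ''v'') \<le> k" using 6(1) by (simp add: v_def)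
  \<comment> \<open>Appending writes only at positions from the old \<open>F_size\<close> on, so the
    tails stored earlier survive.\<close>
  have ne: "j \<noteq> nvar s' ''F_size''" if "j < nvar s ''F_size''" for j
    using 6(3) that by (auto simp: a_def)
  have le: "nvar s ''F_size'' \<le> nvar s' ''F_size''" using 6(3) by (simp add: a_def)
  show ?case
  proof (cases "tight_entry s (nvar s ''v'') k")
    case True
    thus ?thesis
      using 6(3,5) ne le k
      by (simp add: tight_entry_def fr iv tight_entries_insert listed_edges_image image_pair_update
          Suc_diff_le a_def v_def atLeastLessThanSuc cong: if_cong)
  next
    case False
    thus ?thesis
      using 6(3,5) k
      by (auto simp add: tight_entry_def fr iv tight_entries_insert listed_edges_image Suc_diff_le a_def v_def
          cong: if_cong)
  qed
next
  case (7 t s') show ?case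
    by (rule Q) (use 7 in \<open>auto simp: scan_vertex_def\<close>)
qed (use first in \<open>auto simp: a_def v_def listed_edges_image\<close>)

definition grouped_edges :: "memory \<Rightarrow> nat \<Rightarrow> bool" where
  "grouped_edges s m \<longleftrightarrow> narr s ''fstart'' 0 = 0 \<and> nvar s ''F_size'' = narr s ''fstart'' m \<and>
    (\<forall>v<m. narr s ''fstart'' v \<le> narr s ''fstart'' (Suc v) \<and>
      narr s ''fstart'' (Suc v) \<le> nvar s ''F_size'' \<and>
      (\<forall>k\<in>{narr s ''fstart'' v..<narr s ''fstart'' (Suc v)}. narr s ''F_tail'' k = v))"

lemma wp_scan_edges:
  assumes first0: "narr s ''first'' 0 = 0"
    and first: "\<And>v. v < nvar s ''n'' \<Longrightarrow> narr s ''first'' v \<le> narr s ''first'' (Suc v)"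
    and Q: "\<And>t s'. grouped_edges s' (nvar s ''n'') \<Longrightarrow> nvar s' ''F_size'' \<le> narr s ''first'' (nvar s ''n'') \<Longrightarrow>
      listed_edges s' ''F'' = (\<Union>v<nvar s ''n''.
        tight_entries s v {narr s ''first'' v..<narr s ''first'' (Suc v)}) \<Longrightarrow>
      frame scan_edges s s' \<Longrightarrow>
      t \<le> 70 * (narr s ''first'' (nvar s ''n'') + nvar s ''n'') + 20 \<Longrightarrow> Q t s'"
  shows "wp scan_edges s Q"
proof -
  let ?Inv = "\<lambda>m s'. grouped_edges s' m \<and> nvar s' ''F_size'' \<le> narr s ''first'' m \<and>
    listed_edges s' ''F'' = (\<Union>v<m. tight_entries s v {narr s ''first'' v..<narr s ''first'' (Suc v)})"
  let ?c = "scan_vertex ;; NStore ''fstart'' (NAdd (NVar ''v'') (NConst 1)) (NVar ''F_size'')"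
  let ?s = "s\<lparr>narr := (narr s)(''fstart'' := (narr s ''fstart'')(0 := 0)), nvar := (nvar s)(''F_size'' := 0)\<rparr>"
  have loop: "wp (For ''v'' (NConst 0) (NVar ''n'') ?c) ?s
    (\<lambda>t s'. ?Inv (nvar s ''n'') s' \<and> t \<le> 70 * (narr s ''first'' (nvar s ''n'') + nvar s ''n'') + 6)"
  \<comment> \<open>Time is charged to the list entries and vertices already passed, so that list
    lengths add up instead of being bounded by their maximum.\<close>
  proof (rule wp_For[where l = 0 and h = "nvar s ''n''" and Inv = ?Inv and
        T = "\<lambda>k. 70 * (narr s ''first'' k + k)"], goal_cases)
    case 4 show ?case by (simp add: grouped_edges_def listed_edges_image)
  next
    case (5 k s') show ?case using frameD[OF 5(2)] by (simp add: scan_vertex_def)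
  next
    case (6 k s')
    note fr = frameD[OF 6(4), simplified changes_For, unfolded scan_vertex_def, simplified]
    have te: "tight_entries s' = tight_entries s"
      using tight_entries_frame[OF 6(4)] by (simp add: scan_vertex_def) (simp add: tight_entries_def tight_entry_def fun_eq_iff)
    show ?case
      unfolding wp_Seq
    proof (rule wp_scan_vertex, goal_cases)
      case 1 show ?case using first[OF 6(2)] by (simp add: fr 6)
    next
      case (2 t s'')
      note fr2 = frameD[OF 2(6), unfolded scan_vertex_def, simplified]
      have "grouped_edges (s''\<lparr>narr := (narr s'')(''fstart'' := (narr s' ''fstart'')(Suc k := nvar s'' ''F_size'')),
          nvar := (nvar s'')(''v'' := Suc k)\<rparr>) (Suc k)"
        using 6(3) 2(1,3,4)
        by (auto simp: grouped_edges_def fr fr2 6 less_Suc_eq)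
      moreover have "t + 40 + 70 * narr s ''first'' k + 70 * k \<le> 70 * narr s ''first'' (Suc k) + 70 * Suc k"
        using 2(7) first[OF 6(2)] by (simp add: fr 6)
      moreover have "nvar s' ''F_size'' \<le> narr s ''first'' k"
        "nvar s'' ''F_size'' \<le> nvar s' ''F_size'' + (narr s ''first'' (Suc k) - narr s ''first'' k)"
        using 6(3) 2(2) by (simp_all add: fr 6)
      hence "nvar s'' ''F_size'' \<le> narr s ''first'' (Suc k)" using first[OF 6(2)] by linarith
      ultimately show ?case
        using 2(5) 6(3) by (simp add: listed_edges_image fr fr2 6 lessThan_Suc te Un_commute)
    qed
  qed (use first0 in \<open>auto simp: scan_vertex_def\<close>)
  have "wp scan_edges s (\<lambda>t s'. ?Inv (nvar s ''n'') s' \<and>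
      t \<le> 70 * (narr s ''first'' (nvar s ''n'') + nvar s ''n'') + 20)"
    unfolding scan_edges_def using loop by (auto elim!: wp_mono)
  from wp_frame[OF this] show ?thesis by (rule wp_mono) (auto intro: Q)
qed

section \<open>Invariants of the path-based search for strongly connected components\<close>

locale adjacency =
  fixes n :: nat and fs hd :: "nat \<Rightarrow> nat"
begin

definition E :: "(nat \<times> nat) set" where
  "E = {(v, hd k) | v k. v < n \<and> k \<in> {fs v..<fs (Suc v)}}"

text \<open>For \<open>i \<le> j\<close> the absence of a boundary means that both positions lie in
  the same block; for \<open>j < i\<close> it is automatic, which makes the condition on scanned
  edges in \<open>path_inv\<close> one-sided.\<close>

definition separates :: "nat set \<Rightarrow> nat \<Rightarrow> nat \<Rightarrow> bool" where
  "separates Bs i j \<longleftrightarrow> (\<exists>b\<in>Bs. i < b \<and> b \<le> j)"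

text \<open>\<open>D\<close> is the set of completed vertices, \<open>S\<close> the stack of the current path, \<open>B\<close> the stack of
  the positions at which its blocks begin, and \<open>W\<close> the recursion stack of the search, again given by
  positions in \<open>S\<close>. The next edge of \<open>v\<close> to be scanned is \<open>ptr v\<close>, and \<open>idx v\<close> is \<open>0\<close> for an
  unvisited vertex, \<open>i + 1\<close> for the vertex at position \<open>i\<close> of \<open>S\<close>, and \<open>n + 1\<close> for a completed one;
  the latter exceeds every boundary, so that edges to completed vertices never merge blocks.\<close>

definition done_inv :: "(nat \<Rightarrow> nat) \<Rightarrow> nat set \<Rightarrow> bool" where
  "done_inv idx D \<longleftrightarrow> D \<subseteq> {..<n} \<and> (\<forall>v\<in>D. idx v = Suc n \<and> (\<forall>k\<in>{fs v..<fs (Suc v)}. hd k \<in> D))"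

text \<open>The last two clauses carry the proof. Lower positions reach higher ones, and within a
  block also conversely. A scanned edge ends at a completed vertex or not below the block of its
  tail; an edge into a higher block is harmless, as that block is completed first.\<close>

definition path_inv ::
  "(nat \<Rightarrow> nat) \<Rightarrow> nat \<Rightarrow> (nat \<Rightarrow> nat) \<Rightarrow> nat \<Rightarrow> (nat \<Rightarrow> nat) \<Rightarrow> (nat \<Rightarrow> nat) \<Rightarrow> nat set \<Rightarrow> bool" where
  "path_inv S sp B bp idx ptr D \<longleftrightarrow>
    (\<forall>i<sp. S i < n \<and> S i \<notin> D \<and> idx (S i) = Suc i) \<and>
    (\<forall>v<n. v \<notin> D \<longrightarrow> v \<notin> S ` {..<sp} \<longrightarrow> idx v = 0) \<and>
    (\<forall>v<n. fs v \<le> ptr v \<and> ptr v \<le> fs (Suc v) \<and> (idx v = 0 \<longrightarrow> ptr v = fs v)) \<and>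
    (0 < sp \<longrightarrow> 0 < bp) \<and> (0 < bp \<longrightarrow> B 0 = 0) \<and>
    (\<forall>i<bp. B i < sp) \<and> (\<forall>j<bp. \<forall>i<j. B i < B j) \<and>
    (\<forall>j<sp. \<forall>i\<le>j. (S i, S j) \<in> E\<^sup>* \<and> (\<not> separates (B ` {..<bp}) i j \<longrightarrow> (S j, S i) \<in> E\<^sup>*)) \<and>
    (\<forall>i<sp. \<forall>k\<in>{fs (S i)..<ptr (S i)}.
      hd k \<in> D \<or> (\<exists>j<sp. S j = hd k \<and> \<not> separates (B ` {..<bp}) j i))"

text \<open>A vertex from which the recursion has returned stays on \<open>S\<close> until its block
  is completed; it must have no unscanned edge left.\<close>

definition pending_inv :: "(nat \<Rightarrow> nat) \<Rightarrow> nat \<Rightarrow> (nat \<Rightarrow> nat) \<Rightarrow> nat \<Rightarrow> (nat \<Rightarrow> nat) \<Rightarrow> bool" where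
  "pending_inv S sp W wn ptr \<longleftrightarrow>
    (\<forall>j<wn. W j < sp \<and> (\<forall>i<j. W i < W j)) \<and>
    (\<forall>i<sp. i \<notin> W ` {..<wn} \<longrightarrow> ptr (S i) = fs (Suc (S i)))"

lemma E_reach_closed:
  assumes "\<And>v w. v \<in> C \<Longrightarrow> (v, w) \<in> E \<Longrightarrow> w \<in> C" "(u, w) \<in> E\<^sup>*" "u \<in> C"
  shows "w \<in> C"
  using assms(2,3) by induction (auto dest: assms(1))

lemma done_closed: "done_inv idx D \<Longrightarrow> v \<in> D \<Longrightarrow> (v, w) \<in> E \<Longrightarrow> w \<in> D"
  by (auto simp: done_inv_def E_def)

context
  fixes S sp B bp idx ptr D
  assumes path: "path_inv S sp B bp idx ptr D"
begin

lemma path_top: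
  assumes "0 < sp"
  shows "0 < bp" "B (bp - 1) < sp" "\<And>i. i < bp \<Longrightarrow> B i \<le> B (bp - 1)"
    "B ` {..<bp} = insert (B (bp - 1)) (B ` {..<bp - 1})"
proof -
  show bp: "0 < bp" using assms path by (auto simp: path_inv_def)
  thus "B (bp - 1) < sp" using path by (auto simp: path_inv_def)
  show "B i \<le> B (bp - 1)" if "i < bp" for i
  proof (cases "i = bp - 1")
    case False
    hence "i < bp - 1" "bp - 1 < bp" using that by auto
    thus ?thesis using path by (simp add: path_inv_def less_imp_le)
  qed simp
  have "{..<bp} = insert (bp - 1) {..<bp - 1}" using bp by auto
  thus "B ` {..<bp} = insert (B (bp - 1)) (B ` {..<bp - 1})" by simp
qed

lemma path_reach: "i \<le> j \<Longrightarrow> j < sp \<Longrightarrow> (S i, S j) \<in> E\<^sup>*"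
  and path_back: "i \<le> j \<Longrightarrow> j < sp \<Longrightarrow> \<not> separates (B ` {..<bp}) i j \<Longrightarrow> (S j, S i) \<in> E\<^sup>*"
proof -
  have "\<forall>j<sp. \<forall>i\<le>j. (S i, S j) \<in> E\<^sup>* \<and> (\<not> separates (B ` {..<bp}) i j \<longrightarrow> (S j, S i) \<in> E\<^sup>*)"
    using path unfolding path_inv_def by - (elim conjE, assumption)
  from this[THEN spec, of j] show "i \<le> j \<Longrightarrow> j < sp \<Longrightarrow> (S i, S j) \<in> E\<^sup>*"
    "i \<le> j \<Longrightarrow> j < sp \<Longrightarrow> \<not> separates (B ` {..<bp}) i j \<Longrightarrow> (S j, S i) \<in> E\<^sup>*"
    by blast+
qed

lemma path_vertex: "i < sp \<Longrightarrow> S i < n \<and> S i \<notin> D \<and> idx (S i) = Suc i"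
proof -
  have "\<forall>i<sp. S i < n \<and> S i \<notin> D \<and> idx (S i) = Suc i"
    using path unfolding path_inv_def by - (elim conjE, assumption)
  thus "i < sp \<Longrightarrow> S i < n \<and> S i \<notin> D \<and> idx (S i) = Suc i" by blast
qed

lemma path_scanned:
  "\<forall>i<sp. \<forall>k\<in>{fs (S i)..<ptr (S i)}.
    hd k \<in> D \<or> (\<exists>j<sp. S j = hd k \<and> \<not> separates (B ` {..<bp}) j i)"
  using path unfolding path_inv_def by - (elim conjE, assumption)

lemma path_inj: "inj_on S {..<sp}"
  by (rule inj_onI) (metis Suc_inject lessThan_iff path_vertex)

text \<open>A lower position reaches \<open>S i\<close> along the stack; a higher one lies in the
  same block, since no boundary exceeds the last. Hence whatever an edge from the last block
  discovers is reachable from the whole stack.\<close>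

lemma path_last_block:
  assumes i: "B (bp - 1) \<le> i" "i < sp" and j: "j < sp"
  shows "(S j, S i) \<in> E\<^sup>*"
proof (cases "j \<le> i")
  case True
  thus ?thesis using path_reach i by blast
next
  case False
  have "\<not> separates (B ` {..<bp}) i j"
    using path_top(3) i j False by (fastforce simp: separates_def)
  thus ?thesis using path_back False j by simp
qed

text \<open>Stack entries are distinct, having distinct \<open>idx\<close>, and not completed. The
  bound keeps the truncated subtraction in the potential exact and all boundaries below
  \<open>n + 1\<close>.\<close>

lemma card_path:
  assumes "done_inv idx D"
  shows "card D + sp \<le> n"
proof -
  have "D \<union> S ` {..<sp} \<subseteq> {..<n}" using path assms by (auto simp: path_inv_def done_inv_def)
  hence "card (D \<union> S ` {..<sp}) \<le> n" using card_mono[of "{..<n}"] by fastforce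
  moreover have "card (D \<union> S ` {..<sp}) = card D + card (S ` {..<sp})"
    using path assms finite_subset[of D "{..<n}"]
    by (intro card_Un_disjoint) (auto simp: path_inv_def done_inv_def)
  ultimately show ?thesis by (simp add: card_image[OF path_inj])
qed

text \<open>The new vertex is a block of its own and has no scanned edge, because the edge pointer
  of an unvisited vertex is still at its start.\<close>

lemma path_push:
  assumes v: "v < n" "v \<notin> D" "v \<notin> S ` {..<sp}" and reach: "\<And>i. i < sp \<Longrightarrow> (S i, v) \<in> E\<^sup>*"
  shows "path_inv (S(sp := v)) (Suc sp) (B(bp := sp)) (Suc bp) (idx(v := Suc sp)) ptr D"
proof -
  have ne: "S i \<noteq> v" if "i < sp" for i using v(3) that by auto
  have Bimg: "(B(bp := sp)) ` {..<Suc bp} = insert sp (B ` {..<bp})"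
    by (auto simp: lessThan_Suc)
  have sep: "separates (insert sp Bs) i j \<longleftrightarrow> separates Bs i j \<or> i < sp \<and> sp \<le> j" for Bs i j
    by (auto simp: separates_def)
  have ptr: "idx v = 0" using path v by (auto simp: path_inv_def)
  hence ptr: "ptr v = fs v" using path v(1) by (auto simp: path_inv_def)
  have 1: "\<forall>i<Suc sp. (S(sp := v)) i < n \<and> (S(sp := v)) i \<notin> D \<and> (idx(v := Suc sp)) ((S(sp := v)) i) = Suc i"
    using path v ne by (simp add: path_inv_def less_Suc_eq)
  have 2: "\<forall>w<n. w \<notin> D \<longrightarrow> w \<notin> (S(sp := v)) ` {..<Suc sp} \<longrightarrow> (idx(v := Suc sp)) w = 0"
    using path by (auto simp: path_inv_def lessThan_Suc image_iff)
  have 4: "\<forall>j<Suc sp. \<forall>i\<le>j. ((S(sp := v)) i, (S(sp := v)) j) \<in> E\<^sup>* \<and>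
      (\<not> separates (insert sp (B ` {..<bp})) i j \<longrightarrow> ((S(sp := v)) j, (S(sp := v)) i) \<in> E\<^sup>*)"
  proof (intro allI impI)
    fix j i assume ij: "j < Suc sp" "i \<le> j"
    show "((S(sp := v)) i, (S(sp := v)) j) \<in> E\<^sup>* \<and>
      (\<not> separates (insert sp (B ` {..<bp})) i j \<longrightarrow> ((S(sp := v)) j, (S(sp := v)) i) \<in> E\<^sup>*)"
    proof (cases "j = sp")
      case True
      thus ?thesis using ij reach by (cases "i = sp") (auto simp: sep)
    next
      case False
      hence "j < sp" "i \<noteq> sp" using ij by auto
      thus ?thesis using path ij by (simp add: path_inv_def sep)
    qed
  qed
  have 5: "\<forall>i<Suc sp. \<forall>k\<in>{fs ((S(sp := v)) i)..<ptr ((S(sp := v)) i)}. hd k \<in> D \<or>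
      (\<exists>j<Suc sp. (S(sp := v)) j = hd k \<and> \<not> separates (insert sp (B ` {..<bp})) j i)"
  proof (intro allI impI ballI)
    fix i k assume i: "i < Suc sp" and k: "k \<in> {fs ((S(sp := v)) i)..<ptr ((S(sp := v)) i)}"
    have "i < sp" using i k ptr by (cases "i = sp") auto
    hence "hd k \<in> D \<or> (\<exists>j<sp. S j = hd k \<and> \<not> separates (B ` {..<bp}) j i)"
      using path_scanned k by auto
    thus "hd k \<in> D \<or> (\<exists>j<Suc sp. (S(sp := v)) j = hd k \<and> \<not> separates (insert sp (B ` {..<bp})) j i)"
    proof
      assume "\<exists>j<sp. S j = hd k \<and> \<not> separates (B ` {..<bp}) j i"
      then obtain j where "j < sp" "S j = hd k" "\<not> separates (B ` {..<bp}) j i" by blast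
      thus ?thesis using \<open>i < sp\<close> by (intro disjI2 exI[of _ j]) (simp add: sep)
    qed simp
  qed
  have 6: "\<forall>w<n. fs w \<le> ptr w \<and> ptr w \<le> fs (Suc w) \<and> ((idx(v := Suc sp)) w = 0 \<longrightarrow> ptr w = fs w)"
    using path by (simp add: path_inv_def)
  have bp0: "bp = 0 \<Longrightarrow> sp = 0" using path by (auto simp: path_inv_def)
  have 7: "(B(bp := sp)) 0 = 0" using path bp0 by (auto simp: path_inv_def)
  have 8: "(\<forall>i<Suc bp. (B(bp := sp)) i < Suc sp) \<and>
      (\<forall>j<Suc bp. \<forall>i<j. (B(bp := sp)) i < (B(bp := sp)) j)"
    using path by (auto simp: path_inv_def less_Suc_eq)
  show ?thesis
    unfolding path_inv_def Bimg using 1 2 4 5 6 7 8 by simp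
qed

text \<open>An edge from the last block to an earlier position joins the last two blocks: any
  position reaches \<open>S i0\<close>, the edge leads to \<open>S j0\<close>, and from there the
  target is reached upwards along the stack or backwards inside its block. One boundary is removed
  at a time, however far down the edge goes.\<close>

lemma path_collapse:
  assumes i0: "B (bp - 1) \<le> i0" "i0 < sp" and j0: "j0 < B (bp - 1)" and edge: "(S i0, S j0) \<in> E"
  shows "path_inv S sp B (bp - 1) idx ptr D"
proof -
  have sp: "0 < sp" using i0 by simp
  note top = path_top[OF sp]
  \<comment> \<open>The first boundary is 0, so \<open>j0\<close> below the last one rules out a
    single block.\<close>
  have bp: "0 < bp - 1"
  proof (rule ccontr)
    assume "\<not> 0 < bp - 1"
    hence "bp - 1 = 0" by simp
    thus False using j0 path top(1) by (auto simp: path_inv_def)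
  qed
  have sep: "separates (B ` {..<bp}) i j \<longleftrightarrow> separates (B ` {..<bp - 1}) i j \<or> i < B (bp - 1) \<and> B (bp - 1) \<le> j" for i j
    unfolding top(4) by (auto simp: separates_def)
  have 1: "(S j, S i) \<in> E\<^sup>*" if ij: "j < sp" "i \<le> j" "\<not> separates (B ` {..<bp - 1}) i j" for i j
  proof (cases "i < B (bp - 1) \<and> B (bp - 1) \<le> j")
    case False
    thus ?thesis using path_back ij by (auto simp: sep)
  next
    case True
    have "(S j, S i0) \<in> E\<^sup>*" using path_last_block[OF i0 ij(1)] .
    moreover have "(S j0, S i) \<in> E\<^sup>*"
    proof (cases "j0 \<le> i")
      case True
      thus ?thesis using path_reach ij by simp
    next
      case False
      have "\<not> separates (B ` {..<bp}) i j0"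
        using ij(3) True j0 by (auto simp: sep) (auto simp: separates_def)
      thus ?thesis using False path_back j0 top(2) by simp
    qed
    ultimately show ?thesis using edge by (meson rtrancl.rtrancl_into_rtrancl rtrancl_trans)
  qed
  have 2: "\<forall>j<sp. \<forall>i\<le>j. (S i, S j) \<in> E\<^sup>* \<and>
      (\<not> separates (B ` {..<bp - 1}) i j \<longrightarrow> (S j, S i) \<in> E\<^sup>*)"
    using path_reach 1 by blast
  have 3: "\<forall>i<sp. \<forall>k\<in>{fs (S i)..<ptr (S i)}.
      hd k \<in> D \<or> (\<exists>j<sp. S j = hd k \<and> \<not> separates (B ` {..<bp - 1}) j i)"
    using path_scanned unfolding sep by blast
  have 4: "0 < sp \<longrightarrow> 0 < bp - 1" "0 < bp - 1 \<longrightarrow> B 0 = 0" "\<forall>i<bp - 1. B i < sp"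
    "\<forall>j<bp - 1. \<forall>i<j. B i < B j"
    using bp path by (auto simp: path_inv_def)
  show ?thesis
    using path 2 3 4 unfolding path_inv_def by - (elim conjE, intro conjI; assumption)
qed

lemma path_advance:
  assumes i0: "i0 < sp" and lt: "ptr (S i0) < fs (Suc (S i0))"
    and seen: "hd (ptr (S i0)) \<in> D \<or>
      (\<exists>j<sp. S j = hd (ptr (S i0)) \<and> \<not> separates (B ` {..<bp}) j i0)"
  shows "path_inv S sp B bp idx (ptr(S i0 := Suc (ptr (S i0)))) D"
proof -
  have eq: "S i = S i0 \<longleftrightarrow> i = i0" if "i < sp" for i
    using path_inj that i0 by (auto simp: inj_on_def)
  have "\<forall>i<sp. \<forall>k\<in>{fs (S i)..<(ptr(S i0 := Suc (ptr (S i0)))) (S i)}.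
      hd k \<in> D \<or> (\<exists>j<sp. S j = hd k \<and> \<not> separates (B ` {..<bp}) j i)"
  proof (intro allI impI ballI)
    fix i k assume i: "i < sp" and k: "k \<in> {fs (S i)..<(ptr(S i0 := Suc (ptr (S i0)))) (S i)}"
    show "hd k \<in> D \<or> (\<exists>j<sp. S j = hd k \<and> \<not> separates (B ` {..<bp}) j i)"
    proof (cases "i = i0 \<and> k = ptr (S i0)")
      case False
      hence "k \<in> {fs (S i)..<ptr (S i)}" using k eq[OF i] by (auto split: if_splits)
      thus ?thesis using path_scanned i by blast
    qed (use seen in auto)
  qed
  moreover have "idx (S i0) \<noteq> 0" using path i0 by (auto simp: path_inv_def)
  moreover have "\<forall>v<n. fs v \<le> (ptr(S i0 := Suc (ptr (S i0)))) v \<and>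
      (ptr(S i0 := Suc (ptr (S i0)))) v \<le> fs (Suc v) \<and>
      (idx v = 0 \<longrightarrow> (ptr(S i0 := Suc (ptr (S i0)))) v = fs v)"
    using path lt calculation(2) by (simp add: path_inv_def le_Suc_eq)
  ultimately show ?thesis
    using path unfolding path_inv_def by - (elim conjE, intro conjI; assumption)
qed

lemma path_push_edge_reach:
  assumes "B (bp - 1) \<le> i0" "i0 < sp" "(S i0, v) \<in> E" "i < sp"
  shows "(S i, v) \<in> E\<^sup>*"
  using path_last_block[OF assms(1,2,4)] assms(3) by auto

end

section \<open>Completion of the last block\<close>

context
  fixes S sp B bp idx ptr D W wn
  assumes path: "path_inv S sp B bp idx ptr D" and dn: "done_inv idx D"
    and pend: "pending_inv S sp W wn ptr" and sp: "0 < sp"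
    and exhausted: "0 < wn \<Longrightarrow> W (wn - 1) < B (bp - 1)"
begin

lemma pending_below: "k < wn \<Longrightarrow> W k < B (bp - 1)"
proof (cases "k = wn - 1")
  case False
  assume "k < wn"
  hence "k < wn - 1" "wn - 1 < wn" using False by auto
  hence "W k < W (wn - 1)" using pend by (simp add: pending_inv_def)
  thus ?thesis using exhausted \<open>k < wn\<close> by simp
qed (use exhausted in auto)

text \<open>By \<open>exhausted\<close> every position of the block is off the recursion stack and
  hence fully scanned. A scanned edge cannot descend below the block, and nothing lies above
  it.\<close>

lemma block_closed:
  assumes "v \<in> D \<union> S ` {B (bp - 1)..<sp}" "(v, w) \<in> E"
  shows "w \<in> D \<union> S ` {B (bp - 1)..<sp}"
proof (cases "v \<in> D")
  case True
  thus ?thesis using done_closed[OF dn] assms by auto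
next
  case False
  then obtain i where i: "B (bp - 1) \<le> i" "i < sp" "v = S i" using assms by auto
  have "i \<notin> W ` {..<wn}"
  proof
    assume "i \<in> W ` {..<wn}"
    then obtain k where "k < wn" "i = W k" by auto
    thus False using pending_below[of k] i by simp
  qed
  hence "ptr v = fs (Suc v)" using pend i unfolding pending_inv_def by blast
  then obtain k where k: "k \<in> {fs (S i)..<ptr (S i)}" "w = hd k" using assms(2) i by (auto simp: E_def)
  have "hd k \<in> D \<or> (\<exists>j<sp. S j = hd k \<and> \<not> separates (B ` {..<bp}) j i)"
    using path_scanned[OF path] i(2) k(1) by blast
  thus ?thesis
  proof
    assume "\<exists>j<sp. S j = hd k \<and> \<not> separates (B ` {..<bp}) j i"
    then obtain j where j: "j < sp" "S j = hd k" "\<not> separates (B ` {..<bp}) j i" by blast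
    have "bp - 1 < bp" using path_top(1)[OF path sp] by simp
    hence "separates (B ` {..<bp}) j i" if "j < B (bp - 1)"
      using that i(1) unfolding separates_def by blast
    hence "B (bp - 1) \<le> j" using j(3) not_less by blast
    moreover have "w = S j" using j(2) k(2) by simp
    ultimately show ?thesis using j(1) by auto
  qed (use k in auto)
qed

text \<open>A vertex mutually reachable with \<open>u\<close> cannot leave the closed set, and it is
  not completed, since \<open>D\<close> is closed too and would then contain
  \<open>u\<close>.\<close>

lemma block_scc_class:
  assumes u: "u \<in> S ` {B (bp - 1)..<sp}"
  shows "scc_class E u = S ` {B (bp - 1)..<sp}"
proof (intro set_eqI iffI)
  fix v assume v: "v \<in> scc_class E u"
  hence uv: "(u, v) \<in> E\<^sup>*" "(v, u) \<in> E\<^sup>*" by (auto simp: scc_class_def)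
  have "v \<in> D \<union> S ` {B (bp - 1)..<sp}"
    by (rule E_reach_closed[OF _ uv(1)]) (use u block_closed in blast)+
  moreover have "v \<notin> D"
  proof
    assume "v \<in> D"
    have "u \<in> D" by (rule E_reach_closed[OF _ uv(2) \<open>v \<in> D\<close>]) (rule done_closed[OF dn])
    thus False using u path by (auto simp: path_inv_def)
  qed
  ultimately show "v \<in> S ` {B (bp - 1)..<sp}" by auto
next
  fix v assume "v \<in> S ` {B (bp - 1)..<sp}"
  thus "v \<in> scc_class E u"
    using u path_last_block[OF path] by (auto simp: scc_class_def)
qed

lemma pop_block:
  assumes idx': "\<And>v. idx' v = (if v \<in> S ` {B (bp - 1)..<sp} then Suc n else idx v)"
  defines "D' \<equiv> D \<union> S ` {B (bp - 1)..<sp}"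
  shows "path_inv S (B (bp - 1)) B (bp - 1) idx' ptr D'"
    and "done_inv idx' D'"
    and "pending_inv S (B (bp - 1)) W wn ptr"
proof -
  let ?t = "B (bp - 1)"
  note top = path_top[OF path sp]
  have notin: "S i \<notin> S ` {?t..<sp}" if "i < ?t" for i
  proof
    assume "S i \<in> S ` {?t..<sp}"
    then obtain x where x: "S i = S x" "?t \<le> x" "x < sp" by auto
    have "i = x" by (rule inj_onD[OF path_inj[OF path] x(1)]) (use x that in auto)
    thus False using x that by simp
  qed
  show "pending_inv S ?t W wn ptr"
    unfolding pending_inv_def
  proof (intro conjI allI impI)
    show "W j < ?t" if "j < wn" for j using pending_below[OF that] .
    show "W i < W j" if "j < wn" "i < j" for i j using pend that unfolding pending_inv_def by blast
    show "ptr (S i) = fs (Suc (S i))" if "i < ?t" "i \<notin> W ` {..<wn}" for i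
      using pend that top(2) unfolding pending_inv_def by (meson less_trans)
  qed
  show "done_inv idx' D'"
    unfolding done_inv_def
  proof (intro conjI ballI)
    show "D' \<subseteq> {..<n}" using path dn by (auto simp: D'_def path_inv_def done_inv_def)
  next
    fix v assume "v \<in> D'"
    thus "idx' v = Suc n" using dn by (auto simp: idx' D'_def done_inv_def)
  next
    fix v k assume v: "v \<in> D'" and k: "k \<in> {fs v..<fs (Suc v)}"
    have "v < n" using v path dn by (auto simp: D'_def path_inv_def done_inv_def)
    hence "(v, hd k) \<in> E" using k by (auto simp: E_def)
    thus "hd k \<in> D'" using v block_closed[of v "hd k"] by (simp add: D'_def)
  qed
  have lt: "i < sp" if "i < ?t" for i using that top(2) by simp
  have 1: "\<forall>i<?t. S i < n \<and> S i \<notin> D' \<and> idx' (S i) = Suc i"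
    using path_vertex[OF path lt] notin by (simp add: D'_def idx')
  have 2: "\<forall>v<n. v \<notin> D' \<longrightarrow> v \<notin> S ` {..<?t} \<longrightarrow> idx' v = 0"
  proof (intro allI impI)
    fix v assume v: "v < n" "v \<notin> D'" "v \<notin> S ` {..<?t}"
    have "{..<sp} = {..<?t} \<union> {?t..<sp}" using top(2) by auto
    hence "v \<notin> S ` {..<sp}" using v by (auto simp: D'_def image_Un)
    thus "idx' v = 0" using path v by (auto simp: D'_def path_inv_def idx')
  qed
  have 3: "\<forall>v<n. fs v \<le> ptr v \<and> ptr v \<le> fs (Suc v) \<and> (idx' v = 0 \<longrightarrow> ptr v = fs v)"
    using path by (simp add: path_inv_def idx')
  \<comment> \<open>The first boundary is 0, so a nonempty remainder of the stack still has a
    boundary.\<close>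
  have 4: "0 < ?t \<longrightarrow> 0 < bp - 1"
    using path top(1) by (cases "bp - 1 = 0") (auto simp: path_inv_def)
  have bp: "bp - 1 < bp" using top(1) by simp
  have 5: "(\<forall>i<bp - 1. B i < ?t) \<and> (\<forall>j<bp - 1. \<forall>i<j. B i < B j) \<and> (0 < bp - 1 \<longrightarrow> B 0 = 0)"
    using path bp by (auto simp: path_inv_def)
  have sep: "separates (B ` {..<bp}) i j \<longleftrightarrow> separates (B ` {..<bp - 1}) i j" if "j < ?t" for i j
    unfolding top(4) using that by (auto simp: separates_def)
  have 6: "\<forall>j<?t. \<forall>i\<le>j. (S i, S j) \<in> E\<^sup>* \<and> (\<not> separates (B ` {..<bp - 1}) i j \<longrightarrow> (S j, S i) \<in> E\<^sup>*)"
    using path_reach[OF path _ lt] path_back[OF path _ lt] sep by blast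
  have 7: "\<forall>i<?t. \<forall>k\<in>{fs (S i)..<ptr (S i)}.
      hd k \<in> D' \<or> (\<exists>j<?t. S j = hd k \<and> \<not> separates (B ` {..<bp - 1}) j i)"
  proof (intro allI impI ballI)
    fix i k assume i: "i < ?t" and k: "k \<in> {fs (S i)..<ptr (S i)}"
    have "i < sp" using i top(2) by simp
    hence "hd k \<in> D \<or> (\<exists>j<sp. S j = hd k \<and> \<not> separates (B ` {..<bp}) j i)"
      using path_scanned[OF path] k by blast
    thus "hd k \<in> D' \<or> (\<exists>j<?t. S j = hd k \<and> \<not> separates (B ` {..<bp - 1}) j i)"
    proof
      assume "\<exists>j<sp. S j = hd k \<and> \<not> separates (B ` {..<bp}) j i"
      then obtain j where j: "j < sp" "S j = hd k" "\<not> separates (B ` {..<bp}) j i" by blast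
      show ?thesis
      proof (cases "j < ?t")
        case True
        thus ?thesis using j sep[OF i] by auto
      next
        case False
        thus ?thesis using j(1) by (auto simp: D'_def j(2)[symmetric])
      qed
    qed (simp add: D'_def)
  qed
  show "path_inv S ?t B (bp - 1) idx' ptr D'"
    unfolding path_inv_def using 1 2 3 4 5 6 7 by - (elim conjE, intro conjI; assumption)
qed

end

text \<open>\<open>mem\<close> lists the completed vertices component by component and
  \<open>cs\<close> holds the offsets, so that step 4 can run through one component without
  searching for it. The last clause makes the reversed numbering a topological ordering.\<close>

definition comps_inv ::
  "nat set \<Rightarrow> (nat \<Rightarrow> nat) \<Rightarrow> nat \<Rightarrow> (nat \<Rightarrow> nat) \<Rightarrow> (nat \<Rightarrow> nat) \<Rightarrow> nat \<Rightarrow> bool" where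
  "comps_inv D cmp cnt cs mem dn \<longleftrightarrow>
    D = mem ` {..<dn} \<and> inj_on mem {..<dn} \<and> cs 0 = 0 \<and> cs cnt = dn \<and>
    (\<forall>c<cnt. cs c < cs (Suc c) \<and> (\<forall>p\<in>{cs c..<cs (Suc c)}. cmp (mem p) = c)) \<and>
    (\<forall>u\<in>D. cmp u < cnt \<and> scc_class E u = {v \<in> D. cmp v = cmp u} \<and>
      (\<forall>w. (u, w) \<in> E \<longrightarrow> cmp w \<le> cmp u))"

lemma comps_add:
  assumes inv: "comps_inv D cmp cnt cs mem dn" and dn: "done_inv idx D"
    and X: "X \<inter> D = {}" "\<And>u. u \<in> X \<Longrightarrow> scc_class E u = X"
      "\<And>u w. u \<in> X \<Longrightarrow> (u, w) \<in> E \<Longrightarrow> w \<in> D \<union> X"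
    and cmp': "\<And>v. cmp' v = (if v \<in> X then cnt else cmp v)"
    and mem': "\<And>p. p < dn \<Longrightarrow> mem' p = mem p" "mem' ` {dn..<dn'} = X" "inj_on mem' {dn..<dn'}"
    and lt: "dn < dn'"
  shows "comps_inv (D \<union> X) cmp' (Suc cnt) (cs(Suc cnt := dn')) mem' dn'"
proof -
  have split: "{..<dn'} = {..<dn} \<union> {dn..<dn'}" using lt by auto
  have img: "mem' ` {..<dn} = D" using inv mem'(1) by (auto simp: comps_inv_def)
  \<comment> \<open>Earlier ranges end at or before \<open>dn\<close>, where \<open>mem'\<close>
    still agrees with \<open>mem\<close>.\<close>
  have mono: "cs c \<le> dn" if "c \<le> cnt" for c
    using that
  proof (induction rule: inc_induct)
    case base
    show ?case using inv by (simp add: comps_inv_def)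
  next
    case (step c)
    have "cs c < cs (Suc c)" using inv step by (simp add: comps_inv_def)
    thus ?case using step by simp
  qed
  have "D \<union> X = mem' ` {..<dn'}" by (simp add: split image_Un img mem'(2))
  moreover have "inj_on mem' {..<dn'}"
    unfolding split
    by (rule inj_on_Un[THEN iffD2]) (use inv mem' X(1) img in \<open>auto simp: comps_inv_def inj_on_def\<close>)
  moreover have "(cs(Suc cnt := dn')) c < (cs(Suc cnt := dn')) (Suc c) \<and>
      (\<forall>p\<in>{(cs(Suc cnt := dn')) c..<(cs(Suc cnt := dn')) (Suc c)}. cmp' (mem' p) = c)"
    if c: "c < Suc cnt" for c
  proof (cases "c = cnt")
    case True
    have "cmp' (mem' p) = cnt" if "p \<in> {dn..<dn'}" for p using that mem'(2) by (auto simp: cmp')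
    thus ?thesis using True inv lt by (simp add: comps_inv_def)
  next
    case False
    hence c: "c < cnt" using c by simp
    have "cmp' (mem' p) = c" if p: "p \<in> {cs c..<cs (Suc c)}" for p
    proof -
      have "p < dn" using p mono[of "Suc c"] c by simp
      hence "mem' p = mem p" "mem p \<notin> X" using mem'(1) inv X(1) by (auto simp: comps_inv_def)
      thus ?thesis using inv c p by (simp add: comps_inv_def cmp')
    qed
    thus ?thesis using c inv by (simp add: comps_inv_def)
  qed
  moreover have "cmp' u < Suc cnt \<and> scc_class E u = {v \<in> D \<union> X. cmp' v = cmp' u} \<and>
      (\<forall>w. (u, w) \<in> E \<longrightarrow> cmp' w \<le> cmp' u)" if u: "u \<in> D \<union> X" for u
  proof (cases "u \<in> X")
    case True
    have "cmp v \<noteq> cnt" if "v \<in> D" for v using inv that by (auto simp: comps_inv_def)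
    moreover have "cmp' w \<le> cnt" if "(u, w) \<in> E" for w
      using X(3)[OF True that] inv by (auto simp: comps_inv_def cmp' less_imp_le)
    ultimately show ?thesis using True X(1,2) by (auto simp: cmp')
  next
    case False
    hence u: "u \<in> D" using u by simp
    hence "cmp u < cnt" using inv by (simp add: comps_inv_def)
    moreover have "cmp' w \<le> cmp u" if "(u, w) \<in> E" for w
    proof -
      have "w \<in> D" using done_closed[OF dn u that] .
      hence "w \<notin> X" using X(1) by auto
      thus ?thesis using inv u that by (auto simp: comps_inv_def cmp')
    qed
    moreover have "scc_class E u = {v \<in> D. cmp v = cmp u}" using inv u by (simp add: comps_inv_def)
    moreover have "{v \<in> D \<union> X. cmp' v = cmp u} = {v \<in> D. cmp v = cmp u}"
      using X(1) \<open>cmp u < cnt\<close> by (auto simp: cmp')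
    ultimately show ?thesis using False by (simp add: cmp')
  qed
  ultimately show ?thesis
    using inv by (simp add: comps_inv_def)
qed

end

section \<open>Step 2: the strongly connected components\<close>

context adjacency
begin

definition conf ::
  "(nat \<Rightarrow> nat) \<Rightarrow> nat \<Rightarrow> (nat \<Rightarrow> nat) \<Rightarrow> nat \<Rightarrow> (nat \<Rightarrow> nat) \<Rightarrow> nat \<Rightarrow> (nat \<Rightarrow> nat) \<Rightarrow> (nat \<Rightarrow> nat) \<Rightarrow>
    (nat \<Rightarrow> nat) \<Rightarrow> nat \<Rightarrow> (nat \<Rightarrow> nat) \<Rightarrow> (nat \<Rightarrow> nat) \<Rightarrow> nat \<Rightarrow> nat \<Rightarrow> bool" where
  "conf S sp B bp W wn idx ptr cmp cnt cs mem dn r \<longleftrightarrow>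
    path_inv S sp B bp idx ptr (mem ` {..<dn}) \<and> done_inv idx (mem ` {..<dn}) \<and>
    pending_inv S sp W wn ptr \<and> comps_inv (mem ` {..<dn}) cmp cnt cs mem dn \<and>
    r \<le> n \<and> (\<forall>v<r. idx v \<noteq> 0)"

text \<open>Pushing a vertex costs one unit and adds an entry to each of the three stacks, hence the factor 4.\<close>

definition pot :: "nat \<Rightarrow> nat \<Rightarrow> nat \<Rightarrow> (nat \<Rightarrow> nat) \<Rightarrow> nat \<Rightarrow> nat \<Rightarrow> nat" where
  "pot sp bp wn ptr dn r =
    (n - r) + 4 * (n - (dn + sp)) + (\<Sum>v<n. fs (Suc v) - ptr v) + wn + bp + sp"

lemma conf_count:
  assumes "conf S sp B bp W wn idx ptr cmp cnt cs mem dn r"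
  shows "dn + sp \<le> n"
proof -
  have "card (mem ` {..<dn}) = dn"
    using assms by (simp add: conf_def comps_inv_def card_image)
  moreover have "path_inv S sp B bp idx ptr (mem ` {..<dn})" "done_inv idx (mem ` {..<dn})"
    using assms by (simp_all add: conf_def)
  ultimately show ?thesis using card_path by fastforce
qed

lemma conf_push:
  assumes conf: "conf S sp B bp W wn idx ptr cmp cnt cs mem dn r"
    and v: "v < n" "idx v = 0" and reach: "\<And>i. i < sp \<Longrightarrow> (S i, v) \<in> E\<^sup>*"
  shows "conf (S(sp := v)) (Suc sp) (B(bp := sp)) (Suc bp) (W(wn := sp)) (Suc wn) (idx(v := Suc sp)) ptr
      cmp cnt cs mem dn r"
    and "pot sp bp wn ptr dn r = Suc (pot (Suc sp) (Suc bp) (Suc wn) ptr dn r)"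
proof -
  let ?D = "mem ` {..<dn}"
  have path: "path_inv S sp B bp idx ptr ?D" and dn: "done_inv idx ?D"
    and pend: "pending_inv S sp W wn ptr" using conf by (simp_all add: conf_def)
  have vD: "v \<notin> ?D" using dn v(2) unfolding done_inv_def by fastforce
  have vS: "v \<notin> S ` {..<sp}" using path_vertex[OF path] v(2) by fastforce
  have "pending_inv (S(sp := v)) (Suc sp) (W(wn := sp)) (Suc wn) ptr"
    unfolding pending_inv_def
  proof (intro conjI allI impI)
    show "(W(wn := sp)) j < Suc sp" if "j < Suc wn" for j
      using that pend by (cases "j = wn") (auto simp: pending_inv_def less_Suc_eq)
    show "(W(wn := sp)) i < (W(wn := sp)) j" if "j < Suc wn" "i < j" for i j
      using that pend by (cases "j = wn") (auto simp: pending_inv_def)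
    show "ptr ((S(sp := v)) i) = fs (Suc ((S(sp := v)) i))"
      if i: "i < Suc sp" "i \<notin> (W(wn := sp)) ` {..<Suc wn}" for i
    proof -
      have "(W(wn := sp)) ` {..<Suc wn} = insert sp (W ` {..<wn})" by (auto simp: lessThan_Suc)
      hence "i \<noteq> sp" "i \<notin> W ` {..<wn}" using i(2) by auto
      thus ?thesis using i(1) pend by (simp add: pending_inv_def)
    qed
  qed
  moreover have "done_inv (idx(v := Suc sp)) ?D"
    using dn vD unfolding done_inv_def by (auto simp del: image_iff)
  ultimately show new: "conf (S(sp := v)) (Suc sp) (B(bp := sp)) (Suc bp) (W(wn := sp)) (Suc wn)
      (idx(v := Suc sp)) ptr cmp cnt cs mem dn r"
    using conf path_push[OF path v(1) vD vS reach] unfolding conf_def by simp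
  show "pot sp bp wn ptr dn r = Suc (pot (Suc sp) (Suc bp) (Suc wn) ptr dn r)"
    using conf_count[OF new] by (simp add: pot_def)
qed

lemma conf_root:
  assumes "conf S sp B bp W wn idx ptr cmp cnt cs mem dn r" "r < n" "idx r \<noteq> 0"
  shows "conf S sp B bp W wn idx ptr cmp cnt cs mem dn (Suc r)"
    and "pot sp bp wn ptr dn r = Suc (pot sp bp wn ptr dn (Suc r))"
  using assms by (auto simp: conf_def pot_def less_Suc_eq)

lemma conf_advance:
  assumes conf: "conf S sp B bp W wn idx ptr cmp cnt cs mem dn r"
    and i: "i \<in> W ` {..<wn}" and lt: "ptr (S i) < fs (Suc (S i))"
    and seen: "hd (ptr (S i)) \<in> mem ` {..<dn} \<or>
      (\<exists>j<sp. S j = hd (ptr (S i)) \<and> \<not> separates (B ` {..<bp}) j i)"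
  shows "conf S sp B bp W wn idx (ptr(S i := Suc (ptr (S i)))) cmp cnt cs mem dn r"
    and "pot sp bp wn ptr dn r = Suc (pot sp bp wn (ptr(S i := Suc (ptr (S i)))) dn r)"
proof -
  let ?D = "mem ` {..<dn}" and ?p = "ptr(S i := Suc (ptr (S i)))"
  have path: "path_inv S sp B bp idx ptr ?D" and pend: "pending_inv S sp W wn ptr"
    using conf by (simp_all add: conf_def)
  have isp: "i < sp" using i pend by (auto simp: pending_inv_def)
  have "?p (S j) = fs (Suc (S j))" if "j < sp" "j \<notin> W ` {..<wn}" for j
  proof -
    have "j \<noteq> i" using that i by blast
    hence "S j \<noteq> S i" using path_inj[OF path] that isp by (auto simp: inj_on_def)
    thus ?thesis using pend that by (simp add: pending_inv_def)
  qed
  hence "pending_inv S sp W wn ?p" using pend by (simp add: pending_inv_def)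
  thus "conf S sp B bp W wn idx ?p cmp cnt cs mem dn r"
    using conf path_advance[OF path isp lt seen] unfolding conf_def by simp
  have "S i \<in> {..<n}" using path_vertex[OF path isp] by simp
  hence "(\<Sum>v<n. fs (Suc v) - ptr v) = (fs (Suc (S i)) - ptr (S i)) + (\<Sum>v\<in>{..<n} - {S i}. fs (Suc v) - ptr v)"
    "(\<Sum>v<n. fs (Suc v) - ?p v) = (fs (Suc (S i)) - ?p (S i)) + (\<Sum>v\<in>{..<n} - {S i}. fs (Suc v) - ?p v)"
    by (simp_all add: sum.remove)
  moreover have "(\<Sum>v\<in>{..<n} - {S i}. fs (Suc v) - ?p v) = (\<Sum>v\<in>{..<n} - {S i}. fs (Suc v) - ptr v)"
    by (rule sum.cong) auto
  ultimately show "pot sp bp wn ptr dn r = Suc (pot sp bp wn ?p dn r)"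
    using lt by (simp add: pot_def)
qed

text \<open>A stack vertex has \<open>idx\<close> one above its position, so the strict comparison
  with the boundary is membership in the last block; completed vertices pass the same test.\<close>

lemma conf_seen:
  assumes conf: "conf S sp B bp W wn idx ptr cmp cnt cs mem dn r"
    and i: "B (bp - 1) \<le> i" "i < sp" and w: "w < n" "B (bp - 1) < idx w"
  shows "w \<in> mem ` {..<dn} \<or> (\<exists>j<sp. S j = w \<and> \<not> separates (B ` {..<bp}) j i)"
proof (cases "w \<in> mem ` {..<dn}")
  case False
  have path: "path_inv S sp B bp idx ptr (mem ` {..<dn})" using conf by (simp add: conf_def)
  have sp: "0 < sp" using i by simp
  have "w \<in> S ` {..<sp}" using path False w by (auto simp: path_inv_def)
  then obtain j where j: "j < sp" "w = S j" by auto
  hence "B (bp - 1) \<le> j" using path_vertex[OF path j(1)] w(2) by simp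
  hence "\<not> separates (B ` {..<bp}) j i"
    using path_top(3)[OF path sp] by (fastforce simp: separates_def)
  thus ?thesis using j by auto
qed simp

lemma conf_collapse:
  assumes conf: "conf S sp B bp W wn idx ptr cmp cnt cs mem dn r"
    and i: "B (bp - 1) \<le> i" "i < sp" and w: "(S i, w) \<in> E" "w < n" "idx w \<noteq> 0" "idx w \<le> B (bp - 1)"
  shows "conf S sp B (bp - 1) W wn idx ptr cmp cnt cs mem dn r"
    and "pot sp bp wn ptr dn r = Suc (pot sp (bp - 1) wn ptr dn r)"
proof -
  have path: "path_inv S sp B bp idx ptr (mem ` {..<dn})" and dn: "done_inv idx (mem ` {..<dn})"
    using conf by (simp_all add: conf_def)
  have sp: "0 < sp" using i by simp
  note top = path_top[OF path sp]
  \<comment> \<open>A completed vertex has \<open>idx\<close> equal to \<open>n + 1\<close>, above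
    \<open>B (bp - 1) < sp \<le> n\<close>, so \<open>w\<close> must be on the stack.\<close>
  have "sp \<le> n" using conf_count[OF conf] by simp
  hence "w \<notin> mem ` {..<dn}" using dn w(4) top(2) by (auto simp: done_inv_def)
  hence "w \<in> S ` {..<sp}" using path w by (auto simp: path_inv_def)
  then obtain j where j: "j < sp" "w = S j" by auto
  hence "j < B (bp - 1)" using path_vertex[OF path j(1)] w(4) by simp
  from path_collapse[OF path i this] w(1) j
  show "conf S sp B (bp - 1) W wn idx ptr cmp cnt cs mem dn r"
    using conf by (simp add: conf_def)
  show "pot sp bp wn ptr dn r = Suc (pot sp (bp - 1) wn ptr dn r)"
    using top(1) by (simp add: pot_def)
qed

lemma conf_pop_pending:
  assumes conf: "conf S sp B bp W wn idx ptr cmp cnt cs mem dn r"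
    and wn: "0 < wn" and ge: "fs (Suc (S (W (wn - 1)))) \<le> ptr (S (W (wn - 1)))"
  shows "conf S sp B bp W (wn - 1) idx ptr cmp cnt cs mem dn r"
    and "pot sp bp wn ptr dn r = Suc (pot sp bp (wn - 1) ptr dn r)"
proof -
  have path: "path_inv S sp B bp idx ptr (mem ` {..<dn})" and pend: "pending_inv S sp W wn ptr"
    using conf by (simp_all add: conf_def)
  have "W (wn - 1) < sp" using pend wn by (simp add: pending_inv_def)
  hence "S (W (wn - 1)) < n" using path_vertex[OF path] by simp
  hence eq: "ptr (S (W (wn - 1))) = fs (Suc (S (W (wn - 1))))"
    using path ge by (simp add: path_inv_def le_antisym)
  have "{..<wn} = insert (wn - 1) {..<wn - 1}" using wn by auto
  hence img: "W ` {..<wn} = insert (W (wn - 1)) (W ` {..<wn - 1})" by simp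
  have "pending_inv S sp W (wn - 1) ptr"
    unfolding pending_inv_def
  proof (intro conjI allI impI)
    show "W j < sp" if "j < wn - 1" for j using that pend by (simp add: pending_inv_def)
    show "W i < W j" if "j < wn - 1" "i < j" for i j using that pend by (simp add: pending_inv_def)
    show "ptr (S i) = fs (Suc (S i))" if "i < sp" "i \<notin> W ` {..<wn - 1}" for i
      using that pend eq unfolding pending_inv_def img by blast
  qed
  thus "conf S sp B bp W (wn - 1) idx ptr cmp cnt cs mem dn r" using conf by (simp add: conf_def)
  show "pot sp bp wn ptr dn r = Suc (pot sp bp (wn - 1) ptr dn r)"
    using wn by (simp add: pot_def)
qed

lemma conf_pop_block:
  assumes conf: "conf S sp B bp W wn idx ptr cmp cnt cs mem dn r"
    and sp: "0 < sp" and exhausted: "0 < wn \<Longrightarrow> W (wn - 1) < B (bp - 1)"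
    and idx': "\<And>v. idx' v = (if v \<in> S ` {B (bp - 1)..<sp} then Suc n else idx v)"
    and cmp': "\<And>v. cmp' v = (if v \<in> S ` {B (bp - 1)..<sp} then cnt else cmp v)"
    and mem': "\<And>p. p < dn \<Longrightarrow> mem' p = mem p"
      "\<And>i. i < sp - B (bp - 1) \<Longrightarrow> mem' (dn + i) = S (B (bp - 1) + i)"
    and dn': "dn' = dn + (sp - B (bp - 1))"
  shows "conf S (B (bp - 1)) B (bp - 1) W wn idx' ptr cmp' (Suc cnt) (cs(Suc cnt := dn')) mem' dn' r"
    and "pot sp bp wn ptr dn r = Suc (sp - B (bp - 1)) + pot (B (bp - 1)) (bp - 1) wn ptr dn' r"
proof -
  let ?D = "mem ` {..<dn}" and ?t = "B (bp - 1)"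
  let ?X = "S ` {?t..<sp}"
  have path: "path_inv S sp B bp idx ptr ?D" and dn: "done_inv idx ?D"
    and pend: "pending_inv S sp W wn ptr" and comps: "comps_inv ?D cmp cnt cs mem dn"
    using conf by (simp_all add: conf_def)
  note top = path_top[OF path sp]
  note blk = path dn pend sp exhausted
  have 1: "\<exists>i<sp - ?t. p = dn + i" if "p \<in> {dn..<dn'}" for p
    using that top(2) by (intro exI[of _ "p - dn"]) (auto simp: dn')
  have img: "mem' ` {dn..<dn'} = ?X"
  proof (intro set_eqI iffI)
    fix v assume "v \<in> mem' ` {dn..<dn'}"
    then obtain i where "i < sp - ?t" "v = mem' (dn + i)" using 1 by blast
    thus "v \<in> ?X" using mem'(2) by auto
  next
    fix v assume "v \<in> ?X"
    then obtain j where j: "?t \<le> j" "j < sp" "v = S j" by auto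
    hence "v = mem' (dn + (j - ?t))" using mem'(2)[of "j - ?t"] by simp
    thus "v \<in> mem' ` {dn..<dn'}" using j by (intro image_eqI[of _ _ "dn + (j - ?t)"]) (auto simp: dn')
  qed
  have inj: "inj_on mem' {dn..<dn'}"
  proof (rule inj_onI)
    fix p q assume pq: "p \<in> {dn..<dn'}" "q \<in> {dn..<dn'}" "mem' p = mem' q"
    then obtain i j where ij: "i < sp - ?t" "p = dn + i" "j < sp - ?t" "q = dn + j" using 1 by metis
    hence "S (?t + i) = S (?t + j)" using pq(3) mem'(2) by simp
    hence "?t + i = ?t + j" by (rule inj_onD[OF path_inj[OF path]]) (use ij in auto)
    thus "p = q" using ij by simp
  qed
  have lt: "dn < dn'" using top(2) by (simp add: dn')
  have disj: "?X \<inter> ?D = {}" using path_vertex[OF path] by fastforce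
  have D': "mem' ` {..<dn'} = ?D \<union> ?X"
  proof -
    have "{..<dn'} = {..<dn} \<union> {dn..<dn'}" using lt by auto
    moreover have "mem' ` {..<dn} = ?D" using mem'(1) by auto
    ultimately show ?thesis by (simp add: image_Un img)
  qed
  have "comps_inv (?D \<union> ?X) cmp' (Suc cnt) (cs(Suc cnt := dn')) mem' dn'"
    by (rule comps_add[OF comps dn disj block_scc_class[OF blk] _ cmp' mem'(1) img inj lt])
      (use block_closed[OF blk] in blast)+
  moreover have "\<forall>v<r. idx' v \<noteq> 0" using conf by (simp add: idx' conf_def)
  ultimately show new: "conf S ?t B (bp - 1) W wn idx' ptr cmp' (Suc cnt) (cs(Suc cnt := dn')) mem' dn' r"
    using pop_block[OF blk idx'] conf unfolding conf_def D' by simp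
  \<comment> \<open>Vertices only move from the stack to the completed ones, so the term with factor
    4 is unchanged; the shorter stack pays for each of them and the lost boundary for the
    rest.\<close>
  have "dn' + ?t = dn + sp" using top(2) by (simp add: dn')
  thus "pot sp bp wn ptr dn r = Suc (sp - ?t) + pot ?t (bp - 1) wn ptr dn' r"
    using top by (simp add: pot_def)
qed

end

section \<open>The search as a program\<close>

definition push_vertex :: com where
  "push_vertex =
    NStore ''S'' (NVar ''sp'') (NVar ''w'') ;;
    NStore ''B'' (NVar ''bp'') (NVar ''sp'') ;;
    NStore ''W'' (NVar ''wp'') (NVar ''sp'') ;;
    NStore ''idx'' (NVar ''w'') (NAdd (NVar ''sp'') (NConst 1)) ;;
    NSet ''sp'' (NAdd (NVar ''sp'') (NConst 1)) ;;
    NSet ''bp'' (NAdd (NVar ''bp'') (NConst 1)) ;;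
    NSet ''wp'' (NAdd (NVar ''wp'') (NConst 1))"

definition advance :: com where
  "advance = NStore ''ptr'' (NVar ''v'') (NAdd (NArr ''ptr'' (NVar ''v'')) (NConst 1))"

definition pop_loop :: com where
  "pop_loop = For ''i'' (NVar ''top'') (NVar ''sp'')
    (NSet ''v'' (NArr ''S'' (NVar ''i'')) ;;
     NStore ''comp'' (NVar ''v'') (NVar ''comp_count'') ;;
     NStore ''idx'' (NVar ''v'') (NAdd (NVar ''n'') (NConst 1)) ;;
     NStore ''mem'' (NVar ''dn'') (NVar ''v'') ;;
     NSet ''dn'' (NAdd (NVar ''dn'') (NConst 1)))"

definition last_boundary :: nexp where
  "last_boundary = NArr ''B'' (NSub (NVar ''bp'') (NConst 1))"

definition last_pending :: nexp where
  "last_pending = NArr ''W'' (NSub (NVar ''wp'') (NConst 1))"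

definition pop_component :: com where
  "pop_component =
    NSet ''top'' last_boundary ;;
    pop_loop ;;
    NSet ''sp'' (NVar ''top'') ;;
    NSet ''bp'' (NSub (NVar ''bp'') (NConst 1)) ;;
    NSet ''comp_count'' (NAdd (NVar ''comp_count'') (NConst 1)) ;;
    NStore ''cs'' (NVar ''comp_count'') (NVar ''dn'')"

text \<open>A merge does not advance the edge pointer: the same edge is met again until the last
  boundary is low enough. The removed boundary pays for the repetition.\<close>

definition scan_edge :: com where
  "scan_edge =
    NSet ''v'' (NArr ''S'' last_pending) ;;
    Cond (NLess (NArr ''ptr'' (NVar ''v'')) (NArr ''fstart'' (NAdd (NVar ''v'') (NConst 1))))
      (NSet ''w'' (NArr ''F_head'' (NArr ''ptr'' (NVar ''v''))) ;;
       Cond (NEq (NArr ''idx'' (NVar ''w'')) (NConst 0))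
         (push_vertex ;; advance)
         (Cond (Neg (NLess last_boundary (NArr ''idx'' (NVar ''w''))))
            (NSet ''bp'' (NSub (NVar ''bp'') (NConst 1)))
            advance))
      (NSet ''wp'' (NSub (NVar ''wp'') (NConst 1)))"

definition next_root :: com where
  "next_root =
    NSet ''w'' (NVar ''r'') ;;
    Cond (NEq (NArr ''idx'' (NVar ''w'')) (NConst 0)) push_vertex Skip ;;
    NSet ''r'' (NAdd (NVar ''r'') (NConst 1))"

text \<open>The guard asks for a remaining root or a nonempty stack; its form is due to a language
  without disjunction.\<close>

definition search_loop :: com where
  "search_loop =
    While (Neg (Conj (Neg (NLess (NVar ''r'') (NVar ''n''))) (Neg (NLess (NConst 0) (NVar ''sp'')))))
      (Cond (NLess (NConst 0) (NVar ''sp''))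
        (Cond (Conj (NLess (NConst 0) (NVar ''wp'')) (Neg (NLess last_pending last_boundary)))
          scan_edge pop_component)
        next_root)"

lemma wp_pop_loop:
  assumes le: "nvar s ''top'' \<le> nvar s ''sp''"
    and Q: "\<And>t s'. nvar s' ''dn'' = nvar s ''dn'' + (nvar s ''sp'' - nvar s ''top'') \<Longrightarrow>
      (\<And>p. p < nvar s ''dn'' \<Longrightarrow> narr s' ''mem'' p = narr s ''mem'' p) \<Longrightarrow>
      (\<And>i. i < nvar s ''sp'' - nvar s ''top'' \<Longrightarrow>
        narr s' ''mem'' (nvar s ''dn'' + i) = narr s ''S'' (nvar s ''top'' + i)) \<Longrightarrow>
      (\<And>v. narr s' ''comp'' v = (if v \<in> narr s ''S'' ` {nvar s ''top''..<nvar s ''sp''}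
        then nvar s ''comp_count'' else narr s ''comp'' v)) \<Longrightarrow>
      (\<And>v. narr s' ''idx'' v = (if v \<in> narr s ''S'' ` {nvar s ''top''..<nvar s ''sp''}
        then Suc (nvar s ''n'') else narr s ''idx'' v)) \<Longrightarrow>
      frame pop_loop s s' \<Longrightarrow> t \<le> 50 * (nvar s ''sp'' - nvar s ''top'') + 10 \<Longrightarrow> Q t s'"
  shows "wp pop_loop s Q"
  unfolding pop_loop_def
proof (rule wp_For[where l = "nvar s ''top''" and h = "nvar s ''sp''" and
      T = "\<lambda>k. 50 * (k - nvar s ''top'')" and
      Inv = "\<lambda>k s'. nvar s' ''dn'' = nvar s ''dn'' + (k - nvar s ''top'') \<and>
        (\<forall>p<nvar s ''dn''. narr s' ''mem'' p = narr s ''mem'' p) \<and>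
        (\<forall>i<k - nvar s ''top''. narr s' ''mem'' (nvar s ''dn'' + i) = narr s ''S'' (nvar s ''top'' + i)) \<and>
        (\<forall>v. narr s' ''comp'' v = (if v \<in> narr s ''S'' ` {nvar s ''top''..<k}
          then nvar s ''comp_count'' else narr s ''comp'' v)) \<and>
        (\<forall>v. narr s' ''idx'' v = (if v \<in> narr s ''S'' ` {nvar s ''top''..<k}
          then Suc (nvar s ''n'') else narr s ''idx'' v))"], goal_cases)
  case (5 k s') show ?case using frameD[OF 5(2)] by simp
next
  case (6 k s')
  note fr = frameD[OF 6(4), simplified]
  have iv: "{nvar s ''top''..<Suc k} = insert k {nvar s ''top''..<k}" using 6(1) by auto
  have Sk: "Suc k - nvar s ''top'' = Suc (k - nvar s ''top'')" "nvar s ''top'' + (k - nvar s ''top'') = k"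
    using 6(1) by auto
  show ?case using 6(1,3,5) by (simp add: fr iv Sk less_Suc_eq) auto
next
  case (7 t s') show ?case
    by (rule Q) (use 7 in \<open>auto simp: pop_loop_def\<close>)
qed (use le in auto)

context adjacency
begin

definition search_inv :: "memory \<Rightarrow> bool" where
  "search_inv s \<longleftrightarrow>
    conf (narr s ''S'') (nvar s ''sp'') (narr s ''B'') (nvar s ''bp'') (narr s ''W'') (nvar s ''wp'')
      (narr s ''idx'') (narr s ''ptr'') (narr s ''comp'') (nvar s ''comp_count'') (narr s ''cs'')
      (narr s ''mem'') (nvar s ''dn'') (nvar s ''r'') \<and>
    nvar s ''n'' = n \<and> narr s ''fstart'' = fs \<and> narr s ''F_head'' = hd"

definition search_pot :: "memory \<Rightarrow> nat" where
  "search_pot s = pot (nvar s ''sp'') (nvar s ''bp'') (nvar s ''wp'') (narr s ''ptr'') (nvar s ''dn'')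
    (nvar s ''r'')"

lemma wp_next_root:
  assumes inv: "search_inv s" and sp: "nvar s ''sp'' = 0" and r: "nvar s ''r'' < n"
  shows "wp next_root s (\<lambda>t s'. search_inv s' \<and> t + 100 * search_pot s' + 40 \<le> 100 * search_pot s)"
proof -
  note defs = next_root_def push_vertex_def search_inv_def search_pot_def
  have C: "conf (narr s ''S'') 0 (narr s ''B'') (nvar s ''bp'') (narr s ''W'') (nvar s ''wp'')
      (narr s ''idx'') (narr s ''ptr'') (narr s ''comp'') (nvar s ''comp_count'') (narr s ''cs'')
      (narr s ''mem'') (nvar s ''dn'') (nvar s ''r'')"
    using inv sp by (simp add: search_inv_def)
  show ?thesis
  proof (cases "narr s ''idx'' (nvar s ''r'') = 0")
    case True
    note p = conf_push[OF C r True, simplified]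
    note q = conf_root[OF p(1) r, simplified]
    show ?thesis using inv sp True p q by (simp add: defs)
  next
    case False
    show ?thesis using inv sp False conf_root[OF C r False] by (simp add: defs)
  qed
qed

text \<open>The 30 units set aside pay for the loop test (11) and the two branch tests (4 and 15)
  that lead here.\<close>

lemma wp_scan_edge:
  assumes heads: "\<And>v k. v < n \<Longrightarrow> k \<in> {fs v..<fs (Suc v)} \<Longrightarrow> hd k < n"
    and inv: "search_inv s" and sp: "0 < nvar s ''sp''" and pending: "0 < nvar s ''wp''"
    and top: "narr s ''B'' (nvar s ''bp'' - 1) \<le> narr s ''W'' (nvar s ''wp'' - 1)"
  shows "wp scan_edge s (\<lambda>t s'. search_inv s' \<and> t + 100 * search_pot s' + 30 \<le> 100 * search_pot s)"
proof -
  note defs = scan_edge_def push_vertex_def advance_def search_inv_def search_pot_def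
    last_pending_def last_boundary_def
  have C: "conf (narr s ''S'') (nvar s ''sp'') (narr s ''B'') (nvar s ''bp'') (narr s ''W'') (nvar s ''wp'')
      (narr s ''idx'') (narr s ''ptr'') (narr s ''comp'') (nvar s ''comp_count'') (narr s ''cs'')
      (narr s ''mem'') (nvar s ''dn'') (nvar s ''r'')"
    and mem: "nvar s ''n'' = n" "narr s ''fstart'' = fs" "narr s ''F_head'' = hd"
    using inv by (auto simp: search_inv_def)
  have path: "path_inv (narr s ''S'') (nvar s ''sp'') (narr s ''B'') (nvar s ''bp'') (narr s ''idx'')
      (narr s ''ptr'') (narr s ''mem'' ` {..<nvar s ''dn''})"
    and pend: "pending_inv (narr s ''S'') (nvar s ''sp'') (narr s ''W'') (nvar s ''wp'') (narr s ''ptr'')"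
    using C by (simp_all add: conf_def)
  define i where "i = narr s ''W'' (nvar s ''wp'' - Suc 0)"
  define v where "v = narr s ''S'' i"
  have i: "i < nvar s ''sp''" "i \<in> narr s ''W'' ` {..<nvar s ''wp''}"
    using pend pending by (auto simp: pending_inv_def i_def)
  have ti: "narr s ''B'' (nvar s ''bp'' - 1) \<le> i" using top by (simp add: i_def)
  have vn: "v < n" using path_vertex[OF path i(1)] by (simp add: v_def)
  have ptr: "fs v \<le> narr s ''ptr'' v" using path vn by (simp add: path_inv_def)
  show ?thesis
  proof (cases "narr s ''ptr'' v < fs (Suc v)")
    case False
    hence "fs (Suc (narr s ''S'' (narr s ''W'' (nvar s ''wp'' - 1)))) \<le>
        narr s ''ptr'' (narr s ''S'' (narr s ''W'' (nvar s ''wp'' - 1)))"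
      by (simp add: v_def i_def)
    from conf_pop_pending[OF C pending this] show ?thesis
      using False inv by (simp add: defs v_def i_def)
  next
    case True
    define w where "w = hd (narr s ''ptr'' v)"
    have wn: "w < n" using heads[OF vn] True ptr by (simp add: w_def)
    have edge: "(narr s ''S'' i, w) \<in> E" using vn True ptr by (auto simp: E_def w_def v_def)
    show ?thesis
    proof (cases "narr s ''idx'' w = 0")
      case new: True
      have reach: "(narr s ''S'' j, w) \<in> E\<^sup>*" if "j < nvar s ''sp''" for j
        by (rule path_push_edge_reach[OF path ti i(1) edge that])
      note p = conf_push[OF C wn new reach]
      let ?S = "(narr s ''S'')(nvar s ''sp'' := w)" and ?W = "(narr s ''W'')(nvar s ''wp'' := nvar s ''sp'')"
        and ?B = "(narr s ''B'')(nvar s ''bp'' := nvar s ''sp'')"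
      have Si: "?S i = v" using i(1) by (simp add: v_def)
      have i': "i \<in> ?W ` {..<Suc (nvar s ''wp'')}"
        using i(2) by (auto simp: lessThan_Suc)
      \<comment> \<open>The edge to the new vertex goes up across the new boundary; as
        \<open>separates\<close> is one-sided, it still counts as scanned.\<close>
      have "?S (nvar s ''sp'') = w" "\<not> separates (?B ` {..<Suc (nvar s ''bp'')}) (nvar s ''sp'') i"
        using i(1) by (auto simp: separates_def)
      hence seen: "\<exists>j<Suc (nvar s ''sp''). ?S j = hd (narr s ''ptr'' (?S i)) \<and>
          \<not> separates (?B ` {..<Suc (nvar s ''bp'')}) j i"
        unfolding Si w_def[symmetric] by blast
      have lt: "narr s ''ptr'' (?S i) < fs (Suc (?S i))" using True unfolding Si .
      note q0 = conf_advance[OF p(1) i' lt disjI2[OF seen], unfolded Si]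
      have q: "conf ?S (Suc (nvar s ''sp'')) ?B (Suc (nvar s ''bp'')) ?W (Suc (nvar s ''wp''))
          ((narr s ''idx'')(w := Suc (nvar s ''sp''))) ((narr s ''ptr'')(v := Suc (narr s ''ptr'' v)))
          (narr s ''comp'') (nvar s ''comp_count'') (narr s ''cs'') (narr s ''mem'') (nvar s ''dn'')
          (nvar s ''r'')"
        "pot (Suc (nvar s ''sp'')) (Suc (nvar s ''bp'')) (Suc (nvar s ''wp'')) (narr s ''ptr'')
            (nvar s ''dn'') (nvar s ''r'') =
          Suc (pot (Suc (nvar s ''sp'')) (Suc (nvar s ''bp'')) (Suc (nvar s ''wp''))
            ((narr s ''ptr'')(v := Suc (narr s ''ptr'' v))) (nvar s ''dn'') (nvar s ''r''))"
        by (rule q0, assumption)+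
      show ?thesis
        using True new inv p(2) q mem
        by (simp add: defs v_def[symmetric] i_def[symmetric] w_def[symmetric])
    next
      case old: False
      show ?thesis
      proof (cases "narr s ''B'' (nvar s ''bp'' - 1) < narr s ''idx'' w")
        case seen: True
        from conf_seen[OF C ti i(1) wn seen]
        have "hd (narr s ''ptr'' (narr s ''S'' i)) \<in> narr s ''mem'' ` {..<nvar s ''dn''} \<or>
          (\<exists>j<nvar s ''sp''. narr s ''S'' j = hd (narr s ''ptr'' (narr s ''S'' i)) \<and>
            \<not> separates (narr s ''B'' ` {..<nvar s ''bp''}) j i)"
          by (simp add: w_def v_def)
        from conf_advance[OF C i(2) True[unfolded v_def] this]
        show ?thesis
          using True old seen inv mem
          by (simp add: defs v_def[symmetric] i_def[symmetric] w_def[symmetric])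
      next
        case collapse: False
        from conf_collapse[OF C ti i(1) edge wn old] collapse
        show ?thesis
          using True old inv mem
          by (simp add: defs v_def[symmetric] i_def[symmetric] w_def[symmetric])
      qed
    qed
  qed
qed

lemma wp_pop_component:
  assumes inv: "search_inv s" and sp: "0 < nvar s ''sp''"
    and exhausted: "0 < nvar s ''wp'' \<Longrightarrow>
      narr s ''W'' (nvar s ''wp'' - 1) < narr s ''B'' (nvar s ''bp'' - 1)"
  shows "wp pop_component s (\<lambda>t s'. search_inv s' \<and> t + 100 * search_pot s' + 30 \<le> 100 * search_pot s)"
proof -
  have C: "conf (narr s ''S'') (nvar s ''sp'') (narr s ''B'') (nvar s ''bp'') (narr s ''W'') (nvar s ''wp'')
      (narr s ''idx'') (narr s ''ptr'') (narr s ''comp'') (nvar s ''comp_count'') (narr s ''cs'')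
      (narr s ''mem'') (nvar s ''dn'') (nvar s ''r'')"
    and mem: "nvar s ''n'' = n" "narr s ''fstart'' = fs" "narr s ''F_head'' = hd"
    using inv by (auto simp: search_inv_def)
  have path: "path_inv (narr s ''S'') (nvar s ''sp'') (narr s ''B'') (nvar s ''bp'') (narr s ''idx'')
      (narr s ''ptr'') (narr s ''mem'' ` {..<nvar s ''dn''})"
    using C by (simp add: conf_def)
  have top: "narr s ''B'' (nvar s ''bp'' - 1) < nvar s ''sp''" by (rule path_top(2)[OF path sp])
  show ?thesis
    unfolding pop_component_def last_boundary_def wp_Seq wp_NSet
  proof (rule wp_pop_loop, goal_cases)
    case 1 show ?case using top by simp
  next
    case (2 t s')
    note fr = frameD[OF 2(6), unfolded pop_loop_def, simplified]
    note new = 2(1-5)[simplified]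
    have new2: "\<And>v. narr s' ''idx'' v = (if v \<in> narr s ''S'' ` {narr s ''B'' (nvar s ''bp'' - 1)..<nvar s ''sp''}
        then Suc n else narr s ''idx'' v)"
      using new(5) mem(1) by simp
    note p = conf_pop_block[OF C sp exhausted new2, of "narr s' ''comp''" "narr s' ''mem''" "nvar s' ''dn''"]
    have q: "conf (narr s ''S'') (narr s ''B'' (nvar s ''bp'' - 1)) (narr s ''B'') (nvar s ''bp'' - 1)
        (narr s ''W'') (nvar s ''wp'') (narr s' ''idx'') (narr s ''ptr'') (narr s' ''comp'')
        (Suc (nvar s ''comp_count'')) ((narr s ''cs'')(Suc (nvar s ''comp_count'') := nvar s' ''dn''))
        (narr s' ''mem'') (nvar s' ''dn'') (nvar s ''r'')"
      "pot (nvar s ''sp'') (nvar s ''bp'') (nvar s ''wp'') (narr s ''ptr'') (nvar s ''dn'') (nvar s ''r'') =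
        Suc (nvar s ''sp'' - narr s ''B'' (nvar s ''bp'' - 1)) +
        pot (narr s ''B'' (nvar s ''bp'' - 1)) (nvar s ''bp'' - 1) (nvar s ''wp'') (narr s ''ptr'')
          (nvar s' ''dn'') (nvar s ''r'')"
      by (rule p; use new in simp)+
    \<comment> \<open>The loop takes at most 50 units per vertex, while the potential falls by one
      per vertex and one more for the block.\<close>
    show ?case using q 2(7) by (simp add: search_inv_def search_pot_def fr mem)
  qed
qed

end

text \<open>Memory starts arbitrary. The stacks need no initial contents, since their entries matter
  only below the stack pointers.\<close>

definition init_search :: com where
  "init_search =
    For ''v'' (NConst 0) (NVar ''n'')
      (NStore ''idx'' (NVar ''v'') (NConst 0) ;;
       NStore ''ptr'' (NVar ''v'') (NArr ''fstart'' (NVar ''v''))) ;;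
    NSet ''sp'' (NConst 0) ;; NSet ''bp'' (NConst 0) ;; NSet ''wp'' (NConst 0) ;;
    NSet ''dn'' (NConst 0) ;; NSet ''comp_count'' (NConst 0) ;; NSet ''r'' (NConst 0) ;;
    NStore ''cs'' (NConst 0) (NConst 0)"

definition scan_components :: com where
  "scan_components =
    NSet ''cond_size'' (NConst 0) ;;
    For ''k'' (NConst 0) (NVar ''F_size'')
      (NSet ''a'' (NArr ''comp'' (NArr ''F_tail'' (NVar ''k''))) ;;
       NSet ''b'' (NArr ''comp'' (NArr ''F_head'' (NVar ''k''))) ;;
       Cond (NEq (NVar ''a'') (NVar ''b'')) Skip
         (NStore ''cond_tail'' (NVar ''cond_size'') (NVar ''a'') ;;
          NStore ''cond_head'' (NVar ''cond_size'') (NVar ''b'') ;;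
          NSet ''cond_size'' (NAdd (NVar ''cond_size'') (NConst 1))))"

definition find_components :: com where
  "find_components = init_search ;; search_loop ;; scan_components"

lemma sum_telescope_nat:
  fixes f :: "nat \<Rightarrow> nat"
  assumes "\<And>v. v < n \<Longrightarrow> f v \<le> f (Suc v)"
  shows "(\<Sum>v<n. f (Suc v) - f v) + f 0 = f n"
  using assms
proof (induction n)
  case (Suc n)
  have "f n \<le> f (Suc n)" "(\<Sum>v<n. f (Suc v) - f v) + f 0 = f n" using Suc by simp_all
  thus ?case unfolding sum.lessThan_Suc by linarith
qed simp

lemma wp_scan_components:
  assumes Q: "\<And>t s'. listed_edges s' ''cond'' =
        {(narr s ''comp'' u, narr s ''comp'' w) | u w.
          (u, w) \<in> listed_edges s ''F'' \<and> narr s ''comp'' u \<noteq> narr s ''comp'' w} \<Longrightarrow>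
      nvar s' ''cond_size'' \<le> nvar s ''F_size'' \<Longrightarrow>
      frame scan_components s s' \<Longrightarrow> t \<le> 60 * nvar s ''F_size'' + 20 \<Longrightarrow> Q t s'"
  shows "wp scan_components s Q"
proof -
  let ?c = "narr s ''comp''" and ?u = "narr s ''F_tail''" and ?w = "narr s ''F_head''"
  let ?es = "\<lambda>k. {(?c (?u j), ?c (?w j)) | j. j < k \<and> ?c (?u j) \<noteq> ?c (?w j)}"
  let ?Inv = "\<lambda>k s'. listed_edges s' ''cond'' = ?es k \<and> nvar s' ''cond_size'' \<le> k"
  have es_Suc: "?es (Suc k) = (if ?c (?u k) = ?c (?w k) then ?es k else insert (?c (?u k), ?c (?w k)) (?es k))" for k
    by (auto simp: less_Suc_eq)
  have "wp scan_components s (\<lambda>t s'. ?Inv (nvar s ''F_size'') s' \<and> t \<le> 60 * nvar s ''F_size'' + 20)"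
    unfolding scan_components_def wp_Seq wp_NSet
  proof (rule wp_For[where l = 0 and h = "nvar s ''F_size''" and Inv = ?Inv and T = "\<lambda>k. 60 * k"],
      goal_cases)
    case 4 show ?case by (simp add: listed_edges_image)
  next
    case (5 k s') show ?case using frameD[OF 5(2)] by simp
  next
    case (6 k s')
    note fr = frameD[OF 6(4), simplified]
    show ?case
    proof (cases "?c (?u k) = ?c (?w k)")
      case True
      thus ?thesis using 6(3,5) by (simp add: fr es_Suc listed_edges_image)
    next
      case False
      thus ?thesis using 6(3,5) by (simp add: fr es_Suc listed_edges_image image_pair_update cong: if_cong)
    qed
  qed auto
  from wp_frame[OF this] show ?thesis
  proof (rule wp_mono, goal_cases)
    case (1 t s')
    have "?es (nvar s ''F_size'') = {(?c u, ?c w) | u w. (u, w) \<in> listed_edges s ''F'' \<and> ?c u \<noteq> ?c w}"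
      unfolding listed_edges_image by blast
    thus ?case using 1 by (intro Q) auto
  qed
qed

context adjacency
begin

lemma wp_init_search:
  assumes mem: "nvar s ''n'' = n" "narr s ''fstart'' = fs" "narr s ''F_head'' = hd"
    and fs: "fs 0 = 0" "\<And>v. v < n \<Longrightarrow> fs v \<le> fs (Suc v)"
    and Q: "\<And>t s'. search_inv s' \<Longrightarrow> search_pot s' = 5 * n + fs n \<Longrightarrow> frame init_search s s' \<Longrightarrow>
      t \<le> 20 * n + 30 \<Longrightarrow> Q t s'"
  shows "wp init_search s Q"
proof -
  let ?P = "\<lambda>s'. search_inv s' \<and> search_pot s' = 5 * n + fs n"
  have "wp init_search s (\<lambda>t s'. ?P s' \<and> t \<le> 20 * n + 30)"
    unfolding init_search_def wp_Seq
  proof (rule wp_For[where l = 0 and h = n and T = "\<lambda>k. 20 * k" and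
        Inv = "\<lambda>k s'. \<forall>v<k. narr s' ''idx'' v = 0 \<and> narr s' ''ptr'' v = fs v"], goal_cases)
    case (5 k s') show ?case using frameD[OF 5(2)] mem by simp
  next
    case (6 k s') thus ?case using frameD[OF 6(4)] mem by (simp add: less_Suc_eq)
  next
    case (7 t s')
    note fr = frameD[OF 7(3), simplified]
    have "path_inv (narr s' ''S'') 0 (narr s' ''B'') 0 (narr s' ''idx'') (narr s' ''ptr'') {}"
      using 7(1) fs(2) by (simp add: path_inv_def)
    moreover have "comps_inv {} (narr s' ''comp'') 0 ((narr s' ''cs'')(0 := 0)) (narr s' ''mem'') 0"
      by (simp add: comps_inv_def)
    ultimately have "conf (narr s' ''S'') 0 (narr s' ''B'') 0 (narr s' ''W'') 0 (narr s' ''idx'')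
        (narr s' ''ptr'') (narr s' ''comp'') 0 ((narr s' ''cs'')(0 := 0)) (narr s' ''mem'') 0 0"
      by (simp add: conf_def done_inv_def pending_inv_def)
    \<comment> \<open>The initial potential consists of \<open>n\<close> for the roots,
      \<open>4 * n\<close> for the pushes and \<open>fs n\<close> for the edges.\<close>
    moreover have "(\<Sum>v<n. fs (Suc v) - narr s' ''ptr'' v) = fs n"
      using 7(1) sum_telescope_nat[of n fs] fs by simp
    ultimately show ?case using 7(4) by (simp add: search_inv_def search_pot_def pot_def fr mem)
  qed auto
  from wp_frame[OF this] show ?thesis by (rule wp_mono) (auto intro: Q)
qed

lemma wp_search_loop:
  assumes heads: "\<And>v k. v < n \<Longrightarrow> k \<in> {fs v..<fs (Suc v)} \<Longrightarrow> hd k < n"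
    and inv: "search_inv s"
    and Q: "\<And>t s'. comps_inv {..<n} (narr s' ''comp'') (nvar s' ''comp_count'') (narr s' ''cs'')
        (narr s' ''mem'') n \<Longrightarrow> frame search_loop s s' \<Longrightarrow> t \<le> 100 * search_pot s + 11 \<Longrightarrow> Q t s'"
  shows "wp search_loop s Q"
  unfolding search_loop_def
proof (rule wp_While[where Inv = search_inv and \<Phi> = "\<lambda>s. 100 * search_pot s"], goal_cases)
  case (1 s')
  show ?case
  proof (cases "0 < nvar s' ''sp''")
    case False
    moreover from this have "nvar s' ''r'' < n" using 1 by (simp add: search_inv_def)
    ultimately show ?thesis using wp_next_root[OF 1(1)] by (auto elim!: wp_mono)
  next
    case sp: True
    show ?thesis
    proof (cases "0 < nvar s' ''wp'' \<and>
        narr s' ''B'' (nvar s' ''bp'' - 1) \<le> narr s' ''W'' (nvar s' ''wp'' - 1)")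
      case True
      hence "wp scan_edge s'
          (\<lambda>t s''. search_inv s'' \<and> t + 100 * search_pot s'' + 30 \<le> 100 * search_pot s')"
        using heads 1(1) sp by (intro wp_scan_edge) auto
      thus ?thesis using sp True
        by (auto simp: last_pending_def last_boundary_def elim!: wp_mono)
    next
      case False
      thus ?thesis using sp wp_pop_component[OF 1(1) sp]
        by (auto simp: last_pending_def last_boundary_def not_le elim!: wp_mono)
    qed
  qed
next
  case (3 t s')
  have sp: "nvar s' ''sp'' = 0" and r: "n \<le> nvar s' ''r''" using 3(1,2) by (auto simp: search_inv_def)
  let ?D = "narr s' ''mem'' ` {..<nvar s' ''dn''}"
  have C: "path_inv (narr s' ''S'') 0 (narr s' ''B'') (nvar s' ''bp'') (narr s' ''idx'') (narr s' ''ptr'') ?D"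
    "done_inv (narr s' ''idx'') ?D" "\<forall>v<nvar s' ''r''. narr s' ''idx'' v \<noteq> 0"
    and comps: "comps_inv ?D (narr s' ''comp'') (nvar s' ''comp_count'') (narr s' ''cs'')
      (narr s' ''mem'') (nvar s' ''dn'')"
    using 3(1) sp by (simp_all add: search_inv_def conf_def)
  have "?D \<subseteq> {..<n}" using C(2) by (simp add: done_inv_def)
  \<comment> \<open>All roots have been passed, so \<open>v\<close> is visited; with an empty stack
    a visited vertex is completed.\<close>
  moreover have "v \<in> ?D" if "v < n" for v
    using that C(1,3) r by (simp add: path_inv_def)
  ultimately have D: "?D = {..<n}" by blast
  have "card ?D = nvar s' ''dn''" using comps by (simp add: comps_inv_def card_image)
  hence dn: "nvar s' ''dn'' = n" unfolding D by simp
  show ?case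
    by (rule Q) (use comps D dn 3(3,4) in \<open>auto simp: search_loop_def\<close>)
qed (fact inv)

lemma wp_find_components:
  assumes heads: "\<And>v k. v < n \<Longrightarrow> k \<in> {fs v..<fs (Suc v)} \<Longrightarrow> hd k < n"
    and mem: "nvar s ''n'' = n" "narr s ''fstart'' = fs" "narr s ''F_head'' = hd" "nvar s ''F_size'' = fs n"
    and fs: "fs 0 = 0" "\<And>v. v < n \<Longrightarrow> fs v \<le> fs (Suc v)"
    and Q: "\<And>t s'. comps_inv {..<n} (narr s' ''comp'') (nvar s' ''comp_count'') (narr s' ''cs'')
        (narr s' ''mem'') n \<Longrightarrow>
      listed_edges s' ''cond'' = {(narr s' ''comp'' u, narr s' ''comp'' w) | u w.
        (u, w) \<in> listed_edges s ''F'' \<and> narr s' ''comp'' u \<noteq> narr s' ''comp'' w} \<Longrightarrow>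
      nvar s' ''cond_size'' \<le> fs n \<Longrightarrow>
      frame find_components s s' \<Longrightarrow> t \<le> 600 * (n + fs n) + 100 \<Longrightarrow> Q t s'"
  shows "wp find_components s Q"
proof -
  let ?post = "\<lambda>t s'. comps_inv {..<n} (narr s' ''comp'') (nvar s' ''comp_count'')
        (narr s' ''cs'') (narr s' ''mem'') n \<and>
      listed_edges s' ''cond'' = {(narr s' ''comp'' u, narr s' ''comp'' w) | u w.
        (u, w) \<in> listed_edges s ''F'' \<and> narr s' ''comp'' u \<noteq> narr s' ''comp'' w} \<and>
      nvar s' ''cond_size'' \<le> fs n \<and> t \<le> 600 * (n + fs n) + 100"
  have "wp find_components s ?post"
    unfolding find_components_def wp_Seq
  proof (rule wp_init_search[OF mem(1-3) fs])
    fix t1 s1 assume 1: "search_inv s1" "search_pot s1 = 5 * n + fs n" "frame init_search s s1"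
      "t1 \<le> 20 * n + 30"
    note fr1 = frameD[OF 1(3), unfolded init_search_def, simplified]
    show "wp search_loop s1 (\<lambda>t s'. wp scan_components s' (\<lambda>u. ?post (t1 + (t + u))))"
    proof (rule wp_search_loop[OF heads 1(1)])
      fix t2 s2 assume 2: "comps_inv {..<n} (narr s2 ''comp'') (nvar s2 ''comp_count'')
          (narr s2 ''cs'') (narr s2 ''mem'') n" "frame search_loop s1 s2" "t2 \<le> 100 * search_pot s1 + 11"
      note fr2 = frameD[OF 2(2), unfolded search_loop_def scan_edge_def pop_component_def pop_loop_def
          next_root_def push_vertex_def advance_def, simplified]
      show "wp scan_components s2 (\<lambda>u. ?post (t1 + (t2 + u)))"
      proof (rule wp_scan_components)
        fix t3 s3 assume 3: "listed_edges s3 ''cond'' =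
            {(narr s2 ''comp'' u, narr s2 ''comp'' w) | u w.
              (u, w) \<in> listed_edges s2 ''F'' \<and> narr s2 ''comp'' u \<noteq> narr s2 ''comp'' w}"
          "nvar s3 ''cond_size'' \<le> nvar s2 ''F_size''"
          "frame scan_components s2 s3" "t3 \<le> 60 * nvar s2 ''F_size'' + 20"
        note fr3 = frameD[OF 3(3), unfolded scan_components_def, simplified]
        have "listed_edges s2 ''F'' = listed_edges s ''F''"
          by (simp add: listed_edges_image fr2 fr1)
        thus "?post (t1 + (t2 + t3)) s3"
          using 1(2,4) 2(1,3) 3(1,2,4) by (simp add: fr3 fr2 fr1 mem(4))
      qed
    qed
  qed
  from wp_frame[OF this] show ?thesis by (rule wp_mono) (blast intro: Q)
qed

end

section \<open>Step 3: the topological ordering\<close>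

text \<open>A component is completed after all components that it reaches, so the components are numbered
  in reverse topological order.\<close>

definition order_components :: com where
  "order_components = For ''i'' (NConst 0) (NVar ''comp_count'')
    (NStore ''order'' (NVar ''i'') (NSub (NSub (NVar ''comp_count'') (NConst 1)) (NVar ''i'')))"

lemma wp_order_components:
  assumes Q: "\<And>t s'. (\<And>i. i < nvar s ''comp_count'' \<Longrightarrow>
        narr s' ''order'' i = nvar s ''comp_count'' - 1 - i) \<Longrightarrow>
      frame order_components s s' \<Longrightarrow> t \<le> 20 * nvar s ''comp_count'' + 10 \<Longrightarrow> Q t s'"
  shows "wp order_components s Q"
  unfolding order_components_def
proof (rule wp_For[where l = 0 and h = "nvar s ''comp_count''" and T = "\<lambda>k. 20 * k" and
      Inv = "\<lambda>k s'. \<forall>i<k. narr s' ''order'' i = nvar s ''comp_count'' - 1 - i"], goal_cases)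
  case (5 k s') show ?case using frameD[OF 5(2)] by simp
next
  case (6 k s') thus ?case using frameD[OF 6(4)] by (simp add: less_Suc_eq)
next
  case (7 t s') show ?case
    by (rule Q) (use 7 in \<open>auto simp: order_components_def\<close>)
qed auto

section \<open>Step 4: updating the dual solution\<close>

definition mark_heads :: com where
  "mark_heads =
    For ''c'' (NConst 0) (NVar ''comp_count'') (NStore ''hasin'' (NVar ''c'') (NConst 0)) ;;
    For ''k'' (NConst 0) (NVar ''cond_size'')
      (NStore ''hasin'' (NArr ''cond_head'' (NVar ''k'')) (NConst 1))"

text \<open>Whether a label belongs to the component is tested in constant time through its partner.
  The flag \<open>found\<close> stands in for an infinite initial minimum, as \<open>delta\<close>
  starts with an arbitrary or outdated value.\<close>

definition min_slack_vertex :: com where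
  "min_slack_vertex =
    For ''k'' (NArr ''first'' (NVar ''v'')) (NArr ''first'' (NAdd (NVar ''v'') (NConst 1)))
      (NSet ''l'' (NArr ''label'' (NVar ''k'')) ;;
       Cond (NEq (NArr ''comp'' (NArr ''xinv'' (NVar ''l''))) (NVar ''c'')) Skip
         (RSet ''slack'' (RSub (RSub (RArr ''cost'' (NVar ''k'')) (RArr ''alpha'' (NVar ''v'')))
            (RArr ''beta'' (NVar ''l''))) ;;
          Cond (Conj (NLess (NConst 0) (NVar ''found'')) (Neg (RLess (RVar ''slack'') (RVar ''delta'')))) Skip
            (RSet ''delta'' (RVar ''slack'') ;; NSet ''found'' (NConst 1))))"

definition min_slack_component :: com where
  "min_slack_component =
    For ''p'' (NArr ''cs'' (NVar ''c'')) (NArr ''cs'' (NAdd (NVar ''c'') (NConst 1)))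
      (NSet ''v'' (NArr ''mem'' (NVar ''p'')) ;; min_slack_vertex)"

definition shift_component :: com where
  "shift_component =
    For ''p'' (NArr ''cs'' (NVar ''c'')) (NArr ''cs'' (NAdd (NVar ''c'') (NConst 1)))
      (NSet ''v'' (NArr ''mem'' (NVar ''p'')) ;;
       RStore ''alpha'' (NVar ''v'')
         (RAdd (RArr ''alpha'' (NVar ''v'')) (RDiv (RVar ''delta'') (RConst 2))) ;;
       RStore ''beta'' (NArr ''x'' (NVar ''v''))
         (RSub (RArr ''beta'' (NArr ''x'' (NVar ''v''))) (RDiv (RVar ''delta'') (RConst 2))))"

definition update_component :: com where
  "update_component =
    NSet ''found'' (NConst 0) ;;
    min_slack_component ;;
    Cond (NEq (NVar ''found'') (NConst 0)) (RSet ''delta'' (RConst 1)) Skip ;;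
    shift_component"

text \<open>\<open>order\<close> is read from its end, since step 4 goes from the last component to
  the first.\<close>

definition update_components :: com where
  "update_components =
    mark_heads ;;
    For ''j'' (NConst 0) (NVar ''comp_count'')
      (NSet ''c'' (NArr ''order'' (NSub (NSub (NVar ''comp_count'') (NConst 1)) (NVar ''j''))) ;;
       Cond (NLess (NConst 0) (NArr ''hasin'' (NVar ''c''))) update_component Skip)"

section \<open>Effect and cost of the loops of step 4\<close>

lemma wp_mark_heads:
  assumes Q: "\<And>t s'. (\<And>c. c < nvar s ''comp_count'' \<Longrightarrow>
        0 < narr s' ''hasin'' c \<longleftrightarrow> (\<exists>b. (b, c) \<in> listed_edges s ''cond'')) \<Longrightarrow>
      frame mark_heads s s' \<Longrightarrow> t \<le> 20 * (nvar s ''comp_count'' + nvar s ''cond_size'') + 20 \<Longrightarrow> Q t s'"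
  shows "wp mark_heads s Q"
proof -
  let ?h = "narr s ''cond_head''" and ?m = "nvar s ''comp_count''"
  have "wp mark_heads s (\<lambda>t s'. (\<forall>c<?m. 0 < narr s' ''hasin'' c \<longleftrightarrow> c \<in> ?h ` {..<nvar s ''cond_size''}) \<and>
      t \<le> 20 * (?m + nvar s ''cond_size'') + 20)"
    unfolding mark_heads_def wp_Seq
  proof (rule wp_For[where l = 0 and h = ?m and T = "\<lambda>k. 20 * k" and
        Inv = "\<lambda>k s'. \<forall>c<k. narr s' ''hasin'' c = 0"], goal_cases)
    case (5 k s') show ?case using frameD[OF 5(2)] by simp
  next
    case (6 k s') thus ?case by (simp add: less_Suc_eq)
  next
    case (7 t1 s1)
    note fr1 = frameD[OF 7(3), simplified]
    show ?case
    proof (rule wp_For[where l = 0 and h = "nvar s ''cond_size''" and T = "\<lambda>k. 20 * k" and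
        Inv = "\<lambda>k s'. \<forall>c<?m. 0 < narr s' ''hasin'' c \<longleftrightarrow> c \<in> ?h ` {..<k}"], goal_cases)
      case 4 show ?case using 7(1) by simp
    next
      case (5 k s') show ?case using frameD[OF 5(2)] fr1 by simp
    next
      case (6 k s') thus ?case using frameD[OF 6(4)] by (simp add: fr1 lessThan_Suc)
    next
      case (7 t2 s2) thus ?case using \<open>t1 + _ \<le> _\<close> by simp
    qed auto
  qed auto
  from wp_frame[OF this] show ?thesis
  proof (rule wp_mono, goal_cases)
    case (1 t s')
    have "(\<exists>b. (b, c) \<in> listed_edges s ''cond'') \<longleftrightarrow> c \<in> ?h ` {..<nvar s ''cond_size''}" for c
      by (auto simp: listed_edges_image)
    thus ?case using 1 by (intro Q) auto
  qed
qed

definition entry_slacks :: "memory \<Rightarrow> nat \<Rightarrow> nat set \<Rightarrow> real set" where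
  "entry_slacks s v K = {rarr s ''cost'' k - rarr s ''alpha'' v - rarr s ''beta'' (narr s ''label'' k) | k.
    k \<in> K \<and> narr s ''comp'' (narr s ''xinv'' (narr s ''label'' k)) \<noteq> nvar s ''c''}"

lemma entry_slacks_empty [simp]: "entry_slacks s v {} = {}"
  by (simp add: entry_slacks_def)

lemma entry_slacks_insert:
  "entry_slacks s v (insert k K) =
    (if narr s ''comp'' (narr s ''xinv'' (narr s ''label'' k)) = nvar s ''c'' then entry_slacks s v K
     else insert (rarr s ''cost'' k - rarr s ''alpha'' v - rarr s ''beta'' (narr s ''label'' k))
       (entry_slacks s v K))"
  by (auto simp: entry_slacks_def)

lemma finite_entry_slacks [simp]: "finite K \<Longrightarrow> finite (entry_slacks s v K)"
  by (auto simp: entry_slacks_def)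

definition holds_min :: "memory \<Rightarrow> real set \<Rightarrow> bool" where
  "holds_min s T \<longleftrightarrow> (nvar s ''found'' = 0 \<longleftrightarrow> T = {}) \<and> (T \<noteq> {} \<longrightarrow> rvar s ''delta'' = Min T)"

lemma Min_insert_real:
  fixes T :: "real set"
  assumes "finite T" "T \<noteq> {}"
  shows "Min (insert a T) = (if a < Min T then a else Min T)"
proof -
  have "min a m = (if a < m then a else m)" for m by auto
  thus ?thesis using Min_insert[OF assms] by simp
qed

lemma wp_min_slack_vertex:
  assumes first: "narr s ''first'' (nvar s ''v'') \<le> narr s ''first'' (Suc (nvar s ''v''))"
    and min: "holds_min s T" "finite T"
    and Q: "\<And>t s'. holds_min s' (T \<union> entry_slacks s (nvar s ''v'')
        {narr s ''first'' (nvar s ''v'')..<narr s ''first'' (Suc (nvar s ''v''))}) \<Longrightarrow>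
      frame min_slack_vertex s s' \<Longrightarrow>
      t \<le> 60 * (narr s ''first'' (Suc (nvar s ''v'')) - narr s ''first'' (nvar s ''v'')) + 20 \<Longrightarrow> Q t s'"
  shows "wp min_slack_vertex s Q"
  unfolding min_slack_vertex_def
proof (rule wp_For[where l = "narr s ''first'' (nvar s ''v'')" and
      h = "narr s ''first'' (Suc (nvar s ''v''))" and
      T = "\<lambda>k. 60 * (k - narr s ''first'' (nvar s ''v''))" and
      Inv = "\<lambda>k s'. holds_min s' (T \<union> entry_slacks s (nvar s ''v'') {narr s ''first'' (nvar s ''v'')..<k})"],
    goal_cases)
  case (5 k s') show ?case using frameD[OF 5(2)] by simp
next
  case (6 k s')
  note fr = frameD[OF 6(4), simplified]
  let ?T = "T \<union> entry_slacks s (nvar s ''v'') {narr s ''first'' (nvar s ''v'')..<k}"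
  have iv: "{narr s ''first'' (nvar s ''v'')..<Suc k} = insert k {narr s ''first'' (nvar s ''v'')..<k}"
    using 6(1) by auto
  have fin: "finite ?T" using min(2) by simp
  show ?case
  proof (cases "narr s ''comp'' (narr s ''xinv'' (narr s ''label'' k)) = nvar s ''c''")
    case True
    thus ?thesis using 6(1,3,5) by (simp add: fr iv entry_slacks_insert Suc_diff_le holds_min_def)
  next
    case False
    thus ?thesis
      using 6(1,3,5) fin
      by (cases "?T = {}")
        (auto simp: fr iv entry_slacks_insert Suc_diff_le holds_min_def Min_insert_real simp del: Min_insert)
  qed
next
  case (7 t s') show ?case
    by (rule Q) (use 7 in \<open>auto simp: min_slack_vertex_def\<close>)
qed (use first min in \<open>auto simp: holds_min_def\<close>)

text \<open>Counts the list entries and vertices that belong to the first \<open>q\<close> places of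
  \<open>mem\<close>. A component costs a difference of two values, and these differences telescope
  over all components.\<close>

definition member_work :: "memory \<Rightarrow> nat \<Rightarrow> nat" where
  "member_work s q = (\<Sum>p<q. narr s ''first'' (Suc (narr s ''mem'' p)) - narr s ''first'' (narr s ''mem'' p)) + q"

lemma wp_min_slack_component:
  defines "K \<equiv> \<lambda>s p. {narr s ''first'' (narr s ''mem'' p)..<narr s ''first'' (Suc (narr s ''mem'' p))}"
  assumes cs: "narr s ''cs'' (nvar s ''c'') \<le> narr s ''cs'' (Suc (nvar s ''c''))"
    and first: "\<And>p. p < narr s ''cs'' (Suc (nvar s ''c'')) \<Longrightarrow>
      narr s ''first'' (narr s ''mem'' p) \<le> narr s ''first'' (Suc (narr s ''mem'' p))"
    and found: "nvar s ''found'' = 0"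
    and Q: "\<And>t s'. holds_min s' (\<Union>p\<in>{narr s ''cs'' (nvar s ''c'')..<narr s ''cs'' (Suc (nvar s ''c''))}.
        entry_slacks s (narr s ''mem'' p) (K s p)) \<Longrightarrow>
      frame min_slack_component s s' \<Longrightarrow>
      t + 60 * member_work s (narr s ''cs'' (nvar s ''c'')) \<le>
        60 * member_work s (narr s ''cs'' (Suc (nvar s ''c''))) + 20 \<Longrightarrow> Q t s'"
  shows "wp min_slack_component s Q"
  unfolding min_slack_component_def
proof (rule wp_For[where l = "narr s ''cs'' (nvar s ''c'')" and h = "narr s ''cs'' (Suc (nvar s ''c''))" and
      T = "\<lambda>p. 60 * member_work s p" and
      Inv = "\<lambda>q s'. holds_min s' (\<Union>p\<in>{narr s ''cs'' (nvar s ''c'')..<q}.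
        entry_slacks s (narr s ''mem'' p) (K s p))"], goal_cases)
  case 3 show ?case by (simp add: min_slack_vertex_def)
next
  case (5 k s') show ?case using frameD[OF 5(2)] by (simp add: min_slack_vertex_def)
next
  case (6 q s')
  note fr = frameD[OF 6(4), unfolded min_slack_vertex_def, simplified]
  have es: "entry_slacks (s'\<lparr>nvar := (nvar s')(''v'' := v)\<rparr>) = entry_slacks s" for v
    by (intro ext) (simp add: entry_slacks_def fr)
  have iv: "{narr s ''cs'' (nvar s ''c'')..<Suc q} = insert q {narr s ''cs'' (nvar s ''c'')..<q}"
    using 6(1) by auto
  show ?case
    unfolding wp_Seq wp_NSet
  proof (rule wp_min_slack_vertex[where T = "\<Union>p\<in>{narr s ''cs'' (nvar s ''c'')..<q}.
        entry_slacks s (narr s ''mem'' p) (K s p)"], goal_cases)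
    case 1 show ?case using first[OF 6(2)] by (simp add: fr 6(5))
  next
    case 2 show ?case using 6(3) by (simp add: holds_min_def)
  next
    case 3 show ?case by (auto simp: K_def)
  next
    case (4 t s'')
    note fr2 = frameD[OF 4(2), unfolded min_slack_vertex_def, simplified]
    show ?case using 4(1,3) by (simp add: es fr 6(5) iv K_def Un_commute holds_min_def member_work_def)
  qed
next
  case (7 t s') show ?case
    by (rule Q) (use 7 in \<open>auto simp: min_slack_component_def\<close>)
qed (use cs found in \<open>auto simp: holds_min_def\<close>)

text \<open>Injectivity of \<open>mem\<close> and \<open>x\<close> ensures that no entry of
  \<open>alpha\<close> or \<open>beta\<close> is shifted twice.\<close>

lemma wp_shift_component:
  defines "A \<equiv> \<lambda>s. narr s ''mem'' ` {narr s ''cs'' (nvar s ''c'')..<narr s ''cs'' (Suc (nvar s ''c''))}"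
  assumes cs: "narr s ''cs'' (nvar s ''c'') \<le> narr s ''cs'' (Suc (nvar s ''c''))"
    and inj: "inj_on (narr s ''mem'') {narr s ''cs'' (nvar s ''c'')..<narr s ''cs'' (Suc (nvar s ''c''))}"
      "inj_on (narr s ''x'') (A s)"
    and Q: "\<And>t s'. (\<And>v. rarr s' ''alpha'' v = rarr s ''alpha'' v + (if v \<in> A s then rvar s ''delta'' / 2 else 0)) \<Longrightarrow>
      (\<And>l. rarr s' ''beta'' l = rarr s ''beta'' l - (if l \<in> narr s ''x'' ` A s then rvar s ''delta'' / 2 else 0)) \<Longrightarrow>
      frame shift_component s s' \<Longrightarrow>
      t + 60 * member_work s (narr s ''cs'' (nvar s ''c'')) \<le>
        60 * member_work s (narr s ''cs'' (Suc (nvar s ''c''))) + 20 \<Longrightarrow> Q t s'"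
  shows "wp shift_component s Q"
  unfolding shift_component_def
proof (rule wp_For[where l = "narr s ''cs'' (nvar s ''c'')" and h = "narr s ''cs'' (Suc (nvar s ''c''))" and
      T = "\<lambda>p. 60 * member_work s p" and
      Inv = "\<lambda>q s'. rvar s' ''delta'' = rvar s ''delta'' \<and>
        (\<forall>v. rarr s' ''alpha'' v = rarr s ''alpha'' v +
          (if v \<in> narr s ''mem'' ` {narr s ''cs'' (nvar s ''c'')..<q} then rvar s ''delta'' / 2 else 0)) \<and>
        (\<forall>l. rarr s' ''beta'' l = rarr s ''beta'' l -
          (if l \<in> narr s ''x'' ` narr s ''mem'' ` {narr s ''cs'' (nvar s ''c'')..<q}
           then rvar s ''delta'' / 2 else 0))"], goal_cases)
  case (5 k s') show ?case using frameD[OF 5(2)] by simp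
next
  case (6 q s')
  note fr = frameD[OF 6(4), simplified]
  let ?I = "{narr s ''cs'' (nvar s ''c'')..<q}"
  have iv: "{narr s ''cs'' (nvar s ''c'')..<Suc q} = insert q ?I" using 6(1) by auto
  have new: "narr s ''mem'' q \<notin> narr s ''mem'' ` ?I"
    using inj(1) 6(1,2) unfolding inj_on_def by force
  have "narr s ''mem'' q \<in> A s" "narr s ''mem'' ` ?I \<subseteq> A s" using 6(1,2) by (auto simp: A_def)
  hence new': "narr s ''x'' (narr s ''mem'' q) \<notin> narr s ''x'' ` narr s ''mem'' ` ?I"
    using inj(2) new unfolding inj_on_def by blast
  show ?case using 6(3,5) new new' by (simp add: fr iv member_work_def cong: if_cong)
next
  case (7 t s') show ?case
    by (rule Q) (use 7 in \<open>simp_all add: A_def shift_component_def\<close>)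
qed (use cs in auto)

text \<open>Finds the range of a position in an array cut by offsets: the component of an entry of
  \<open>mem\<close>, or the tail of a listed edge.\<close>

lemma interval_cover:
  fixes f :: "nat \<Rightarrow> nat"
  assumes "f 0 \<le> p" "p < f m"
  shows "\<exists>c<m. f c \<le> p \<and> p < f (Suc c)"
  using assms(2)
proof (induction m)
  case 0
  thus ?case using assms(1) by simp
next
  case (Suc m)
  show ?case
  proof (cases "p < f m")
    case True
    thus ?thesis using Suc.IH by (auto intro: less_SucI)
  next
    case False
    thus ?thesis using Suc.prems by (auto simp: not_less)
  qed
qed

section \<open>Reading the components off the arrays\<close>

context adjacency
begin

lemma comps_mono:
  assumes "comps_inv {..<n} cmp m cs mem n" "c \<le> m"
  shows "cs c \<le> n"
  using assms(2)
proof (induction rule: inc_induct)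
  case base
  show ?case using assms(1) by (simp add: comps_inv_def)
next
  case (step c)
  have "cs c < cs (Suc c)" using assms(1) step by (simp add: comps_inv_def)
  thus ?case using step by simp
qed

text \<open>Every vertex occurs in \<open>mem\<close>, its position falls into some range, and all
  entries of a range carry the number of that range.\<close>

lemma comps_block:
  assumes comps: "comps_inv {..<n} cmp m cs mem n" and c: "c < m"
  shows "mem ` {cs c..<cs (Suc c)} = {v. v < n \<and> cmp v = c}"
proof -
  have img: "mem ` {..<n} = {..<n}" and cmp: "\<And>c p. c < m \<Longrightarrow> p \<in> {cs c..<cs (Suc c)} \<Longrightarrow> cmp (mem p) = c"
    and cs: "cs 0 = 0" "cs m = n"
    using comps by (auto simp: comps_inv_def)
  show ?thesis
  proof (intro set_eqI iffI)
    fix v assume "v \<in> mem ` {cs c..<cs (Suc c)}"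
    then obtain p where p: "p \<in> {cs c..<cs (Suc c)}" "v = mem p" by auto
    have "p < n" using comps_mono[OF comps, of "Suc c"] c p(1) by simp
    hence "v < n" using img p(2) by auto
    thus "v \<in> {v. v < n \<and> cmp v = c}" using cmp[OF c p(1)] p(2) by simp
  next
    fix v assume v: "v \<in> {v. v < n \<and> cmp v = c}"
    hence "v \<in> mem ` {..<n}" using img by simp
    then obtain p where p: "p < n" "v = mem p" by auto
    obtain b where b: "b < m" "cs b \<le> p" "p < cs (Suc b)"
      using interval_cover[of cs p m] cs p(1) by auto
    hence "b = c" using cmp[of b p] v p(2) by simp
    thus "v \<in> mem ` {cs c..<cs (Suc c)}" using b p(2) by auto
  qed
qed

text \<open>Offsets grow strictly because no component is empty. The overhead per component is
  therefore bounded by the number of vertices.\<close>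

lemma comps_count:
  assumes comps: "comps_inv {..<n} cmp m cs mem n"
  shows "m \<le> n"
proof -
  have "c \<le> cs c" if "c \<le> m" for c
    using that
  proof (induction c)
    case (Suc c)
    hence "cs c < cs (Suc c)" using comps by (simp add: comps_inv_def)
    thus ?case using Suc by simp
  qed simp
  thus ?thesis using comps by (force simp: comps_inv_def)
qed

lemma comps_scc_class:
  assumes comps: "comps_inv {..<n} cmp m cs mem n" and u: "u < n"
  shows "cmp u < m" "scc_class E u = {v. v < n \<and> cmp v = cmp u}" "(u, w) \<in> E \<Longrightarrow> cmp w \<le> cmp u"
  using comps u by (auto simp: comps_inv_def)

end

section \<open>The programs on an encoded instance\<close>

text \<open>Positions replace the lists of \<open>encodes_input\<close>, and \<open>xinv\<close> is
  included. The dual variables are kept apart in \<open>dual_mem\<close>, because step 4 changes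
  them.\<close>

definition input_mem :: "memory \<Rightarrow> (nat, nat) lap \<Rightarrow> (nat \<Rightarrow> nat) \<Rightarrow> bool" where
  "input_mem s I x \<longleftrightarrow>
    vertices I = {..<nvar s ''n''} \<and> labels I = {..<nvar s ''n''} \<and>
    bij_betw x {..<nvar s ''n''} {..<nvar s ''n''} \<and> narr s ''first'' 0 = 0 \<and>
    (\<forall>v<nvar s ''n''. narr s ''x'' v = x v \<and> narr s ''xinv'' (x v) = v \<and>
      narr s ''first'' v \<le> narr s ''first'' (Suc v) \<and>
      allowed I v = narr s ''label'' ` {narr s ''first'' v..<narr s ''first'' (Suc v)} \<and>
      allowed I v \<subseteq> {..<nvar s ''n''} \<and>
      (\<forall>k\<in>{narr s ''first'' v..<narr s ''first'' (Suc v)}.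
        rarr s ''cost'' k = cost I v (narr s ''label'' k)))"

definition dual_mem :: "memory \<Rightarrow> (nat, nat) lap \<Rightarrow> (nat, nat) dual \<Rightarrow> bool" where
  "dual_mem s I d \<longleftrightarrow> (\<forall>v\<in>vertices I. rarr s ''alpha'' v = fst d v) \<and>
    (\<forall>l\<in>labels I. rarr s ''beta'' l = snd d l)"

lemma input_mem_frame:
  assumes "frame c s s'" "''n'' \<notin> nvs c" "''cost'' \<notin> ras c"
    "''x'' \<notin> nas c" "''xinv'' \<notin> nas c" "''first'' \<notin> nas c" "''label'' \<notin> nas c"
  shows "input_mem s' I x \<longleftrightarrow> input_mem s I x"
  using assms(2-) by (simp add: input_mem_def frameD[OF assms(1)])

lemma dual_mem_frame:
  assumes "frame c s s'" "''alpha'' \<notin> ras c" "''beta'' \<notin> ras c"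
  shows "dual_mem s' I d \<longleftrightarrow> dual_mem s I d"
  using assms(2-) by (simp add: dual_mem_def frameD[OF assms(1)])

lemma input_mem_x:
  assumes "input_mem s I x" "v \<in> vertices I"
  shows "narr s ''x'' v = x v" "narr s ''xinv'' (x v) = v"
    "narr s ''first'' v \<le> narr s ''first'' (Suc v)"
  using assms by (simp_all add: input_mem_def)

lemma input_mem_allowed:
  assumes "input_mem s I x" "v \<in> vertices I"
  shows "allowed I v = narr s ''label'' ` {narr s ''first'' v..<narr s ''first'' (Suc v)}"
    "allowed I v \<subseteq> labels I"
proof -
  have "v < nvar s ''n''" "labels I = {..<nvar s ''n''}" using assms by (auto simp: input_mem_def)
  thus "allowed I v = narr s ''label'' ` {narr s ''first'' v..<narr s ''first'' (Suc v)}"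
    "allowed I v \<subseteq> labels I"
    using assms(1) unfolding input_mem_def by blast+
qed

lemma input_mem_entry:
  assumes "input_mem s I x" "v \<in> vertices I" "k \<in> {narr s ''first'' v..<narr s ''first'' (Suc v)}"
  shows "narr s ''label'' k \<in> allowed I v" "narr s ''label'' k \<in> labels I"
    "rarr s ''cost'' k = cost I v (narr s ''label'' k)"
proof -
  show l: "narr s ''label'' k \<in> allowed I v"
    unfolding input_mem_allowed(1)[OF assms(1,2)] using assms(3) by (rule imageI)
  thus "narr s ''label'' k \<in> labels I" using input_mem_allowed(2)[OF assms(1,2)] by blast
  have "v < nvar s ''n''" using assms by (auto simp: input_mem_def)
  thus "rarr s ''cost'' k = cost I v (narr s ''label'' k)"
    using assms(1,3) unfolding input_mem_def by blast
qed

lemma input_mem_update [simp]: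
  "''n'' \<noteq> y \<Longrightarrow> input_mem (s\<lparr>nvar := (nvar s)(y := a)\<rparr>) I x = input_mem s I x"
  by (simp add: input_mem_def)

lemma label_vertex:
  assumes "input_mem s I x" "v \<in> vertices I" "k \<in> {narr s ''first'' v..<narr s ''first'' (Suc v)}"
  defines "w \<equiv> narr s ''xinv'' (narr s ''label'' k)"
  shows "w \<in> vertices I" "narr s ''label'' k = x w"
proof -
  have "x ` vertices I = labels I"
    using assms(1) by (simp add: input_mem_def bij_betw_def)
  then obtain z where z: "z \<in> vertices I" "narr s ''label'' k = x z"
    using input_mem_entry(2)[OF assms(1-3)] by force
  hence "w = z" using input_mem_x(2)[OF assms(1)] by (simp add: w_def)
  thus "w \<in> vertices I" "narr s ''label'' k = x w" using z by simp_all
qed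

lemma tight_entries_eq_parcs:
  assumes inp: "input_mem s I x" and dual: "dual_mem s I d"
  shows "(\<Union>v<nvar s ''n''. tight_entries s v {narr s ''first'' v..<narr s ''first'' (Suc v)}) =
    parcs (input_graph I d x)"
proof -
  let ?R = "\<lambda>v. {narr s ''first'' v..<narr s ''first'' (Suc v)}"
  have V: "vertices I = {..<nvar s ''n''}" using inp by (simp add: input_mem_def)
  have entry: "tight_entry s v k \<longleftrightarrow> slack I d v (narr s ''label'' k) = 0 \<and>
      v \<noteq> narr s ''xinv'' (narr s ''label'' k)" if "v \<in> vertices I" "k \<in> ?R v" for v k
  proof -
    note input_mem_entry[OF inp that]
    thus ?thesis using that dual by (auto simp: tight_entry_def slack_def dual_mem_def)
  qed
  show ?thesis
  proof (intro set_eqI iffI)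
    fix e assume "e \<in> (\<Union>v<nvar s ''n''. tight_entries s v (?R v))"
    then obtain v k where vk: "v \<in> vertices I" "k \<in> ?R v" "tight_entry s v k"
      "e = (v, narr s ''xinv'' (narr s ''label'' k))"
      by (auto simp: tight_entries_def V)
    moreover have "narr s ''label'' k \<in> allowed I v" using input_mem_entry(1)[OF inp vk(1,2)] .
    ultimately show "e \<in> parcs (input_graph I d x)"
      using label_vertex[OF inp vk(1,2)] by (auto simp: parcs_input_graph entry)
  next
    fix e assume "e \<in> parcs (input_graph I d x)"
    then obtain v w where e: "e = (v, w)" "v \<in> vertices I" "w \<in> vertices I" "v \<noteq> w"
      "x w \<in> allowed I v" "slack I d v (x w) = 0"
      by (auto simp: parcs_input_graph)
    then obtain k where k: "k \<in> ?R v" "x w = narr s ''label'' k"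
      unfolding input_mem_allowed(1)[OF inp \<open>v \<in> vertices I\<close>] by blast
    have "narr s ''xinv'' (narr s ''label'' k) = w"
      using input_mem_x(2)[OF inp e(3)] k(2) by simp
    moreover from this have "tight_entry s v k" using e k by (simp add: entry)
    ultimately show "e \<in> (\<Union>v<nvar s ''n''. tight_entries s v (?R v))"
      using e(1,2) k(1) by (auto simp: tight_entries_def V)
  qed
qed

text \<open>As \<open>x\<close> is injective, a label belongs to the component iff its partner has
  component number \<open>c\<close>; the entries that pass the test of the program then give exactly
  the slacks minimized in \<open>step_delta\<close>.\<close>

lemma step_delta_entry_slacks:
  assumes inp: "input_mem s I x" and dual: "dual_mem s I e"
    and A: "narr s ''mem'' ` P = {v \<in> vertices I. narr s ''comp'' v = nvar s ''c''}"
  defines "T \<equiv> (\<Union>p\<in>P. entry_slacks s (narr s ''mem'' p)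
    {narr s ''first'' (narr s ''mem'' p)..<narr s ''first'' (Suc (narr s ''mem'' p))})"
  shows "step_delta I x (narr s ''mem'' ` P) e = (if T = {} then 1 else Min T)"
proof -
  let ?A = "narr s ''mem'' ` P" and ?R = "\<lambda>v. {narr s ''first'' v..<narr s ''first'' (Suc v)}"
  have AV: "v \<in> vertices I" if "v \<in> ?A" for v using that A by auto
  have "inj_on x (vertices I)" using inp by (simp add: input_mem_def bij_betw_def)
  hence xinj: "x w \<in> x ` ?A \<longleftrightarrow> w \<in> ?A" if "w \<in> vertices I" for w
    using that AV by (intro inj_on_image_mem_iff) auto
  have T: "T = (\<Union>v\<in>?A. entry_slacks s v (?R v))" by (simp add: T_def)
  have "(\<lambda>(v, l). slack I e v l) ` (SIGMA v:?A. allowed I v - x ` ?A) = T"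
  proof (intro set_eqI iffI)
    fix r assume "r \<in> (\<lambda>(v, l). slack I e v l) ` (SIGMA v:?A. allowed I v - x ` ?A)"
    then obtain v l where vl: "v \<in> ?A" "l \<in> allowed I v" "l \<notin> x ` ?A" "r = slack I e v l"
      by (elim imageE SigmaE) (simp only: prod.case Diff_iff, blast)
    have v: "v \<in> vertices I" using AV vl by blast
    obtain k where k: "k \<in> ?R v" "l = narr s ''label'' k"
      using vl(2) unfolding input_mem_allowed(1)[OF inp v] by blast
    let ?w = "narr s ''xinv'' (narr s ''label'' k)"
    have w: "?w \<in> vertices I" "narr s ''label'' k = x ?w" using label_vertex[OF inp v k(1)] by auto
    have "?w \<notin> ?A" using vl(3) k(2) w(2) xinj[OF w(1)] by metis
    hence "narr s ''comp'' ?w \<noteq> nvar s ''c''" using w(1) unfolding A by blast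
    moreover have "r = rarr s ''cost'' k - rarr s ''alpha'' v - rarr s ''beta'' (narr s ''label'' k)"
      using input_mem_entry[OF inp v k(1)] k(2) v vl(4) dual by (simp add: slack_def dual_mem_def)
    ultimately show "r \<in> T" using vl(1) k(1) unfolding T entry_slacks_def by blast
  next
    fix r assume "r \<in> T"
    then obtain v k where vk: "v \<in> ?A" "k \<in> ?R v"
      "r = rarr s ''cost'' k - rarr s ''alpha'' v - rarr s ''beta'' (narr s ''label'' k)"
      "narr s ''comp'' (narr s ''xinv'' (narr s ''label'' k)) \<noteq> nvar s ''c''"
      unfolding T entry_slacks_def by blast
    have v: "v \<in> vertices I" using AV vk by blast
    let ?w = "narr s ''xinv'' (narr s ''label'' k)"
    have w: "?w \<in> vertices I" "narr s ''label'' k = x ?w" using label_vertex[OF inp v vk(2)] by auto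
    have "?w \<notin> ?A" using vk(4) unfolding A by blast
    hence "narr s ''label'' k \<notin> x ` ?A" using w(2) xinj[OF w(1)] by metis
    moreover have "narr s ''label'' k \<in> allowed I v" using input_mem_entry(1)[OF inp v vk(2)] .
    moreover have "r = slack I e v (narr s ''label'' k)"
      using input_mem_entry[OF inp v vk(2)] v vk(3) dual by (simp add: slack_def dual_mem_def)
    ultimately show "r \<in> (\<lambda>(v, l). slack I e v l) ` (SIGMA v:?A. allowed I v - x ` ?A)"
      using vk(1) by (intro image_eqI[of _ _ "(v, narr s ''label'' k)"]) (simp_all add: image_iff)
  qed
  thus ?thesis by (simp add: step_delta_eq Let_def)
qed

lemma wp_update_component:
  defines "P \<equiv> \<lambda>s. {narr s ''cs'' (nvar s ''c'')..<narr s ''cs'' (Suc (nvar s ''c''))}"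
  assumes inp: "input_mem s I x" and dual: "dual_mem s I e"
    and cs: "narr s ''cs'' (nvar s ''c'') \<le> narr s ''cs'' (Suc (nvar s ''c''))"
    and inj: "inj_on (narr s ''mem'') (P s)"
    and mem: "\<And>p. p < narr s ''cs'' (Suc (nvar s ''c'')) \<Longrightarrow> narr s ''mem'' p \<in> vertices I"
    and A: "narr s ''mem'' ` P s = {v \<in> vertices I. narr s ''comp'' v = nvar s ''c''}"
    and ingoing: "\<exists>B. (B, narr s ''mem'' ` P s) \<in> parcs K"
    and Q: "\<And>t s'. dual_mem s' I (process_component I x K (narr s ''mem'' ` P s) e) \<Longrightarrow>
      frame update_component s s' \<Longrightarrow>
      t + 120 * member_work s (narr s ''cs'' (nvar s ''c'')) \<le>
        120 * member_work s (narr s ''cs'' (Suc (nvar s ''c''))) + 70 \<Longrightarrow> Q t s'"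
  shows "wp update_component s Q"
proof -
  let ?A = "narr s ''mem'' ` P s"
  let ?R = "\<lambda>v. {narr s ''first'' v..<narr s ''first'' (Suc v)}"
  let ?T = "\<Union>p\<in>P s. entry_slacks s (narr s ''mem'' p) (?R (narr s ''mem'' p))"
  have V: "vertices I = {..<nvar s ''n''}" "labels I = {..<nvar s ''n''}"
    using inp by (simp_all add: input_mem_def)
  have "inj_on x (vertices I)" using inp by (simp add: input_mem_def bij_betw_def)
  hence "inj_on x ?A" by (rule inj_on_subset) (use A in auto)
  moreover have xA: "narr s ''x'' v = x v" if "v \<in> ?A" for v
    using that A input_mem_x(1)[OF inp] by auto
  ultimately have injx: "inj_on (narr s ''x'') ?A" by (simp add: inj_on_def)
  have ximg: "narr s ''x'' ` ?A = x ` ?A" using xA by (rule image_cong[OF refl])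
  have "wp update_component s (\<lambda>t s'. dual_mem s' I (process_component I x K ?A e) \<and>
      t + 120 * member_work s (narr s ''cs'' (nvar s ''c'')) \<le>
        120 * member_work s (narr s ''cs'' (Suc (nvar s ''c''))) + 70)"
    unfolding update_component_def wp_Seq wp_NSet
  proof (rule wp_min_slack_component, goal_cases)
    case 1 show ?case using cs by simp
  next
    case (2 p) thus ?case using mem input_mem_x(3)[OF inp] by simp
  next
    case 3 show ?case by simp
  next
    case (4 t s1)
    note fr1 = frameD[OF 4(2), unfolded min_slack_component_def min_slack_vertex_def, simplified]
    have es: "entry_slacks (s\<lparr>nvar := (nvar s)(''found'' := a)\<rparr>) = entry_slacks s" for a
      by (intro ext) (simp add: entry_slacks_def)
    have mw: "member_work (s\<lparr>nvar := (nvar s)(''found'' := a)\<rparr>) = member_work s" for a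
      by (intro ext) (simp add: member_work_def)
    have min: "holds_min s1 ?T" using 4(1) by (simp add: es P_def)
    \<comment> \<open>The memory after the default branch, whichever way it went, so that the shift
      is treated once.\<close>
    define s2 where "s2 = (if nvar s1 ''found'' = 0 then s1\<lparr>rvar := (rvar s1)(''delta'' := 1)\<rparr> else s1)"
    have delta: "rvar s2 ''delta'' = step_delta I x ?A e"
      using min step_delta_entry_slacks[OF inp dual A] by (simp add: s2_def holds_min_def)
    have s2: "nvar s2 = nvar s1" "narr s2 = narr s1" "rarr s2 = rarr s1" by (simp_all add: s2_def)
    have mw2: "member_work s2 = member_work s" by (intro ext) (simp add: member_work_def s2 fr1)
    have main: "wp shift_component s2 (\<lambda>u s'. dual_mem s' I (process_component I x K ?A e) \<and>
        u + 60 * member_work s (narr s ''cs'' (nvar s ''c'')) \<le>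
          60 * member_work s (narr s ''cs'' (Suc (nvar s ''c''))) + 20)"
    proof (rule wp_shift_component, goal_cases)
      case 1 show ?case using cs by (simp add: s2 fr1)
    next
      case 2 show ?case using inj by (simp add: s2 fr1 P_def)
    next
      case 3 show ?case using injx by (simp add: s2 fr1 P_def)
    next
      case (4 u s3)
      show ?case
        using 4(1,2,4) dual ingoing ximg
        by (simp add: dual_mem_def process_component_eq delta s2 fr1 P_def mw2)
    qed
    show ?case
      using main 4(3) by (cases "nvar s1 ''found'' = 0") (auto simp: s2_def mw elim!: wp_mono)
  qed
  from wp_frame[OF this] show ?thesis by (rule wp_mono) (auto intro: Q)
qed

lemma member_work_mono: "a \<le> b \<Longrightarrow> member_work s a \<le> member_work s b"
  by (auto simp: member_work_def intro!: add_mono sum_mono2)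

text \<open>\<open>mem\<close> permutes the vertices, so the list lengths can be summed in the order
  of the offsets, where they telescope.\<close>

lemma member_work_all:
  assumes inp: "input_mem s I x" and bij: "bij_betw (narr s ''mem'') {..<nvar s ''n''} {..<nvar s ''n''}"
  shows "member_work s (nvar s ''n'') = narr s ''first'' (nvar s ''n'') + nvar s ''n''"
proof -
  let ?f = "narr s ''first''"
  have "(\<Sum>p<nvar s ''n''. ?f (Suc (narr s ''mem'' p)) - ?f (narr s ''mem'' p)) =
      (\<Sum>v<nvar s ''n''. ?f (Suc v) - ?f v)"
    by (rule sum.reindex_bij_betw[OF bij])
  also have "\<dots> = ?f (nvar s ''n'')"
    using sum_telescope_nat[of "nvar s ''n''" ?f] inp by (simp add: input_mem_def)
  finally show ?thesis by (simp add: member_work_def)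
qed

lemma wp_update_components:
  fixes n fs hd
  assumes inp: "input_mem s I x" and dual: "dual_mem s I d" and n: "nvar s ''n'' = n"
    and comps: "adjacency.comps_inv n fs hd {..<n} (narr s ''comp'') m (narr s ''cs'') (narr s ''mem'') n"
    and m: "nvar s ''comp_count'' = m"
    and order: "\<And>i. i < m \<Longrightarrow> narr s ''order'' i = m - 1 - i"
    and V: "V = (\<lambda>c. {v \<in> vertices I. narr s ''comp'' v = c})"
    and ingoing: "\<And>c. c < m \<Longrightarrow> (\<exists>B. (B, V c) \<in> parcs K) \<longleftrightarrow> (\<exists>b. (b, c) \<in> listed_edges s ''cond'')"
    and Q: "\<And>t s'. dual_mem s' I (fold (process_component I x K) (map V [0..<m]) d) \<Longrightarrow>
      t \<le> 20 * nvar s ''cond_size'' + 500 * (narr s ''first'' n + n) + 100 \<Longrightarrow> Q t s'"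
  shows "wp update_components s Q"
proof -
  interpret adjacency n fs hd .
  have VI: "vertices I = {..<n}" using inp n by (simp add: input_mem_def)
  have cs_lt: "narr s ''cs'' c < narr s ''cs'' (Suc c)" if "c < m" for c
    using comps that by (simp add: comps_inv_def)
  have img: "narr s ''mem'' ` {..<n} = {..<n}" and inj: "inj_on (narr s ''mem'') {..<n}"
    using comps by (auto simp: comps_inv_def)
  have block: "narr s ''mem'' ` {narr s ''cs'' c..<narr s ''cs'' (Suc c)} = V c" if "c < m" for c
    using comps_block[OF comps that] by (auto simp: V VI)
  let ?d = "\<lambda>j. fold (process_component I x K) (map V [0..<j]) d"
  \<comment> \<open>Per unit of work, 60 units each for the minimum and the shift; 150 per component
    for the rest, whether it is updated or not.\<close>
  let ?T = "\<lambda>j. 120 * member_work s (narr s ''cs'' j) + 150 * j"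
  have mw: "member_work s n = narr s ''first'' n + n"
    using member_work_all[OF inp] inj img n by (simp add: bij_betw_def)
  show ?thesis
    unfolding update_components_def wp_Seq
  proof (rule wp_mark_heads, goal_cases)
    case (1 t1 s1)
    note fr1 = frameD[OF 1(2), unfolded mark_heads_def, simplified]
    have inp1: "input_mem s1 I x"
      using inp input_mem_frame[OF 1(2)] by (simp add: mark_heads_def)
    have dual1: "dual_mem s1 I d"
      using dual dual_mem_frame[OF 1(2)] by (simp add: mark_heads_def)
    show ?case
    proof (rule wp_For[where l = 0 and h = m and T = ?T and Inv = "\<lambda>j s'. dual_mem s' I (?d j)"],
        goal_cases)
      case 3 show ?case
        by (simp add: update_component_def min_slack_component_def min_slack_vertex_def shift_component_def)
    next
      case 4 show ?case using dual1 by (simp add: dual_mem_def)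
    next
      case (5 j s') show ?case
        using frameD[OF 5(2)] fr1 m
        by (simp add: update_component_def min_slack_component_def min_slack_vertex_def shift_component_def)
    next
      case (6 j s')
      note unf = update_component_def min_slack_component_def min_slack_vertex_def shift_component_def
      note fr = frameD[OF 6(4), unfolded unf, simplified]
      have inp': "input_mem s' I x"
        using inp1 input_mem_frame[OF 6(4)] by (simp add: unf)
      \<comment> \<open>Reading the reversed order from its end gives the components by increasing
        number.\<close>
      have c: "narr s ''order'' (m - Suc j) = j" using order[of "m - Suc j"] 6(2) by simp
      have d_Suc: "?d (Suc j) = process_component I x K (V j) (?d j)" by simp
      have has: "0 < narr s1 ''hasin'' j \<longleftrightarrow> (\<exists>B. (B, V j) \<in> parcs K)"
        using 1(1) ingoing[OF 6(2)] 6(2) m by simp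
      have mono: "member_work s (narr s ''cs'' j) \<le> member_work s (narr s ''cs'' (Suc j))"
        using cs_lt[OF 6(2)] by (intro member_work_mono) simp
      let ?s = "s'\<lparr>nvar := (nvar s')(''c'' := j)\<rparr>"
      have arr: "nvar ?s ''c'' = j" "narr ?s ''cs'' = narr s ''cs''" "narr ?s ''mem'' = narr s ''mem''"
        "narr ?s ''comp'' = narr s ''comp''" "narr ?s ''first'' = narr s ''first''"
        by (simp_all add: fr fr1)
      have mw': "member_work ?s = member_work s" by (intro ext) (simp add: member_work_def fr fr1)
      have upd: "wp update_component ?s (\<lambda>t s''. dual_mem s'' I (?d (Suc j)) \<and>
          t + 120 * member_work s (narr s ''cs'' j) \<le> 120 * member_work s (narr s ''cs'' (Suc j)) + 70)"
        if "\<exists>B. (B, V j) \<in> parcs K"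
      proof (rule wp_update_component[where e = "?d j" and K = K and x = x and I = I], goal_cases)
        case 1 show ?case using inp' by simp
      next
        case 2 show ?case using 6(3) by (simp add: dual_mem_def)
      next
        case 3 show ?case using cs_lt[OF 6(2)] unfolding arr by simp
      next
        case 4
        have "{narr s ''cs'' j..<narr s ''cs'' (Suc j)} \<subseteq> {..<n}"
          using comps_mono[OF comps, of "Suc j"] 6(2) by auto
        thus ?case using inj unfolding arr by (rule inj_on_subset[rotated])
      next
        case (5 p)
        hence "p < n" using comps_mono[OF comps, of "Suc j"] 6(2) unfolding arr by simp
        thus ?case using img unfolding arr VI by blast
      next
        case 6 show ?case using block[OF \<open>j < m\<close>] unfolding arr V .
      next
        case 7 show ?case using that block[OF \<open>j < m\<close>] unfolding arr by simp
      next
        case (8 t s'') thus ?case using block[OF \<open>j < m\<close>] unfolding arr mw' d_Suc by simp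
      qed
      show ?case
      proof (cases "\<exists>B. (B, V j) \<in> parcs K")
        case True
        hence "0 < narr s1 ''hasin'' j" using has by simp
        thus ?thesis using wp_mono[OF upd[OF True]] 6(5) c
          by (auto simp: fr fr1 m dual_mem_def elim!: wp_mono)
      next
        case False
        hence "narr s1 ''hasin'' j = 0" using has by simp
        moreover have "?d (Suc j) = ?d j" using False by (simp add: d_Suc process_component_eq)
        ultimately show ?thesis using 6(3,5) c mono
          by (simp add: fr fr1 m dual_mem_def del: upt_Suc)
      qed
    next
      case (7 t s')
      have "m \<le> n" by (rule comps_count[OF comps])
      moreover have "narr s ''cs'' m = n" using comps by (simp add: comps_inv_def)
      ultimately show ?case using 7(1,4) 1(3) m mw by (intro Q) auto
    qed auto
  qed
qed

section \<open>The four programs together\<close>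

definition build_graph :: com where
  "build_graph = invert_assignment ;; scan_edges"

lemma encodes_input_frame:
  assumes "frame c s s'" "''n'' \<notin> nvs c" "{''first'', ''label'', ''x''} \<inter> nas c = {}"
    "{''cost'', ''alpha'', ''beta''} \<inter> ras c = {}"
  shows "encodes_input s' I Ls d x \<longleftrightarrow> encodes_input s I Ls d x"
  using assms(2-) by (simp add: encodes_input_def frameD[OF assms(1)])

lemma encodes_input_mem:
  assumes inst: "lap_instance I" and ax: "assignment I x" and enc: "encodes_input s I Ls d x"
    and xinv: "\<And>v. v < nvar s ''n'' \<Longrightarrow> narr s ''xinv'' (x v) = v"
  shows "input_mem s I x" "dual_mem s I d"
proof -
  let ?n = "nvar s ''n''"
  let ?R = "\<lambda>v. {narr s ''first'' v..<narr s ''first'' (Suc v)}"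
  have VL: "vertices I = {..<?n}" "labels I = {..<?n}" using enc by (simp_all add: encodes_input_def)
  have first: "narr s ''first'' v = (\<Sum>u<v. length (Ls u))" if "v \<le> ?n" for v
    using enc that by (simp add: encodes_input_def)
  have entries: "narr s ''label'' (narr s ''first'' v + k) = Ls v ! k"
    "rarr s ''cost'' (narr s ''first'' v + k) = cost I v (Ls v ! k)"
    if "v < ?n" "k < length (Ls v)" for v k
  proof -
    have "\<forall>v\<in>vertices I. \<forall>k<length (Ls v).
        narr s ''label'' (narr s ''first'' v + k) = Ls v ! k \<and>
        rarr s ''cost'' (narr s ''first'' v + k) = cost I v (Ls v ! k)"
      using enc unfolding encodes_input_def by blast
    thus "narr s ''label'' (narr s ''first'' v + k) = Ls v ! k"
      "rarr s ''cost'' (narr s ''first'' v + k) = cost I v (Ls v ! k)"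
      using that VL by simp_all
  qed
  have Ls: "set (Ls v) = allowed I v" if "v < ?n" for v
    using enc that VL by (simp add: encodes_input_def)
  have Suc: "narr s ''first'' (Suc v) = narr s ''first'' v + length (Ls v)" if "v < ?n" for v
    using first[of v] first[of "Suc v"] that by simp
  have offset: "\<exists>i<length (Ls v). k = narr s ''first'' v + i" if "v < ?n" "k \<in> ?R v" for v k
    using that Suc[OF that(1)] by (intro exI[of _ "k - narr s ''first'' v"]) auto
  have lab: "allowed I v = narr s ''label'' ` ?R v" if v: "v < ?n" for v
    unfolding Ls[OF v, symmetric]
  proof (intro set_eqI iffI)
    fix l assume "l \<in> set (Ls v)"
    then obtain k where "k < length (Ls v)" "l = Ls v ! k" by (auto simp: in_set_conv_nth)
    thus "l \<in> narr s ''label'' ` ?R v"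
      using entries[OF v] Suc[OF v] by (intro image_eqI[of _ _ "narr s ''first'' v + k"]) auto
  next
    fix l assume "l \<in> narr s ''label'' ` ?R v"
    then obtain k where k: "k \<in> ?R v" "l = narr s ''label'' k" by auto
    obtain i where "i < length (Ls v)" "k = narr s ''first'' v + i" using offset[OF v k(1)] by auto
    thus "l \<in> set (Ls v)" using entries(1)[OF v] k(2) by simp
  qed
  have cst: "rarr s ''cost'' k = cost I v (narr s ''label'' k)" if "v < ?n" "k \<in> ?R v" for v k
    using offset[OF that] entries[OF that(1)] by auto
  have sub: "allowed I v \<subseteq> {..<?n}" if "v < ?n" for v
    using inst that unfolding lap_instance_def VL by blast
  have bij: "bij_betw x {..<?n} {..<?n}" using ax by (simp add: assignment_def VL)
  have first0: "narr s ''first'' 0 = 0" using first[of 0] by simp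
  have x: "narr s ''x'' v = x v" if "v < ?n" for v using enc that VL by (simp add: encodes_input_def)
  have all: "\<forall>v<?n. narr s ''x'' v = x v \<and> narr s ''xinv'' (x v) = v \<and>
      narr s ''first'' v \<le> narr s ''first'' (Suc v) \<and> allowed I v = narr s ''label'' ` ?R v \<and>
      allowed I v \<subseteq> {..<?n} \<and> (\<forall>k\<in>?R v. rarr s ''cost'' k = cost I v (narr s ''label'' k))"
    using x xinv Suc lab sub cst by (intro allI impI conjI ballI) (simp_all only: le_add1)
  show "input_mem s I x" unfolding input_mem_def using VL bij first0 all by blast
  show "dual_mem s I d" using enc by (simp add: dual_mem_def encodes_input_def)
qed

text \<open>Every list contains the label \<open>x v\<close>, so there are at least as many entries
  as vertices, and terms linear in \<open>n\<close> are absorbed.\<close>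

lemma encodes_input_size:
  assumes ax: "assignment I x" and enc: "encodes_input s I Ls d x"
  shows "(\<Sum>v\<in>vertices I. card (allowed I v)) = narr s ''first'' (nvar s ''n'')"
    and "nvar s ''n'' \<le> narr s ''first'' (nvar s ''n'')"
proof -
  let ?n = "nvar s ''n''"
  have V: "vertices I = {..<?n}" using enc by (simp add: encodes_input_def)
  have len: "card (allowed I v) = length (Ls v)" if "v < ?n" for v
    using enc that V distinct_card[of "Ls v"] by (simp add: encodes_input_def)
  have first: "narr s ''first'' ?n = (\<Sum>u<?n. length (Ls u))" using enc by (simp add: encodes_input_def)
  thus "(\<Sum>v\<in>vertices I. card (allowed I v)) = narr s ''first'' ?n" using len by (simp add: V)
  have "1 \<le> length (Ls v)" if "v < ?n" for v
  proof -
    have "x v \<in> set (Ls v)" using enc ax that V by (simp add: encodes_input_def assignment_def)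
    thus ?thesis by (cases "Ls v") auto
  qed
  hence "(\<Sum>v<?n. 1) \<le> (\<Sum>u<?n. length (Ls u))" by (intro sum_mono) simp
  thus "?n \<le> narr s ''first'' ?n" by (simp add: first)
qed

lemma wp_build_graph:
  assumes inst: "lap_instance I" and ax: "assignment I x" and enc: "encodes_input s I Ls d x"
  defines "n \<equiv> nvar s ''n''"
  shows "wp build_graph s (\<lambda>t s'. nvar s' ''n'' = n \<and> narr s' ''first'' = narr s ''first'' \<and>
    input_mem s' I x \<and> dual_mem s' I d \<and> grouped_edges s' n \<and>
    nvar s' ''F_size'' \<le> narr s ''first'' n \<and> listed_edges s' ''F'' = parcs (input_graph I d x) \<and>
    t \<le> 70 * (narr s ''first'' n + n) + 12 * n + 26)" (is "wp build_graph s ?post")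
proof -
  have V: "vertices I = {..<n}" using enc by (simp add: encodes_input_def n_def)
  have x: "narr s ''x'' v = x v" if "v < n" for v using enc that V by (simp add: encodes_input_def)
  have "inj_on x {..<n}" using ax by (simp add: assignment_def bij_betw_def V)
  hence inj: "inj_on (narr s ''x'') {..<n}" using x by (simp add: inj_on_def)
  show ?thesis
    unfolding build_graph_def wp_Seq
  proof (rule wp_invert_assignment)
    show "inj_on (narr s ''x'') {..<nvar s ''n''}" using inj by (simp add: n_def)
  next
    fix t1 s1 assume 1: "\<forall>v<nvar s ''n''. narr s1 ''xinv'' (narr s ''x'' v) = v"
      "frame invert_assignment s s1" "t1 \<le> 12 * nvar s ''n'' + 6"
    note fr1 = frameD[OF 1(2), unfolded invert_assignment_def, simplified]
    have enc1: "encodes_input s1 I Ls d x"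
      using enc encodes_input_frame[OF 1(2)] by (simp add: invert_assignment_def)
    have mem1: "input_mem s1 I x" "dual_mem s1 I d"
      by (rule encodes_input_mem[OF inst ax enc1]; use 1(1) x in \<open>simp add: fr1 n_def\<close>)+
    show "wp scan_edges s1 (\<lambda>u. ?post (t1 + u))"
    proof (rule wp_scan_edges)
      show "narr s1 ''first'' 0 = 0" using mem1 by (simp add: input_mem_def)
      show "narr s1 ''first'' v \<le> narr s1 ''first'' (Suc v)" if "v < nvar s1 ''n''" for v
        using mem1 that by (simp add: input_mem_def)
    next
      fix t2 s2 assume 2: "grouped_edges s2 (nvar s1 ''n'')"
        "nvar s2 ''F_size'' \<le> narr s1 ''first'' (nvar s1 ''n'')"
        "listed_edges s2 ''F'' = (\<Union>v<nvar s1 ''n''.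
          tight_entries s1 v {narr s1 ''first'' v..<narr s1 ''first'' (Suc v)})"
        "frame scan_edges s1 s2" "t2 \<le> 70 * (narr s1 ''first'' (nvar s1 ''n'') + nvar s1 ''n'') + 20"
      note fr2 = frameD[OF 2(4), unfolded scan_edges_def scan_vertex_def, simplified]
      have "input_mem s2 I x" "dual_mem s2 I d"
        using mem1 input_mem_frame[OF 2(4)] dual_mem_frame[OF 2(4)]
        by (simp_all add: scan_edges_def scan_vertex_def)
      moreover have "listed_edges s2 ''F'' = parcs (input_graph I d x)"
        using 2(3) tight_entries_eq_parcs[OF mem1] by simp
      ultimately show "?post (t1 + t2) s2"
        using 1(3) 2(1,2,5) by (simp add: fr1 fr2 n_def)
    qed
  qed
qed

lemma grouped_edges_E:
  assumes grp: "grouped_edges s n"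
  shows "adjacency.E n (narr s ''fstart'') (narr s ''F_head'') = listed_edges s ''F''"
proof -
  let ?fs = "narr s ''fstart''"
  have fs: "?fs 0 = 0" "nvar s ''F_size'' = ?fs n" using grp by (auto simp: grouped_edges_def)
  have tail: "narr s ''F_tail'' k = v" "k < ?fs n" if "v < n" "k \<in> {?fs v..<?fs (Suc v)}" for v k
    using grp that fs unfolding grouped_edges_def by fastforce+
  show ?thesis
  proof (intro set_eqI iffI)
    fix e assume "e \<in> adjacency.E n ?fs (narr s ''F_head'')"
    then obtain v k where "v < n" "k \<in> {?fs v..<?fs (Suc v)}" "e = (v, narr s ''F_head'' k)"
      by (auto simp: adjacency.E_def)
    thus "e \<in> listed_edges s ''F''" using tail[of v k] fs(2) by (auto simp: listed_edges_image)
  next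
    fix e assume "e \<in> listed_edges s ''F''"
    then obtain k where k: "k < ?fs n" "e = (narr s ''F_tail'' k, narr s ''F_head'' k)"
      using fs(2) by (auto simp: listed_edges_image)
    obtain v where "v < n" "k \<in> {?fs v..<?fs (Suc v)}"
      using interval_cover[of ?fs k n] fs(1) k(1) by auto
    thus "e \<in> adjacency.E n ?fs (narr s ''F_head'')"
      using tail(1)[of v k] k(2) unfolding adjacency.E_def by blast
  qed
qed

lemma program_correct:
  assumes inst: "lap_instance I" and ax: "assignment I x" and enc: "encodes_input s I Ls d x"
  shows "\<exists>t. runs_algorithm_A build_graph find_components order_components update_components s I d x t \<and>
    t \<le> 3000 * max 1 (\<Sum>v\<in>vertices I. card (allowed I v))"
proof -
  define n where "n = nvar s ''n''"
  let ?G = "input_graph I d x"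
  let ?K = "condensation ?G"
  have V: "vertices I = {..<n}" using enc by (simp add: encodes_input_def n_def)
  obtain t1 s1 where s1: "exec build_graph s t1 s1" "nvar s1 ''n'' = n" "narr s1 ''first'' = narr s ''first''"
    "input_mem s1 I x" "dual_mem s1 I d" "grouped_edges s1 n"
    "nvar s1 ''F_size'' \<le> narr s ''first'' n" "listed_edges s1 ''F'' = parcs ?G"
    "t1 \<le> 70 * (narr s ''first'' n + n) + 12 * n + 26"
    using wp_build_graph[OF inst ax enc] unfolding wp_def n_def by blast
  define fs where "fs = narr s1 ''fstart''"
  define hd where "hd = narr s1 ''F_head''"
  interpret adjacency n fs hd .
  have E: "E = parcs ?G" using grouped_edges_E[OF s1(6)] s1(8) by (simp add: fs_def hd_def)
  have fs: "fs 0 = 0" "nvar s1 ''F_size'' = fs n" "\<And>v. v < n \<Longrightarrow> fs v \<le> fs (Suc v)"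
    using s1(6) by (auto simp: grouped_edges_def fs_def)
  have heads: "hd k < n" if "v < n" "k \<in> {fs v..<fs (Suc v)}" for v k
  proof -
    have "(v, hd k) \<in> E" unfolding E_def using that by blast
    thus ?thesis using parcs_input_graph_subset[of I d x] unfolding E V by auto
  qed
  have "wp find_components s1 (\<lambda>t s'. comps_inv {..<n} (narr s' ''comp'') (nvar s' ''comp_count'')
      (narr s' ''cs'') (narr s' ''mem'') n \<and>
    listed_edges s' ''cond'' = {(narr s' ''comp'' u, narr s' ''comp'' w) | u w.
      (u, w) \<in> listed_edges s1 ''F'' \<and> narr s' ''comp'' u \<noteq> narr s' ''comp'' w} \<and>
    nvar s' ''cond_size'' \<le> fs n \<and> frame find_components s1 s' \<and> t \<le> 600 * (n + fs n) + 100)"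
    by (rule wp_find_components[OF heads s1(2) _ _ _ fs(1,3)]) (use fs(2) in \<open>auto simp: fs_def hd_def\<close>)
  then obtain t2 s2 where s2: "exec find_components s1 t2 s2"
    "comps_inv {..<n} (narr s2 ''comp'') (nvar s2 ''comp_count'') (narr s2 ''cs'') (narr s2 ''mem'') n"
    "listed_edges s2 ''cond'' = {(narr s2 ''comp'' u, narr s2 ''comp'' w) | u w.
      (u, w) \<in> E \<and> narr s2 ''comp'' u \<noteq> narr s2 ''comp'' w}"
    "nvar s2 ''cond_size'' \<le> fs n" "frame find_components s1 s2" "t2 \<le> 600 * (n + fs n) + 100"
    unfolding wp_def E s1(8) by blast
  note unf2 = find_components_def init_search_def search_loop_def scan_edge_def pop_component_def
    pop_loop_def next_root_def push_vertex_def advance_def scan_components_def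
  note fr2 = frameD[OF s2(5), unfolded unf2, simplified]
  define m where "m = nvar s2 ''comp_count''"
  let ?c = "narr s2 ''comp''"
  define C where "C = component_of_index s2 I"
  have C: "C c = {v. v < n \<and> ?c v = c}" for c by (auto simp: C_def component_of_index_def V)
  note comps = s2(2)[folded m_def]
  have scc: "scc_class E u = C (?c u)" "?c u < m" if "u < n" for u
    using comps_scc_class[OF comps that] by (simp_all add: C)
  \<comment> \<open>Injectivity of \<open>C\<close> needs a member in each class: two empty classes
    would coincide.\<close>
  have nonempty: "\<exists>u<n. ?c u = c" if "c < m" for c
  proof -
    have "narr s2 ''mem'' (narr s2 ''cs'' c) \<in> narr s2 ''mem'' ` {narr s2 ''cs'' c..<narr s2 ''cs'' (Suc c)}"
      using comps that by (simp add: comps_inv_def)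
    thus ?thesis unfolding comps_block[OF comps that] by auto
  qed
  have inj: "inj_on C {..<m}"
  proof (rule inj_onI)
    fix a b assume ab: "a \<in> {..<m}" "b \<in> {..<m}" "C a = C b"
    obtain u where "u < n" "?c u = a" using nonempty ab(1) by auto
    hence "u \<in> C b" using ab(3) by (auto simp: C)
    thus "a = b" using \<open>?c u = a\<close> by (simp add: C)
  qed
  have G: "parcs ?G \<subseteq> pverts ?G \<times> pverts ?G" by (simp add: parcs_input_graph_subset)
  have pK: "pverts ?K = C ` {..<m}"
  proof -
    have "pverts ?K = scc_class E ` {..<n}" by (simp add: pverts_condensation[OF G] V E)
    also have "\<dots> = C ` ?c ` {..<n}" using scc(1) by (auto simp: image_iff)
    also have "?c ` {..<n} = {..<m}" using scc(2) nonempty by force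
    finally show ?thesis .
  qed
  have EV: "u < n" "w < n" if "(u, w) \<in> E" for u w
    using subsetD[OF parcs_input_graph_subset that[unfolded E]] by (simp_all add: V)
  have Ceq: "C (?c u) = C (?c w) \<longleftrightarrow> ?c u = ?c w" if "u < n" "w < n" for u w
    using inj_on_eq_iff[OF inj] scc(2) that by simp
  have aK: "parcs ?K = {(C (?c u), C (?c w)) | u w. (u, w) \<in> E \<and> ?c u \<noteq> ?c w}"
  proof -
    have "parcs ?K = {(scc_class E u, scc_class E w) | u w. (u, w) \<in> E \<and> scc_class E u \<noteq> scc_class E w}"
      by (simp add: parcs_condensation[OF G] E)
    also have "\<dots> = {(C (?c u), C (?c w)) | u w. (u, w) \<in> E \<and> ?c u \<noteq> ?c w}"
      using scc(1) EV Ceq by (intro Collect_cong) (metis (no_types, lifting))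
    finally show ?thesis .
  qed
  have bij: "bij_betw C {..<m} (pverts ?K)" using inj by (simp add: bij_betw_def pK)
  have arcs: "map_prod C C ` listed_edges s2 ''cond'' = parcs ?K"
    unfolding aK s2(3) by force
  have "wp order_components s2 (\<lambda>t s'. (\<forall>i<m. narr s' ''order'' i = m - 1 - i) \<and>
      frame order_components s2 s' \<and> t \<le> 20 * m + 10)"
    by (rule wp_order_components) (simp add: m_def)
  then obtain t3 s3 where s3: "exec order_components s2 t3 s3" "\<And>i. i < m \<Longrightarrow> narr s3 ''order'' i = m - 1 - i"
    "frame order_components s2 s3" "t3 \<le> 20 * m + 10"
    unfolding wp_def by blast
  note fr3 = frameD[OF s3(3), unfolded order_components_def, simplified]
  define Vs where "Vs = map (\<lambda>i. C (narr s3 ''order'' i)) [0..<m]"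
  \<comment> \<open>\<open>foldr\<close> over \<open>Vs\<close> becomes \<open>fold\<close> over the
    components by increasing number, the order of the loop of step 4.\<close>
  have Vs: "rev Vs = map C [0..<m]"
    by (rule nth_equalityI) (auto simp: Vs_def rev_nth s3(2))
  have Vs_nth: "Vs ! i = C (m - 1 - i)" if "i < m" for i using that by (simp add: Vs_def s3(2))
  have top: "topological_ordering ?K Vs"
    unfolding topological_ordering_def
  proof (intro conjI allI impI)
    have "distinct (rev Vs)" unfolding Vs using inj by (simp add: distinct_map atLeast0LessThan)
    thus "distinct Vs" by simp
    have "set (rev Vs) = C ` {..<m}" unfolding Vs by (simp add: atLeast0LessThan)
    thus "set Vs = pverts ?K" by (simp add: pK)
  next
    fix i j assume "i < length Vs" "j < length Vs" and arc: "(Vs ! i, Vs ! j) \<in> parcs ?K"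
    hence ij: "i < m" "j < m" by (simp_all add: Vs_def)
    obtain u w where uw: "(u, w) \<in> E" "?c u \<noteq> ?c w" "C (m - 1 - i) = C (?c u)" "C (m - 1 - j) = C (?c w)"
      using arc unfolding aK Vs_nth[OF ij(1)] Vs_nth[OF ij(2)] by auto
    \<comment> \<open>Injectivity recovers the component numbers from the classes; the edge goes to
      a smaller number, and \<open>m - 1 - i\<close> reverses the order.\<close>
    have "m - 1 - i = ?c u" "m - 1 - j = ?c w"
      using inj_onD[OF inj uw(3)] inj_onD[OF inj uw(4)] scc(2) EV[OF uw(1)] ij by simp_all
    moreover have "?c w < ?c u"
      using comps_scc_class(3)[OF comps EV(1)[OF uw(1)] uw(1)] uw(2) by simp
    ultimately show "i < j" using ij by simp
  qed
  have inp3: "input_mem s3 I x" "dual_mem s3 I d"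
    using s1(4,5) input_mem_frame[OF s2(5)] input_mem_frame[OF s3(3)]
      dual_mem_frame[OF s2(5)] dual_mem_frame[OF s3(3)]
    by (simp_all add: unf2 order_components_def)
  have ingoing: "(\<exists>B. (B, C c) \<in> parcs ?K) \<longleftrightarrow> (\<exists>b. (b, c) \<in> listed_edges s3 ''cond'')" if "c < m" for c
  proof -
    have "listed_edges s3 ''cond'' = listed_edges s2 ''cond''" by (simp add: listed_edges_image fr3)
    moreover have "C (?c w) = C c \<longleftrightarrow> ?c w = c" if "w < n" for w
      using inj_on_eq_iff[OF inj] scc(2)[OF that] \<open>c < m\<close> by simp
    ultimately show ?thesis unfolding aK s2(3) using EV(2) by simp blast
  qed
  have "wp update_components s3 (\<lambda>t s'. dual_mem s' I (fold (process_component I x ?K) (map C [0..<m]) d) \<and>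
      t \<le> 20 * nvar s3 ''cond_size'' + 500 * (narr s3 ''first'' n + n) + 100)"
  proof (rule wp_update_components[OF inp3, where m = m and V = C and K = ?K])
    show "nvar s3 ''n'' = n" by (simp add: fr3 fr2 s1(2))
    show "comps_inv {..<n} (narr s3 ''comp'') m (narr s3 ''cs'') (narr s3 ''mem'') n"
      using comps by (simp add: fr3)
    show "nvar s3 ''comp_count'' = m" by (simp add: fr3 m_def)
    show "C = (\<lambda>c. {v \<in> vertices I. narr s3 ''comp'' v = c})" by (auto simp: fun_eq_iff C V fr3)
  qed (use s3(2) ingoing in auto)
  then obtain t4 s4 where s4: "exec update_components s3 t4 s4"
    "dual_mem s4 I (fold (process_component I x ?K) (map C [0..<m]) d)"
    "t4 \<le> 20 * nvar s3 ''cond_size'' + 500 * (narr s3 ''first'' n + n) + 100"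
    unfolding wp_def by blast
  have out: "process_all I x ?K Vs d = fold (process_component I x ?K) (map C [0..<m]) d"
    unfolding process_all_def foldr_conv_fold Vs ..
  have run: "runs_algorithm_A build_graph find_components order_components update_components s I d x
      (t1 + t2 + t3 + t4)"
    unfolding runs_algorithm_A_def Let_def
  proof (intro exI conjI)
    show "exec build_graph s t1 s1" "exec find_components s1 t2 s2" "exec order_components s2 t3 s3"
      "exec update_components s3 t4 s4"
      by (fact s1(1) s2(1) s3(1) s4(1))+
    show "listed_edges s1 ''F'' = parcs ?G" by (fact s1(8))
    show "bij_betw (component_of_index s2 I) {..<nvar s2 ''comp_count''} (pverts ?K)"
      using bij by (simp only: C_def m_def)
    show "map_prod (component_of_index s2 I) (component_of_index s2 I) ` listed_edges s2 ''cond'' = parcs ?K"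
      using arcs by (simp only: C_def)
    show "Vs = map (\<lambda>i. component_of_index s2 I (narr s3 ''order'' i)) [0..<nvar s2 ''comp_count'']"
      by (simp only: Vs_def C_def m_def)
    show "topological_ordering ?K Vs" by (fact top)
    show "process_all I x ?K Vs d = process_all I x ?K Vs d" ..
    show "\<forall>v\<in>vertices I. rarr s4 ''alpha'' v = fst (process_all I x ?K Vs d) v"
      "\<forall>l\<in>labels I. rarr s4 ''beta'' l = snd (process_all I x ?K Vs d) l"
      using s4(2) unfolding out dual_mem_def by blast+
    show "t1 + t2 + t3 + t4 = t1 + t2 + t3 + t4" ..
  qed
  have size: "(\<Sum>v\<in>vertices I. card (allowed I v)) = narr s ''first'' n" "n \<le> narr s ''first'' n"
    using encodes_input_size[OF ax enc] by (simp_all add: n_def)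
  have "m \<le> n" by (rule comps_count[OF comps])
  moreover have "narr s3 ''first'' = narr s ''first''" by (simp add: fr3 fr2 s1(3))
  moreover have "nvar s3 ''cond_size'' \<le> fs n" using s2(4) by (simp add: fr3)
  \<comment> \<open>With \<open>n\<close>, \<open>m\<close> and the numbers of edges bounded by the
    input size \<open>N\<close>, the four bounds add up to at most \<open>2392 * N + 236\<close>.
    The maximum with 1 absorbs the constant on the empty instance.\<close>
  ultimately have "t1 + t2 + t3 + t4 \<le> 3000 * max 1 (\<Sum>v\<in>vertices I. card (allowed I v))"
    using s1(7,9) s2(6) s3(4) s4(3) size fs(2) by simp
  thus ?thesis using run by blast
qed

theorem theorem4:
  shows
    "(\<forall>(I :: ('v::finite, 'l::finite) lap) d x.
        lap_instance I \<and> lap_feasible I \<and> dual_optimal I d \<and> optimal_assignment I x \<longrightarrow>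
        (\<exists>d'. algorithm_A I d x d') \<and>
        (\<forall>d'. algorithm_A I d x d' \<longrightarrow>
           dual_optimal I d' \<and>
           dual_vec I d' \<in> rel_interior (dual_vec I ` {e. dual_optimal I e})))
     \<and>
     (\<exists>P1 P2 P3 P4 (C :: nat). \<forall>(I :: (nat, nat) lap) Ls d x s.
        lap_instance I \<and> lap_feasible I \<and> dual_optimal I d \<and> optimal_assignment I x \<and>
        encodes_input s I Ls d x \<longrightarrow>
        (\<exists>t. runs_algorithm_A P1 P2 P3 P4 s I d x t \<and>
             t \<le> C * max 1 (\<Sum>v\<in>vertices I. card (allowed I v))))"
proof (intro conjI allI impI)
  fix I :: "('v, 'l) lap" and d x
  assume "lap_instance I \<and> lap_feasible I \<and> dual_optimal I d \<and> optimal_assignment I x"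
  thus "\<exists>d'. algorithm_A I d x d'" by (intro algorithm_A_exists) simp
next
  fix I :: "('v, 'l) lap" and d x d'
  assume "lap_instance I \<and> lap_feasible I \<and> dual_optimal I d \<and> optimal_assignment I x"
    and d': "algorithm_A I d x d'"
  hence asm: "lap_instance I" "dual_optimal I d" "optimal_assignment I x" by auto
  show "dual_optimal I d'" by (rule algorithm_A_optimal[OF asm d'])
  show "dual_vec I d' \<in> rel_interior (dual_vec I ` {e. dual_optimal I e})"
    by (rule dual_vec_in_rel_interior[OF asm(1) algorithm_A_optimal[OF asm d'] asm(3)])
      (rule algorithm_A_tight[OF asm d'])
next
  show "\<exists>P1 P2 P3 P4 (C :: nat). \<forall>(I :: (nat, nat) lap) Ls d x s.
        lap_instance I \<and> lap_feasible I \<and> dual_optimal I d \<and> optimal_assignment I x \<and>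
        encodes_input s I Ls d x \<longrightarrow>
        (\<exists>t. runs_algorithm_A P1 P2 P3 P4 s I d x t \<and>
             t \<le> C * max 1 (\<Sum>v\<in>vertices I. card (allowed I v)))"
    using program_correct unfolding optimal_assignment_def by blast
qed

end
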